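(* Let $\mathcal{P}$ be a radical parametrization in $n$ parameters, given with a fixed representation as in the context, and let $\mathcal{A}_\mathcal{P}$, $\mathcal{B}_\mathcal{P}$, $\mathcal{V}_\mathcal{P}$ be its auxiliary, incidence and radical varieties. Then: (i) every irreducible component of $\mathcal{A}_\mathcal{P}$ has dimension $n$; (ii) $\mathcal{B}_\mathcal{P}$ is irreducible and has dimension $n$; (iii) $\mathcal{V}_\mathcal{P}$ is irreducible and has dimension $n$.
   Context: Let $\overline{t}=(t_1,\dots,t_n)$. A radical tower over $\mathbb{C}(\overline{t})$ is a tower of fields $\mathbb{F}_0=\mathbb{C}(\overline{t})\subseteq\mathbb{F}_1\subseteq\dots\subseteq\mathbb{F}_m$ with $\mathbb{F}_i=\mathbb{F}_{i-1}(\delta_i)$, where $\delta_i^{e_i}=\alpha_i\in\mathbb{F}_{i-1}$, $e_i\in\mathbb{N}$. A radical parametrization $\mathcal{P}$ is a tuple $\overline{x}=(x_1,\dots,x_r)$ of elements of $\mathbb{F}_m$, with $r>n$, whose Jacobian with respect to $\overline{t}$ (using the unique extensions of the derivations $\partial/\partial t_i$ to $\mathbb{F}_m$) has rank $n$; the $\delta_i$ are realized as analytic functions $\delta_i(\overline{t})$ by fixing values $\delta_i(\overline{t}_0)=a_i$ at some point $\overline{t}_0$ (choice of branches), so that $\overline{x}(\overline{t})$ is well defined. A representation of $\mathcal{P}$ consists of the tower together with polynomials such that $\alpha_1=\alpha_{1N}(\overline{t})/\alpha_{1D}(\overline{t})$, $\alpha_i=\alpha_{iN}(\overline{t},\delta_1,\dots,\delta_{i-1})/\alpha_{iD}(\overline{t},\delta_1,\dots,\delta_{i-1})$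 for $i=2,\dots,m$, and $x_j=x_{jN}(\overline{t},\overline{\delta})/x_{jD}(\overline{t},\overline{\delta})$ for $j=1,\dots,r$, where $\overline{\delta}=(\delta_1,\dots,\delta_m)$. Let $\varphi:\mathbb{C}^n\to\mathbb{C}^{n+m+r}$, $\overline{t}\mapsto(\overline{t},\overline{\delta}(\overline{t}),\overline{x}(\overline{t}))$. The incidence variety is $\mathcal{B}_\mathcal{P}=\overline{\mathrm{Im}(\varphi)}$ (Zariski closure). Let $\pi:\mathcal{B}_\mathcal{P}\to\mathbb{C}^r$, $(\overline{t},\overline{\delta},\overline{x})\mapsto\overline{x}$; the radical variety is $\mathcal{V}_\mathcal{P}=\overline{\pi(\mathcal{B}_\mathcal{P})}\subset\mathbb{C}^r$. In $\mathbb{C}[\overline{T},\overline{\Delta},\overline{X},Z]$ define $E_i=\Delta_i^{e_i}\alpha_{iD}(\overline{T},\Delta_1,\dots,\Delta_{i-1})-\alpha_{iN}(\overline{T},\Delta_1,\dots,\Delta_{i-1})$ ($i=1,\dots,m$), $G_j=X_jx_{jD}(\overline{T},\overline{\Delta})-x_{jN}(\overline{T},\overline{\Delta})$ ($j=1,\dots,r$), and $G_Z=Z\cdot\mathrm{lcm}(x_{1D},\dots,x_{rD},\alpha_{1D},\dots,\alpha_{mD})-1$. The auxiliary variety $\mathcal{A}_\mathcal{P}\subset\mathbb{C}^{n+m+r}$ is the Zariski closure of the projection of $V(E_1,\dots,E_m,G_1,\dots,G_r,G_Z)\subset\mathbb{C}^{n+m+r+1}$ forgetting the last coordinate $Z$.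 *)

theory Defs
  imports "HOL-Analysis.Analysis"
begin

datatype 'v mpx = Const complex | Var 'v | Add "'v mpx" "'v mpx" | Mul "'v mpx" "'v mpx"

fun meval :: "'v mpx \<Rightarrow> ('v \<Rightarrow> complex) \<Rightarrow> complex" where
  "meval (Const c) p = c"
| "meval (Var v) p = p v"
| "meval (Add f g) p = meval f p + meval g p"
| "meval (Mul f g) p = meval f p * meval g p"

fun mvars :: "'v mpx \<Rightarrow> 'v set" where
  "mvars (Const c) = {}"
| "mvars (Var v) = {v}"
| "mvars (Add f g) = mvars f \<union> mvars g"
| "mvars (Mul f g) = mvars f \<union> mvars g"

definition msub :: "'v mpx \<Rightarrow> 'v mpx \<Rightarrow> 'v mpx" where
  "msub f g = Add f (Mul (Const (-1)) g)"

fun mpow :: "'v mpx \<Rightarrow> nat \<Rightarrow> 'v mpx" where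
  "mpow f 0 = Const 1"
| "mpow f (Suc k) = Mul f (mpow f k)"

definition mprod :: "'v mpx list \<Rightarrow> 'v mpx" where
  "mprod fs = foldr Mul fs (Const 1)"

definition aspace :: "'v set \<Rightarrow> ('v \<Rightarrow> complex) set" where
  "aspace I = {p. \<forall>v. v \<notin> I \<longrightarrow> p v = 0}"

definition zset :: "'v set \<Rightarrow> 'v mpx set \<Rightarrow> ('v \<Rightarrow> complex) set" where
  "zset I F = {p \<in> aspace I. \<forall>f\<in>F. meval f p = 0}"

definition zclosed :: "'v set \<Rightarrow> ('v \<Rightarrow> complex) set \<Rightarrow> bool" where
  "zclosed I S \<longleftrightarrow> (\<exists>F. (\<forall>f\<in>F. mvars f \<subseteq> I) \<and> S = zset I F)"

definition zclosure :: "'v set \<Rightarrow> ('v \<Rightarrow> complex) set \<Rightarrow> ('v \<Rightarrow> complex) set" where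
  "zclosure I S = \<Inter>{C. zclosed I C \<and> S \<subseteq> C}"

definition zirreducible :: "'v set \<Rightarrow> ('v \<Rightarrow> complex) set \<Rightarrow> bool" where
  "zirreducible I S \<longleftrightarrow> zclosed I S \<and> S \<noteq> {} \<and>
     (\<forall>A B. zclosed I A \<and> zclosed I B \<and> S = A \<union> B \<longrightarrow> S = A \<or> S = B)"

definition zchain :: "'v set \<Rightarrow> ('v \<Rightarrow> complex) set \<Rightarrow> nat \<Rightarrow> (nat \<Rightarrow> ('v \<Rightarrow> complex) set) \<Rightarrow> bool" where
  "zchain I X k Z \<longleftrightarrow> (\<forall>i\<le>k. zirreducible I (Z i) \<and> Z i \<subseteq> X) \<and> (\<forall>i<k. Z i \<subset> Z (Suc i))"

definition zdim :: "'v set \<Rightarrow> ('v \<Rightarrow> complex) set \<Rightarrow> nat \<Rightarrow> bool" where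
  "zdim I X d \<longleftrightarrow> (\<exists>Z. zchain I X d Z) \<and> \<not> (\<exists>Z. zchain I X (Suc d) Z)"

definition zcomponent :: "'v set \<Rightarrow> ('v \<Rightarrow> complex) set \<Rightarrow> ('v \<Rightarrow> complex) set \<Rightarrow> bool" where
  "zcomponent I X C \<longleftrightarrow> zirreducible I C \<and> C \<subseteq> X \<and>
     (\<forall>C'. zirreducible I C' \<and> C \<subseteq> C' \<and> C' \<subseteq> X \<longrightarrow> C' = C)"

definition proj :: "'v set \<Rightarrow> ('v \<Rightarrow> complex) \<Rightarrow> ('v \<Rightarrow> complex)" where
  "proj I p = (\<lambda>v. if v \<in> I then p v else 0)"

definition holo_on :: "(complex^'n \<Rightarrow> complex) \<Rightarrow> (complex^'n) set \<Rightarrow> bool" where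
  "holo_on f U \<longleftrightarrow> (\<forall>t\<in>U. \<exists>L. (f has_derivative L) (at t) \<and> (\<forall>c z. L (c *s z) = c * L z))"

text \<open>Coordinates: T k (parameters), D i (radicals Delta_i, 0-based), X j (x_j, 0-based), Z.\<close>
datatype 'n coord = Tc 'n | Dc nat | Xc nat | Zc

definition rp_env :: "nat \<Rightarrow> (nat \<Rightarrow> complex^'n \<Rightarrow> complex) \<Rightarrow> complex^'n \<Rightarrow> 'n coord \<Rightarrow> complex" where
  "rp_env m \<delta> t = (\<lambda>v. case v of Tc k \<Rightarrow> t $ k | Dc i \<Rightarrow> (if i < m then \<delta> i t else 0) | _ \<Rightarrow> 0)"

definition rp_x :: "nat \<Rightarrow> (nat \<Rightarrow> complex^'n \<Rightarrow> complex) \<Rightarrow> (nat \<Rightarrow> 'n coord mpx) \<Rightarrow> (nat \<Rightarrow> 'n coord mpx)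
    \<Rightarrow> nat \<Rightarrow> complex^'n \<Rightarrow> complex" where
  "rp_x m \<delta> xN xD j t = meval (xN j) (rp_env m \<delta> t) / meval (xD j) (rp_env m \<delta> t)"

definition coordsA :: "nat \<Rightarrow> nat \<Rightarrow> 'n coord set" where
  "coordsA m r = range Tc \<union> Dc ` {..<m} \<union> Xc ` {..<r}"

definition coordsX :: "nat \<Rightarrow> 'n coord set" where
  "coordsX r = Xc ` {..<r}"

definition rp_phi :: "nat \<Rightarrow> nat \<Rightarrow> (nat \<Rightarrow> complex^'n \<Rightarrow> complex) \<Rightarrow> (nat \<Rightarrow> 'n coord mpx)
    \<Rightarrow> (nat \<Rightarrow> 'n coord mpx) \<Rightarrow> complex^'n \<Rightarrow> 'n coord \<Rightarrow> complex" where
  "rp_phi m r \<delta> xN xD t = (\<lambda>v. case v of Tc k \<Rightarrow> t $ k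
      | Dc i \<Rightarrow> (if i < m then \<delta> i t else 0)
      | Xc j \<Rightarrow> (if j < r then rp_x m \<delta> xN xD j t else 0)
      | Zc \<Rightarrow> 0)"

definition rp_E :: "(nat \<Rightarrow> nat) \<Rightarrow> (nat \<Rightarrow> 'n coord mpx) \<Rightarrow> (nat \<Rightarrow> 'n coord mpx) \<Rightarrow> nat \<Rightarrow> 'n coord mpx" where
  "rp_E e aN aD i = msub (Mul (mpow (Var (Dc i)) (e i)) (aD i)) (aN i)"

definition rp_G :: "(nat \<Rightarrow> 'n coord mpx) \<Rightarrow> (nat \<Rightarrow> 'n coord mpx) \<Rightarrow> nat \<Rightarrow> 'n coord mpx" where
  "rp_G xN xD j = msub (Mul (Var (Xc j)) (xD j)) (xN j)"

text \<open>G_Z uses the product of all denominators in place of their lcm (same zero set).\<close>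
definition rp_GZ :: "nat \<Rightarrow> nat \<Rightarrow> (nat \<Rightarrow> 'n coord mpx) \<Rightarrow> (nat \<Rightarrow> 'n coord mpx) \<Rightarrow> 'n coord mpx" where
  "rp_GZ m r aD xD = msub (Mul (Var Zc) (mprod (map xD [0..<r] @ map aD [0..<m]))) (Const 1)"

definition auxiliary_variety :: "nat \<Rightarrow> nat \<Rightarrow> (nat \<Rightarrow> nat) \<Rightarrow> (nat \<Rightarrow> 'n coord mpx) \<Rightarrow> (nat \<Rightarrow> 'n coord mpx)
    \<Rightarrow> (nat \<Rightarrow> 'n coord mpx) \<Rightarrow> (nat \<Rightarrow> 'n coord mpx) \<Rightarrow> ('n coord \<Rightarrow> complex) set" where
  "auxiliary_variety m r e aN aD xN xD =
     zclosure (coordsA m r)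
       (proj (coordsA m r) ` zset (insert Zc (coordsA m r))
          (rp_E e aN aD ` {..<m} \<union> rp_G xN xD ` {..<r} \<union> {rp_GZ m r aD xD}))"

definition incidence_variety :: "nat \<Rightarrow> nat \<Rightarrow> (complex^'n) set \<Rightarrow> (nat \<Rightarrow> complex^'n \<Rightarrow> complex)
    \<Rightarrow> (nat \<Rightarrow> 'n coord mpx) \<Rightarrow> (nat \<Rightarrow> 'n coord mpx) \<Rightarrow> ('n coord \<Rightarrow> complex) set" where
  "incidence_variety m r U \<delta> xN xD =
     zclosure (coordsA m r)
       (rp_phi m r \<delta> xN xD ` {t \<in> U. \<forall>j<r. meval (xD j) (rp_env m \<delta> t) \<noteq> 0})"

definition radical_variety :: "nat \<Rightarrow> nat \<Rightarrow> (complex^'n) set \<Rightarrow> (nat \<Rightarrow> complex^'n \<Rightarrow> complex)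
    \<Rightarrow> (nat \<Rightarrow> 'n coord mpx) \<Rightarrow> (nat \<Rightarrow> 'n coord mpx) \<Rightarrow> ('n coord \<Rightarrow> complex) set" where
  "radical_variety m r U \<delta> xN xD =
     zclosure (coordsX r) (proj (coordsX r) ` incidence_variety m r U \<delta> xN xD)"

end

theory Submission
  imports Defs "HOL-Complex_Analysis.Complex_Analysis" "HOL-Library.Function_Algebras"
    "HOL-Computational_Algebra.Fundamental_Theorem_Algebra"
begin

text \<open>Dimensions are bounded from above by counting: along a strict chain of \<open>k + 1\<close> irreducible
  sets the Hilbert function of the largest grows at least like \<open>s^k\<close>, whereas the equations
  \<open>E_i\<close> and \<open>G_j\<close> allow every radical and every \<open>x_j\<close> to be eliminated, so the Hilbert function on
  the points with nonvanishing denominators is \<open>O(s^n)\<close>. From below, \<open>n\<close> algebraically independent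
  coordinates on an irreducible set yield a chain of length \<open>n\<close>: fix one coordinate, decompose the
  slice, and use that generic points lift along coordinate projections. The parameters are
  independent on the incidence variety by the identity theorem, which also gives its
  irreducibility. They are independent on a component of the auxiliary variety because a
  polynomial in \<open>t\<close> vanishing there would be a zero divisor, which continuity of roots excludes.
  On the radical variety, \<open>n\<close> of the \<open>x_j\<close> with invertible Jacobian have an image with interior.\<close>

subsection \<open>Hilbert's basis theorem\<close>

text \<open>Since \<open>zdim\<close> speaks of chains of irreducible closed sets, an upper bound
  must defeat every chain and a lower bound must exhibit one. Neither side uses transcendence
  degrees or the principal ideal theorem. The upper bound rests on \<open>j choose (n + 1)\<close>
  outgrowing every multiple of \<open>j^n\<close>. The lower bound needs no statement about all
  pieces of a slice, only one irreducible piece on which the remaining coordinates stay independent.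
  Rings are sets of polynomial functions inside one function type; the complex field being infinite,
  a polynomial is zero iff its function is. Eliminating a radical from a function of degree
  \<open>s\<close> costs a factor \<open>D^s\<close> and coefficients of degree proportional to
  \<open>s\<close>: this changes the constant in the growth bound, not the exponent
  \<open>n\<close>. One mismatch has to be repaired: the parametrization is evaluated wherever the
  denominators of the \<open>x_j\<close> are nonzero, whereas the equations also need those of the
  \<open>alpha_i\<close> to be nonzero. Removing the zeros of the latter must be shown not to shrink
  the closure of the image.\<close>

locale subring =
  fixes R :: "'a::comm_ring_1 set"
  assumes one_mem: "1 \<in> R"
    and diff_mem: "a \<in> R \<Longrightarrow> b \<in> R \<Longrightarrow> a - b \<in> R"
    and mult_mem: "a \<in> R \<Longrightarrow> b \<in> R \<Longrightarrow> a * b \<in> R"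
begin

lemma zero_mem: "0 \<in> R"
  using diff_mem[OF one_mem one_mem] by simp

lemma uminus_mem: "a \<in> R \<Longrightarrow> - a \<in> R"
  using diff_mem[OF zero_mem, of a] by simp

lemma add_mem: "a \<in> R \<Longrightarrow> b \<in> R \<Longrightarrow> a + b \<in> R"
  using diff_mem[of a "- b"] uminus_mem by simp

lemma power_mem: "a \<in> R \<Longrightarrow> a ^ n \<in> R"
  by (induction n) (auto intro: one_mem mult_mem)

lemma sum_mem: "(\<And>i. i \<in> A \<Longrightarrow> f i \<in> R) \<Longrightarrow> sum f A \<in> R"
  by (induction A rule: infinite_finite_induct) (auto intro: zero_mem add_mem)

end

definition ideal_of :: "'a::comm_ring_1 set \<Rightarrow> 'a set \<Rightarrow> bool" where
  "ideal_of R S \<longleftrightarrow> S \<subseteq> R \<and> 0 \<in> S \<and> (\<forall>a\<in>S. \<forall>b\<in>S. a + b \<in> S) \<and> (\<forall>r\<in>R. \<forall>a\<in>S. r * a \<in> S)"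

inductive_set ideal_span :: "'a::comm_ring_1 set \<Rightarrow> 'a set \<Rightarrow> 'a set" for R G where
  zero: "0 \<in> ideal_span R G"
| step: "a \<in> ideal_span R G \<Longrightarrow> r \<in> R \<Longrightarrow> g \<in> G \<Longrightarrow> a + r * g \<in> ideal_span R G"

definition noetherian_set :: "'a::comm_ring_1 set \<Rightarrow> bool" where
  "noetherian_set R \<longleftrightarrow> (\<forall>S. ideal_of R S \<longrightarrow> (\<exists>G. finite G \<and> G \<subseteq> S \<and> S \<subseteq> ideal_span R G))"

text \<open>The ring R[y]. Since \<open>y\<close> may be algebraic over \<open>R\<close>, an element
  can have many representing polynomials; leading coefficients therefore belong to \<open>q\<close>
  and not to its value.\<close>

definition adjoin :: "'a::comm_ring_1 set \<Rightarrow> 'a \<Rightarrow> 'a set" where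
  "adjoin R y = {poly q y |q. \<forall>i. coeff q i \<in> R}"

lemma ideal_span_subset:
  assumes "ideal_of R S" "G \<subseteq> S"
  shows "ideal_span R G \<subseteq> S"
proof
  fix a assume "a \<in> ideal_span R G"
  then show "a \<in> S"
    by induction (use assms in \<open>auto simp: ideal_of_def subset_iff\<close>)
qed

lemma ideal_span_add:
  assumes "a \<in> ideal_span R G" "b \<in> ideal_span R G"
  shows "a + b \<in> ideal_span R G"
  using assms(2)
proof induction
  case (step b r g)
  then show ?case using ideal_span.step[of "a + b"] by (simp add: add.assoc)
qed (use assms in simp)

text \<open>In the basis theorem, \<open>P c h\<close> says that \<open>h\<close> is the value of a polynomial with leading
  coefficient \<open>c\<close>.\<close>
lemma ideal_span_lift:
  assumes "c \<in> ideal_span R G" "subring T" "R \<subseteq> T" "z \<in> T" "\<And>g. g \<in> G \<Longrightarrow> F g \<in> H"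
    and add: "\<And>a b c d. P a b \<Longrightarrow> P c d \<Longrightarrow> P (a + c) (b + d)"
    and base: "P 0 0"
    and mult: "\<And>r g. r \<in> R \<Longrightarrow> g \<in> G \<Longrightarrow> P (r * g) (r * z * F g)"
  shows "\<exists>h\<in>ideal_span T H. P c h"
  using assms(1)
proof induction
  case zero
  then show ?case using base ideal_span.zero by blast
next
  case (step a r g)
  then obtain h where h: "h \<in> ideal_span T H" "P a h" by blast
  interpret T: subring T by fact
  have "h + (r * z) * F g \<in> ideal_span T H"
    using h step assms(3-5) by (intro ideal_span.step) (auto intro: T.mult_mem)
  moreover have "P (a + r * g) (h + (r * z) * F g)"
    using h step by (intro add mult) auto
  ultimately show ?case by blast
qed

lemma subring_adjoin:
  assumes "subring R"
  shows "subring (adjoin R y)"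
proof -
  interpret subring R by fact
  show ?thesis
  proof
    show "1 \<in> adjoin R y"
      unfolding adjoin_def
      by (rule CollectI, rule exI[of _ 1]) (auto simp: coeff_1 intro: one_mem zero_mem)
    fix a b assume "a \<in> adjoin R y" "b \<in> adjoin R y"
    then obtain p q where pq: "a = poly p y" "\<forall>i. coeff p i \<in> R" "b = poly q y" "\<forall>i. coeff q i \<in> R"
      unfolding adjoin_def by blast
    show "a - b \<in> adjoin R y"
      unfolding adjoin_def
      by (rule CollectI, rule exI[of _ "p - q"]) (use pq in \<open>auto intro: diff_mem\<close>)
    show "a * b \<in> adjoin R y"
      unfolding adjoin_def
      by (rule CollectI, rule exI[of _ "p * q"])
        (use pq in \<open>auto simp: coeff_mult intro: sum_mem mult_mem\<close>)
  qed
qed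

text \<open>The classical argument by leading coefficients: they form an increasing sequence of
  ideals \<open>L d\<close> of \<open>R\<close>, which becomes constant from some \<open>D\<close>
  on. Lifts of finite generating sets of \<open>L 0\<close>, ..., \<open>L D\<close> generate
  \<open>S\<close>, because every leading term can be cancelled by them.\<close>

theorem hilbert_basis:
  fixes R :: "'a::comm_ring_1 set" and y :: 'a
  assumes R: "subring R" and noeth: "noetherian_set R"
  shows "noetherian_set (adjoin R y)"
  unfolding noetherian_set_def
proof (intro allI impI)
  fix S assume S: "ideal_of (adjoin R y) S"
  interpret subring R by fact
  define T where "T = adjoin R y"
  interpret T: subring T unfolding T_def using R by (rule subring_adjoin)
  have RT: "R \<subseteq> T"
  proof
    fix c assume "c \<in> R"
    then show "c \<in> T" unfolding T_def adjoin_def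
      by (intro CollectI exI[of _ "[:c:]"]) (auto simp: coeff_pCons zero_mem split: nat.split)
  qed
  have yT: "y \<in> T" unfolding T_def adjoin_def
    by (intro CollectI exI[of _ "[:0, 1:]"]) (auto simp: coeff_pCons zero_mem one_mem split: nat.split)
  have S0: "0 \<in> S" and Sadd: "\<And>a b. a \<in> S \<Longrightarrow> b \<in> S \<Longrightarrow> a + b \<in> S"
    and Smult: "\<And>r a. r \<in> T \<Longrightarrow> a \<in> S \<Longrightarrow> r * a \<in> S" and ST: "S \<subseteq> T"
    using S unfolding ideal_of_def T_def by auto
  \<comment> \<open>The coefficient at \<open>d\<close> is allowed to be zero; otherwise
    \<open>Q d\<close>, and with it \<open>L d\<close>, would not be closed under addition.\<close>
  define Q where "Q d = {q. (\<forall>i. coeff q i \<in> R) \<and> (\<forall>i>d. coeff q i = 0) \<and> poly q y \<in> S}" for d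
  define L where "L d = (\<lambda>q. coeff q d) ` Q d" for d
  have Qadd: "p + q \<in> Q d" if "p \<in> Q d" "q \<in> Q d" for p q d
    using that unfolding Q_def by (auto intro: add_mem Sadd)
  have Qsmult: "smult r p \<in> Q d" if "p \<in> Q d" "r \<in> R" for p r d
    using that RT unfolding Q_def by (auto intro!: mult_mem Smult)
  have Qshift: "monom 1 k * p \<in> Q (d + k)" if "p \<in> Q d" for p d k
    using that unfolding Q_def
    by (auto simp: coeff_monom_mult poly_monom zero_mem intro!: Smult T.power_mem yT)
  have L_ideal: "ideal_of R (L d)" for d
    unfolding ideal_of_def
  proof (intro conjI ballI)
    show "L d \<subseteq> R" unfolding L_def Q_def by auto
    have "0 \<in> Q d" unfolding Q_def by (auto simp: zero_mem S0)
    then show "0 \<in> L d" unfolding L_def by force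
    fix a assume "a \<in> L d"
    then obtain p where p: "p \<in> Q d" "a = coeff p d" unfolding L_def by auto
    show "a + b \<in> L d" if "b \<in> L d" for b
    proof -
      from that obtain q where q: "q \<in> Q d" "b = coeff q d" unfolding L_def by auto
      show ?thesis unfolding L_def using Qadd[OF p(1) q(1)] p q by (metis coeff_add image_eqI)
    qed
    show "r * a \<in> L d" if "r \<in> R" for r
      unfolding L_def using Qsmult[OF p(1) that] p by (metis coeff_smult image_eqI)
  qed
  have L_mono: "L d \<subseteq> L (d + k)" for d k
  proof
    fix a assume "a \<in> L d"
    then obtain p where p: "p \<in> Q d" "a = coeff p d" unfolding L_def by auto
    have "coeff (monom 1 k * p) (d + k) = a" using p by (simp add: coeff_monom_mult)
    then show "a \<in> L (d + k)" unfolding L_def using Qshift[OF p(1), of k] by (metis image_eqI)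
  qed
  have L_mono': "L d \<subseteq> L e" if "d \<le> e" for d e
    using L_mono[of d "e - d"] that by simp
  have "ideal_of R (\<Union>d. L d)"
    unfolding ideal_of_def
  proof (intro conjI ballI)
    show "(\<Union>d. L d) \<subseteq> R" "0 \<in> (\<Union>d. L d)" using L_ideal unfolding ideal_of_def by blast+
    fix a assume "a \<in> (\<Union>d. L d)"
    then obtain d where d: "a \<in> L d" by auto
    show "r * a \<in> (\<Union>d. L d)" if "r \<in> R" for r using L_ideal[of d] that d unfolding ideal_of_def by blast
    show "a + b \<in> (\<Union>d. L d)" if "b \<in> (\<Union>d. L d)" for b
    proof -
      from that obtain e where "b \<in> L e" by auto
      then have "a \<in> L (max d e)" "b \<in> L (max d e)" using d L_mono'[of d "max d e"] L_mono'[of e "max d e"] by auto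
      then show ?thesis using L_ideal[of "max d e"] unfolding ideal_of_def by blast
    qed
  qed
  then obtain G0 where G0: "finite G0" "G0 \<subseteq> (\<Union>d. L d)" "(\<Union>d. L d) \<subseteq> ideal_span R G0"
    using noeth unfolding noetherian_set_def by meson
  have "\<exists>D. G0 \<subseteq> L D" using G0(1,2)
  proof induction
    case (insert g F)
    then obtain D d where "F \<subseteq> L D" "g \<in> L d" by auto
    then have "insert g F \<subseteq> L (max D d)"
      using L_mono'[of d "max D d"] L_mono'[of D "max D d"] by auto
    then show ?case by blast
  qed simp
  then obtain D where D: "G0 \<subseteq> L D" by blast
  have "\<exists>G. finite G \<and> G \<subseteq> L d \<and> L d \<subseteq> ideal_span R G" for d
    using noeth L_ideal unfolding noetherian_set_def by meson
  then obtain G where G: "\<And>d. finite (G d)" "\<And>d. G d \<subseteq> L d" "\<And>d. L d \<subseteq> ideal_span R (G d)"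
    by metis
  define F where "F d g = (SOME q. q \<in> Q d \<and> coeff q d = g)" for d g
  have F: "F d g \<in> Q d \<and> coeff (F d g) d = g" if "g \<in> L d" for d g
    unfolding F_def by (rule someI_ex) (use that in \<open>auto simp: L_def\<close>)
  have LD: "L n \<subseteq> L D" for n
  proof -
    have "L n \<subseteq> ideal_span R G0" using G0(3) by blast
    also have "\<dots> \<subseteq> L D" using ideal_span_subset[OF L_ideal D] .
    finally show ?thesis .
  qed
  define H where "H = (\<Union>d\<in>{..D}. (\<lambda>g. poly (F d g) y) ` G d)"
  have "finite H" unfolding H_def using G(1) by auto
  moreover have HS: "H \<subseteq> S" unfolding H_def using F G(2) Q_def by blast
  moreover have main: "poly q y \<in> ideal_span T H" if "(\<forall>i. coeff q i \<in> R) \<and> (\<forall>i\<ge>n. coeff q i = 0) \<and> poly q y \<in> S" for q n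
    using that
  proof (induction n arbitrary: q)
    case 0
    then have "q = 0" by (auto simp: poly_eq_iff)
    then show ?case by (simp add: ideal_span.zero)
  next
    case (Suc n)
    \<comment> \<open>Above \<open>D\<close> no new leading coefficients occur, so the generators of
      degree \<open>D\<close>, shifted by \<open>y ^ (n - D)\<close>, cancel the term of degree
      \<open>n\<close>.\<close>
    define d where "d = min n D"
    have "q \<in> Q n" using Suc.prems unfolding Q_def by (auto simp: Suc_le_eq)
    then have "coeff q n \<in> L n" unfolding L_def by auto
    then have "coeff q n \<in> L d" unfolding d_def using LD[of n] by (auto simp: min_def)
    then have span: "coeff q n \<in> ideal_span R (G d)" using G(3) by blast
    define P where "P a b \<longleftrightarrow> (\<exists>p\<in>Q n. coeff p n = a \<and> poly p y = b)" for a b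
    have "\<exists>h\<in>ideal_span T H. P (coeff q n) h"
    proof (rule ideal_span_lift[where z = "y ^ (n - d)" and F = "\<lambda>g. poly (F d g) y", OF span T.subring_axioms RT T.power_mem[OF yT]])
      show "poly (F d g) y \<in> H" if "g \<in> G d" for g unfolding H_def d_def using that d_def by auto
      show "P (a + c) (b + e)" if "P a b" "P c e" for a b c e
      proof -
        from that obtain p p' where "p \<in> Q n" "coeff p n = a" "poly p y = b" "p' \<in> Q n" "coeff p' n = c" "poly p' y = e"
          unfolding P_def by blast
        then show ?thesis unfolding P_def using Qadd[of p n p'] by (intro bexI[of _ "p + p'"]) auto
      qed
      show "P 0 0" unfolding P_def by (intro bexI[of _ 0]) (auto simp: Q_def zero_mem S0)
      fix r g assume rg: "r \<in> R" "g \<in> G d"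
      have "F d g \<in> Q d" "coeff (F d g) d = g" using F G(2) rg by blast+
      moreover have "d \<le> n" unfolding d_def by simp
      ultimately show "P (r * g) (r * y ^ (n - d) * poly (F d g) y)"
        unfolding P_def using Qsmult[OF Qshift[of "F d g" d "n - d"] rg(1)]
        by (intro bexI[of _ "smult r (monom 1 (n - d) * F d g)"])
          (auto simp: coeff_monom_mult poly_monom mult.assoc)
    qed
    then obtain p where p: "p \<in> Q n" "coeff p n = coeff q n" "poly p y \<in> ideal_span T H"
      unfolding P_def by blast
    have "poly (q - p) y \<in> ideal_span T H"
    proof (rule Suc.IH, intro conjI allI impI)
      show "coeff (q - p) i \<in> R" for i using Suc.prems p(1) unfolding Q_def by (auto intro: diff_mem)
      show "coeff (q - p) i = 0" if "i \<ge> n" for i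
        using Suc.prems p that unfolding Q_def by (cases "i = n") auto
      have "poly p y \<in> S" using p(1) unfolding Q_def by auto
      then have "- 1 * poly p y \<in> S" by (intro Smult T.uminus_mem T.one_mem)
      then have "poly q y + - 1 * poly p y \<in> S" using Suc.prems by (intro Sadd) auto
      then show "poly (q - p) y \<in> S" by simp
    qed
    from ideal_span_add[OF this p(3)] show ?case by simp
  qed
  moreover have "S \<subseteq> ideal_span T H"
  proof
    fix s assume "s \<in> S"
    then obtain q where q: "\<forall>i. coeff q i \<in> R" "s = poly q y" using ST unfolding T_def adjoin_def by blast
    show "s \<in> ideal_span T H"
      using main[of q "Suc (degree q)"] q \<open>s \<in> S\<close> by (auto simp: coeff_eq_0)
  qed
  ultimately show "\<exists>G. finite G \<and> G \<subseteq> S \<and> S \<subseteq> ideal_span (adjoin R y) G"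
    unfolding T_def by blast
qed

subsection \<open>Polynomial functions and the Zariski topology\<close>

fun mdeg :: "'v mpx \<Rightarrow> nat" where
  "mdeg (Const c) = 0"
| "mdeg (Var v) = 1"
| "mdeg (Add f g) = max (mdeg f) (mdeg g)"
| "mdeg (Mul f g) = mdeg f + mdeg g"

text \<open>A filtration by the formal degree of some representing expression. Expressions of the
  same function may differ in \<open>mdeg\<close>, so membership bounds the degree from above
  only.\<close>

definition dpol :: "'v set \<Rightarrow> nat \<Rightarrow> (('v \<Rightarrow> complex) \<Rightarrow> complex) set" where
  "dpol K s = {meval f |f. mvars f \<subseteq> K \<and> mdeg f \<le> s}"

definition pfun :: "'v set \<Rightarrow> (('v \<Rightarrow> complex) \<Rightarrow> complex) set" where
  "pfun K = {meval f |f. mvars f \<subseteq> K}"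

abbreviation vanishes :: "('p \<Rightarrow> complex) \<Rightarrow> 'p set \<Rightarrow> bool" where
  "vanishes f X \<equiv> \<forall>p\<in>X. f p = 0"

lemma dpol_const: "(\<lambda>p. c) \<in> dpol K s"
  unfolding dpol_def by (rule CollectI, rule exI[of _ "Const c"]) auto

lemma dpol_add: "f \<in> dpol K s \<Longrightarrow> g \<in> dpol K s \<Longrightarrow> f + g \<in> dpol K s"
  unfolding dpol_def
proof clarify
  fix a b :: "'a mpx" assume "mvars a \<subseteq> K" "mdeg a \<le> s" "mvars b \<subseteq> K" "mdeg b \<le> s"
  then show "\<exists>f. meval a + meval b = meval f \<and> mvars f \<subseteq> K \<and> mdeg f \<le> s"
    by (intro exI[of _ "Add a b"]) auto
qed

lemma dpol_mult: "f \<in> dpol K s \<Longrightarrow> g \<in> dpol K t \<Longrightarrow> f * g \<in> dpol K (s + t)"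
  unfolding dpol_def
proof clarify
  fix a b :: "'a mpx" assume "mvars a \<subseteq> K" "mdeg a \<le> s" "mvars b \<subseteq> K" "mdeg b \<le> t"
  then show "\<exists>f. meval a * meval b = meval f \<and> mvars f \<subseteq> K \<and> mdeg f \<le> s + t"
    by (intro exI[of _ "Mul a b"]) auto
qed

lemma dpol_mono: "f \<in> dpol K s \<Longrightarrow> K \<subseteq> L \<Longrightarrow> s \<le> t \<Longrightarrow> f \<in> dpol L t"
  unfolding dpol_def by fastforce

lemma dpol_power: "f \<in> dpol K s \<Longrightarrow> f ^ k \<in> dpol K (s * k)"
proof (induction k)
  case 0
  then show ?case using dpol_const[of 1] by (simp add: one_fun_def)
next
  case (Suc k)
  then show ?case using dpol_mult[of f K s "f ^ k" "s * k"] unfolding power_Suc mult_Suc_right by blast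
qed

lemma dpol_sum: "(\<And>i. i \<in> A \<Longrightarrow> f i \<in> dpol K s) \<Longrightarrow> (\<lambda>p. \<Sum>i\<in>A. f i p) \<in> dpol K s"
proof (induction A rule: infinite_finite_induct)
  case (insert x F)
  then have "f x + (\<lambda>p. \<Sum>i\<in>F. f i p) \<in> dpol K s" by (intro dpol_add) auto
  then show ?case using insert by (simp add: plus_fun_def)
qed (auto intro: dpol_const)

lemma pfun_dpol: "f \<in> pfun K \<Longrightarrow> \<exists>s. f \<in> dpol K s"
  unfolding pfun_def dpol_def by blast

lemma dpol_pfun: "f \<in> dpol K s \<Longrightarrow> f \<in> pfun K"
  unfolding pfun_def dpol_def by blast

lemma pfun_meval: "mvars f \<subseteq> K \<Longrightarrow> meval f \<in> pfun K"
  unfolding pfun_def by blast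

lemma pfun_const: "(\<lambda>p. c) \<in> pfun K"
  using dpol_const dpol_pfun by blast

lemma pfun_var: "v \<in> K \<Longrightarrow> (\<lambda>p. p v) \<in> pfun K"
  unfolding pfun_def by (rule CollectI, rule exI[of _ "Var v"]) auto

lemma pfun_add: "f \<in> pfun K \<Longrightarrow> g \<in> pfun K \<Longrightarrow> (\<lambda>p. f p + g p) \<in> pfun K"
  unfolding pfun_def
proof clarify
  fix a b :: "'a mpx" assume "mvars a \<subseteq> K" "mvars b \<subseteq> K"
  then show "\<exists>f. (\<lambda>p. meval a p + meval b p) = meval f \<and> mvars f \<subseteq> K"
    by (intro exI[of _ "Add a b"]) auto
qed

lemma pfun_mult: "f \<in> pfun K \<Longrightarrow> g \<in> pfun K \<Longrightarrow> (\<lambda>p. f p * g p) \<in> pfun K"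
  unfolding pfun_def
proof clarify
  fix a b :: "'a mpx" assume "mvars a \<subseteq> K" "mvars b \<subseteq> K"
  then show "\<exists>f. (\<lambda>p. meval a p * meval b p) = meval f \<and> mvars f \<subseteq> K"
    by (intro exI[of _ "Mul a b"]) auto
qed

lemma pfun_diff: "f \<in> pfun K \<Longrightarrow> g \<in> pfun K \<Longrightarrow> (\<lambda>p. f p - g p) \<in> pfun K"
  using pfun_add[of f K "\<lambda>p. (- 1) * g p"] pfun_mult[OF pfun_const, of g K "- 1"] by simp

lemma pfun_power: "f \<in> pfun K \<Longrightarrow> (\<lambda>p. f p ^ k) \<in> pfun K"
  by (induction k) (auto intro: pfun_const pfun_mult)

lemma pfun_sum: "(\<And>i. i \<in> A \<Longrightarrow> f i \<in> pfun K) \<Longrightarrow> (\<lambda>p. \<Sum>i\<in>A. f i p) \<in> pfun K"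
  by (induction A rule: infinite_finite_induct) (auto intro: pfun_const pfun_add)

lemma pfun_prod: "(\<And>i. i \<in> A \<Longrightarrow> f i \<in> pfun K) \<Longrightarrow> (\<lambda>p. \<Prod>i\<in>A. f i p) \<in> pfun K"
  by (induction A rule: infinite_finite_induct) (auto intro: pfun_const pfun_mult)

lemma pfun_mono: "f \<in> pfun K \<Longrightarrow> K \<subseteq> L \<Longrightarrow> f \<in> pfun L"
  unfolding pfun_def by blast

lemma pfun_induct [consumes 1, case_names const var add mult]:
  assumes "f \<in> pfun K"
    and "\<And>c. P (\<lambda>p. c)" and "\<And>v. v \<in> K \<Longrightarrow> P (\<lambda>p. p v)"
    and "\<And>f g. f \<in> pfun K \<Longrightarrow> g \<in> pfun K \<Longrightarrow> P f \<Longrightarrow> P g \<Longrightarrow> P (\<lambda>p. f p + g p)"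
    and "\<And>f g. f \<in> pfun K \<Longrightarrow> g \<in> pfun K \<Longrightarrow> P f \<Longrightarrow> P g \<Longrightarrow> P (\<lambda>p. f p * g p)"
  shows "P f"
proof -
  from assms(1) obtain a where "mvars a \<subseteq> K" "f = meval a" unfolding pfun_def by blast
  moreover have "mvars a \<subseteq> K \<Longrightarrow> P (meval a)" for a
  proof (induction a)
    case (Const c)
    have "meval (Const c) = (\<lambda>p. c)" by auto
    then show ?case using assms(2)[of c] by simp
  next
    case (Var v)
    have "meval (Var v) = (\<lambda>p. p v)" by auto
    then show ?case using assms(3)[of v] Var by simp
  next
    case (Add f g)
    have "meval (Add f g) = (\<lambda>p. meval f p + meval g p)" by auto
    then show ?case using assms(4)[of "meval f" "meval g"] Add pfun_meval[of f K] pfun_meval[of g K] by auto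
  next
    case (Mul f g)
    have "meval (Mul f g) = (\<lambda>p. meval f p * meval g p)" by auto
    then show ?case using assms(5)[of "meval f" "meval g"] Mul pfun_meval[of f K] pfun_meval[of g K] by auto
  qed
  ultimately show ?thesis by blast
qed

lemma pfun_cong: "f \<in> pfun K \<Longrightarrow> (\<And>v. v \<in> K \<Longrightarrow> p v = q v) \<Longrightarrow> f p = f q"
  by (induction rule: pfun_induct) auto

lemma pfun_subst:
  assumes "f \<in> pfun K" "\<And>v. v \<in> K \<Longrightarrow> h v \<in> pfun L"
  shows "(\<lambda>p. f (\<lambda>v. h v p)) \<in> pfun L"
  using assms by (induction rule: pfun_induct) (auto intro: pfun_const pfun_add pfun_mult)

lemma pfun_line:
  assumes "f \<in> pfun K"
  shows "\<exists>q. \<forall>z. f (\<lambda>v. a v + z * (b v - a v)) = poly q z"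
  using assms
proof (induction rule: pfun_induct)
  case (const c)
  show ?case by (rule exI[of _ "[:c:]"]) simp
next
  case (var v)
  show ?case by (rule exI[of _ "[:a v, b v - a v:]"]) simp
next
  case (add f g)
  then show ?case by (metis poly_add)
next
  case (mult f g)
  then show ?case by (metis poly_mult)
qed

text \<open>Polynomial functions form an integral domain: on the complex line through
  \<open>a\<close> and \<open>b\<close>, with \<open>a\<close> at 0 and \<open>b\<close> at 1, both
  factors restrict to nonzero univariate polynomials.\<close>

lemma pfun_nonzero_mult:
  assumes f: "f \<in> pfun K" "f a \<noteq> 0" and g: "g \<in> pfun K" "g b \<noteq> 0"
  shows "\<exists>p. f p * g p \<noteq> 0"
proof -
  from pfun_line[OF f(1)] obtain q where q: "\<And>z. f (\<lambda>v. a v + z * (b v - a v)) = poly q z" by blast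
  from pfun_line[OF g(1)] obtain r where r: "\<And>z. g (\<lambda>v. a v + z * (b v - a v)) = poly r z" by blast
  have "q \<noteq> 0" using q[of 0] f(2) by auto
  moreover have "r \<noteq> 0" using r[of 1] g(2) by auto
  ultimately have "q * r \<noteq> 0" by simp
  then obtain z where "poly (q * r) z \<noteq> 0" using poly_all_0_iff_0 by blast
  then show ?thesis using q r by (metis poly_mult)
qed

lemma pfun_nonzero_prod:
  assumes "finite A" "\<And>i. i \<in> A \<Longrightarrow> f i \<in> pfun K \<and> (\<exists>p. f i p \<noteq> 0)"
  shows "\<exists>p. (\<Prod>i\<in>A. f i p) \<noteq> 0"
  using assms
proof (induction A rule: finite_induct)
  case (insert x F)
  then obtain p q where "f x p \<noteq> 0" "(\<Prod>i\<in>F. f i q) \<noteq> 0" by blast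
  then show ?case
    using pfun_nonzero_mult[of "f x" K p "\<lambda>p. \<Prod>i\<in>F. f i p" q] insert by (auto intro: pfun_prod)
qed simp

lemma subring_pfun: "subring (pfun K)"
  by standard (auto simp: one_fun_def times_fun_def fun_diff_def intro: pfun_const pfun_diff pfun_mult)

text \<open>A polynomial in \<open>y\<close> over the ring of functions of the other coordinates is
  kept as a map \<open>Q\<close> from points to univariate complex polynomials. Roots and
  divisibility can then be discussed over one point at a time, while the last clause remembers how
  the coefficients depend on the point.\<close>

lemma dpol_expand:
  assumes "f \<in> dpol (insert y K) s"
  shows "\<exists>Q. (\<forall>p. f p = poly (Q p) (p y)) \<and> (\<forall>p. degree (Q p) \<le> s) \<and>
     (\<forall>i. (\<lambda>p. coeff (Q p) i) \<in> dpol K s)"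
proof -
  have "\<exists>Q. (\<forall>p. meval a p = poly (Q p) (p y)) \<and> (\<forall>p. degree (Q p) \<le> mdeg a) \<and>
     (\<forall>i. (\<lambda>p. coeff (Q p) i) \<in> dpol K (mdeg a))" if "mvars a \<subseteq> insert y K" for a
    using that
  proof (induction a)
    case (Const c)
    then show ?case
      by (intro exI[of _ "\<lambda>p. [:c:]"]) (auto simp: coeff_pCons dpol_const split: nat.split)
  next
    case (Var v)
    show ?case
    proof (cases "v = y")
      case True
      then show ?thesis
        by (intro exI[of _ "\<lambda>p. [:0, 1:]"]) (auto simp: coeff_pCons dpol_const split: nat.split)
    next
      case False
      have "(\<lambda>p. p v) \<in> dpol K 1" unfolding dpol_def using Var False
        by (intro CollectI exI[of _ "Var v"]) auto
      then have "(\<lambda>p. coeff [:p v:] i) \<in> dpol K (mdeg (Var v))" for i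
        by (cases i) (simp_all add: dpol_const)
      then show ?thesis
        by (intro exI[of _ "\<lambda>p. [:p v:]"]) auto
    qed
  next
    case (Add f g)
    then obtain Q R where
      Q: "\<And>p. meval f p = poly (Q p) (p y)" "\<And>p. degree (Q p) \<le> mdeg f" "\<And>i. (\<lambda>p. coeff (Q p) i) \<in> dpol K (mdeg f)" and
      R: "\<And>p. meval g p = poly (R p) (p y)" "\<And>p. degree (R p) \<le> mdeg g" "\<And>i. (\<lambda>p. coeff (R p) i) \<in> dpol K (mdeg g)"
      by (metis Un_subset_iff mvars.simps(3))
    have "(\<lambda>p. coeff (Q p) i) + (\<lambda>p. coeff (R p) i) \<in> dpol K (max (mdeg f) (mdeg g))" for i
      using Q(3)[of i] R(3)[of i] by (intro dpol_add) (auto elim: dpol_mono)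
    then have "(\<lambda>p. coeff (Q p + R p) i) \<in> dpol K (max (mdeg f) (mdeg g))" for i
      by (simp add: plus_fun_def)
    moreover have "degree (Q p + R p) \<le> max (mdeg f) (mdeg g)" for p
      using Q(2)[of p] R(2)[of p] by (intro degree_add_le) auto
    ultimately show ?case using Q(1) R(1) by (intro exI[of _ "\<lambda>p. Q p + R p"]) auto
  next
    case (Mul f g)
    then obtain Q R where
      Q: "\<And>p. meval f p = poly (Q p) (p y)" "\<And>p. degree (Q p) \<le> mdeg f" "\<And>i. (\<lambda>p. coeff (Q p) i) \<in> dpol K (mdeg f)" and
      R: "\<And>p. meval g p = poly (R p) (p y)" "\<And>p. degree (R p) \<le> mdeg g" "\<And>i. (\<lambda>p. coeff (R p) i) \<in> dpol K (mdeg g)"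
      by (metis Un_subset_iff mvars.simps(4))
    have "(\<lambda>p. coeff (Q p) j) * (\<lambda>p. coeff (R p) k) \<in> dpol K (mdeg f + mdeg g)" for j k
      using Q(3)[of j] R(3)[of k] by (intro dpol_mult)
    then have "(\<lambda>p. coeff (Q p) j * coeff (R p) k) \<in> dpol K (mdeg f + mdeg g)" for j k
      by (simp add: times_fun_def)
    then have "(\<lambda>p. coeff (Q p * R p) i) \<in> dpol K (mdeg f + mdeg g)" for i
      by (simp add: coeff_mult) (intro dpol_sum)
    moreover have "degree (Q p * R p) \<le> mdeg f + mdeg g" for p
      using Q(2)[of p] R(2)[of p] degree_mult_le[of "Q p" "R p"] by linarith
    ultimately show ?case using Q(1) R(1) by (intro exI[of _ "\<lambda>p. Q p * R p"]) auto
  qed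
  moreover obtain a where "mvars a \<subseteq> insert y K" "mdeg a \<le> s" "f = meval a"
    using assms unfolding dpol_def by blast
  ultimately obtain Q where "\<forall>p. f p = poly (Q p) (p y)" "\<forall>p. degree (Q p) \<le> mdeg a"
      "\<forall>i. (\<lambda>p. coeff (Q p) i) \<in> dpol K (mdeg a)" by metis
  then show ?thesis using \<open>mdeg a \<le> s\<close> by (intro exI[of _ Q]) (auto intro: dpol_mono order_trans)
qed

lemma pfun_insert_subset: "pfun (insert y K) \<subseteq> adjoin (pfun K) (\<lambda>p. p y)"
proof
  fix f assume "f \<in> pfun (insert y K)"
  then obtain s where "f \<in> dpol (insert y K) s" using pfun_dpol by blast
  from dpol_expand[OF this] obtain Q where
    Q: "\<And>p. f p = poly (Q p) (p y)" "\<And>p. degree (Q p) \<le> s" "\<And>i. (\<lambda>p. coeff (Q p) i) \<in> dpol K s" by blast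
  \<comment> \<open>\<open>degree (Q p)\<close> varies with \<open>p\<close>, so the polynomial over
    the function ring is padded up to the uniform bound \<open>s\<close>.\<close>
  define q where "q = (\<Sum>i\<le>s. monom (\<lambda>p. coeff (Q p) i) i)"
  have coeff: "coeff q i = (if i \<le> s then (\<lambda>p. coeff (Q p) i) else 0)" for i
    unfolding q_def by (simp add: coeff_sum)
  have sum_apply: "(\<Sum>i\<in>A. g i) p = (\<Sum>i\<in>A. g i p)" for A :: "nat set" and g :: "nat \<Rightarrow> ('a \<Rightarrow> complex) \<Rightarrow> complex" and p
    by (induction A rule: infinite_finite_induct) auto
  have power_apply: "(g ^ n) p = g p ^ n" for g :: "('a \<Rightarrow> complex) \<Rightarrow> complex" and n p
    by (induction n) auto
  have "f p = poly q (\<lambda>p. p y) p" for p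
  proof -
    have "f p = (\<Sum>i\<le>degree (Q p). coeff (Q p) i * p y ^ i)"
      using Q(1) by (simp add: poly_altdef)
    also have "\<dots> = (\<Sum>i\<le>s. coeff (Q p) i * p y ^ i)"
      using Q(2)[of p] by (intro sum.mono_neutral_left) (auto simp: coeff_eq_0)
    also have "\<dots> = poly q (\<lambda>p. p y) p"
      unfolding q_def by (simp add: poly_sum poly_monom sum_apply power_apply)
    finally show ?thesis .
  qed
  then have "f = poly q (\<lambda>p. p y)" by auto
  moreover have "coeff q i \<in> pfun K" for i
    using Q(3)[of i] pfun_const[of 0] by (auto simp: coeff dpol_pfun zero_fun_def)
  ultimately show "f \<in> adjoin (pfun K) (\<lambda>p. p y)" unfolding adjoin_def by blast
qed

lemma adjoin_pfun_subset: "adjoin (pfun K) (\<lambda>p. p y) \<subseteq> pfun (insert y K)"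
proof
  fix f assume "f \<in> adjoin (pfun K) (\<lambda>p. p y)"
  then obtain q where q: "\<forall>i. coeff q i \<in> pfun K" "f = poly q (\<lambda>p. p y)" unfolding adjoin_def by blast
  interpret subring "pfun (insert y K)" by (rule subring_pfun)
  show "f \<in> pfun (insert y K)"
    unfolding q(2) poly_altdef
    by (intro sum_mem mult_mem power_mem) (use q(1) in \<open>auto intro: pfun_mono pfun_var\<close>)
qed

text \<open>Variables are adjoined one by one by \<open>hilbert_basis\<close>. Without variables
  only constants remain; they form a field, so any nonzero element generates its ideal.\<close>

lemma noetherian_pfun: "finite K \<Longrightarrow> noetherian_set (pfun K)"
proof (induction K rule: finite_induct)
  case empty
  have const: "\<exists>c. f = (\<lambda>p. c)" if "f \<in> pfun {}" for f :: "('a \<Rightarrow> complex) \<Rightarrow> complex"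
  proof -
    have "f p = f undefined" for p using pfun_cong[OF that, of p undefined] by simp
    then show ?thesis by auto
  qed
  show ?case unfolding noetherian_set_def
  proof (intro allI impI)
    fix S :: "(('a \<Rightarrow> complex) \<Rightarrow> complex) set" assume S: "ideal_of (pfun {}) S"
    show "\<exists>G. finite G \<and> G \<subseteq> S \<and> S \<subseteq> ideal_span (pfun {}) G"
    proof (cases "S \<subseteq> {0}")
      case True
      then show ?thesis by (intro exI[of _ "{}"]) (auto intro: ideal_span.zero)
    next
      case False
      have SP: "S \<subseteq> pfun {}" using S unfolding ideal_of_def by simp
      from False obtain f where f: "f \<in> S" "f \<noteq> 0" by auto
      then obtain c where c: "f = (\<lambda>p. c)" using const[of f] SP by auto
      have "c \<noteq> 0" using f c by (auto simp: zero_fun_def)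
      have "g \<in> ideal_span (pfun {}) {f}" if "g \<in> S" for g
      proof -
        have "g \<in> pfun {}" using SP that by blast
        then obtain d where d: "g = (\<lambda>p. d)" using const[of g] by blast
        have "0 + (\<lambda>p. d / c) * f \<in> ideal_span (pfun {}) {f}"
          by (intro ideal_span.intros pfun_const) auto
        moreover have "0 + (\<lambda>p. d / c) * f = g" using c d \<open>c \<noteq> 0\<close> by (auto simp: fun_eq_iff)
        ultimately show ?thesis by simp
      qed
      then show ?thesis using f(1) by (intro exI[of _ "{f}"]) auto
    qed
  qed
next
  case (insert y K)
  then show ?case
    using hilbert_basis[OF subring_pfun, of K "\<lambda>p. p y"] pfun_insert_subset[of y K]
      adjoin_pfun_subset[of K y] by simp
qed

section \<open>Closed and irreducible sets in terms of polynomial functions\<close>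

lemma zclosedI:
  assumes "F \<subseteq> pfun I"
  shows "zclosed I {p \<in> aspace I. \<forall>f\<in>F. f p = 0}"
proof -
  define F' where "F' = {a. mvars a \<subseteq> I \<and> meval a \<in> F}"
  have "F = meval ` F'" unfolding F'_def using assms unfolding pfun_def by blast
  then have "{p \<in> aspace I. \<forall>f\<in>F. f p = 0} = zset I F'" unfolding zset_def by auto
  moreover have "\<forall>f\<in>F'. mvars f \<subseteq> I" unfolding F'_def by simp
  ultimately show ?thesis unfolding zclosed_def by (intro exI[of _ F'] conjI)
qed

lemma zclosed_iff:
  "zclosed I C \<longleftrightarrow> C = {p \<in> aspace I. \<forall>f\<in>pfun I. vanishes f C \<longrightarrow> f p = 0}"
proof
  assume "zclosed I C"
  then obtain F where F: "\<forall>f\<in>F. mvars f \<subseteq> I" "C = zset I F" unfolding zclosed_def by blast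
  then have "vanishes (meval f) C" "meval f \<in> pfun I" if "f \<in> F" for f
    using that unfolding zset_def by (auto intro: pfun_meval)
  then show "C = {p \<in> aspace I. \<forall>f\<in>pfun I. vanishes f C \<longrightarrow> f p = 0}"
    using F(2) unfolding zset_def by blast
next
  assume "C = {p \<in> aspace I. \<forall>f\<in>pfun I. vanishes f C \<longrightarrow> f p = 0}"
  also have "\<dots> = {p \<in> aspace I. \<forall>f\<in>{f \<in> pfun I. vanishes f C}. f p = 0}" by auto
  finally show "zclosed I C" using zclosedI[of "{f \<in> pfun I. vanishes f C}" I] by auto
qed

lemma zclosed_subset_aspace: "zclosed I C \<Longrightarrow> C \<subseteq> aspace I"
  unfolding zclosed_def zset_def by blast

lemma zclosed_memI:
  assumes "zclosed I C" "p \<in> aspace I" "\<And>f. f \<in> pfun I \<Longrightarrow> vanishes f C \<Longrightarrow> f p = 0"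
  shows "p \<in> C"
  using assms unfolding zclosed_iff by blast

lemma zclosed_not_subset:
  assumes "zclosed I C" "S \<subseteq> aspace I" "\<not> S \<subseteq> C"
  obtains f where "f \<in> pfun I" "vanishes f C" "\<not> vanishes f S"
proof -
  from assms(3) obtain p where p: "p \<in> S" "p \<notin> C" by blast
  with assms(2) have "p \<in> aspace I" by blast
  with zclosed_memI[OF assms(1), of p] p(2) obtain f where "f \<in> pfun I" "vanishes f C" "f p \<noteq> 0"
    by blast
  with p(1) that show ?thesis by blast
qed

lemma zclosure_eq:
  assumes "S \<subseteq> aspace I"
  shows "zclosure I S = {p \<in> aspace I. \<forall>f\<in>pfun I. vanishes f S \<longrightarrow> f p = 0}" (is "_ = ?R")
proof
  have "?R = {p \<in> aspace I. \<forall>f\<in>{f\<in>pfun I. vanishes f S}. f p = 0}" by auto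
  then have "zclosed I ?R" using zclosedI[of "{f\<in>pfun I. vanishes f S}" I] by auto
  moreover have "S \<subseteq> ?R" using assms by auto
  ultimately show "zclosure I S \<subseteq> ?R" unfolding zclosure_def by blast
  show "?R \<subseteq> zclosure I S"
    unfolding zclosure_def
  proof (intro Inter_greatest subsetI)
    fix C p assume "C \<in> {C. zclosed I C \<and> S \<subseteq> C}" "p \<in> ?R"
    then have "zclosed I C" "S \<subseteq> C" "p \<in> aspace I" "\<And>f. f \<in> pfun I \<Longrightarrow> vanishes f S \<Longrightarrow> f p = 0"
      by auto
    then show "p \<in> C" using zclosed_memI[of I C p] by (meson subsetD)
  qed
qed

lemma zclosed_zclosure: "S \<subseteq> aspace I \<Longrightarrow> zclosed I (zclosure I S)"
proof -
  assume "S \<subseteq> aspace I"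
  then have "zclosure I S = {p \<in> aspace I. \<forall>f\<in>{f \<in> pfun I. vanishes f S}. f p = 0}"
    by (auto simp: zclosure_eq)
  also have "zclosed I \<dots>" by (intro zclosedI) auto
  finally show ?thesis .
qed

lemma zclosure_subset: "S \<subseteq> zclosure I S"
  unfolding zclosure_def by blast

lemma vanishes_zclosure:
  "S \<subseteq> aspace I \<Longrightarrow> f \<in> pfun I \<Longrightarrow> vanishes f (zclosure I S) \<longleftrightarrow> vanishes f S"
  using zclosure_subset[of S I] by (auto simp: zclosure_eq)

lemma zclosed_Int_zeros:
  assumes "zclosed I C" "f \<in> pfun I"
  shows "zclosed I {p \<in> C. f p = 0}"
proof -
  have "{p \<in> C. f p = 0} = {p \<in> aspace I. \<forall>g\<in>insert f {g \<in> pfun I. vanishes g C}. g p = 0}"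
    using assms(1) zclosed_subset_aspace[OF assms(1)] zclosed_memI[OF assms(1)] by blast
  then show ?thesis using zclosedI[of "insert f {g \<in> pfun I. vanishes g C}" I] assms(2) by auto
qed

text \<open>The right-hand side says that the vanishing ideal is prime. The zero sets of
  \<open>f\<close> and \<open>g\<close> split \<open>X\<close> when the product vanishes;
  conversely, functions separating \<open>X\<close> from the two pieces of a splitting have a
  product vanishing on \<open>X\<close>.\<close>

lemma zirreducible_iff:
  "zirreducible I X \<longleftrightarrow> zclosed I X \<and> X \<noteq> {} \<and>
    (\<forall>f\<in>pfun I. \<forall>g\<in>pfun I. vanishes (\<lambda>p. f p * g p) X \<longrightarrow> vanishes f X \<or> vanishes g X)"
proof
  assume X: "zirreducible I X"
  have *: "vanishes f X \<or> vanishes g X" if "f \<in> pfun I" "g \<in> pfun I" "vanishes (\<lambda>p. f p * g p) X" for f g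
  proof -
    have "zclosed I {p \<in> X. f p = 0}" "zclosed I {p \<in> X. g p = 0}"
      using X that unfolding zirreducible_def by (auto intro: zclosed_Int_zeros)
    moreover have "X = {p \<in> X. f p = 0} \<union> {p \<in> X. g p = 0}" using that by auto
    ultimately have "X = {p \<in> X. f p = 0} \<or> X = {p \<in> X. g p = 0}"
      using X unfolding zirreducible_def by blast
    then show ?thesis by blast
  qed
  then show "zclosed I X \<and> X \<noteq> {} \<and>
    (\<forall>f\<in>pfun I. \<forall>g\<in>pfun I. vanishes (\<lambda>p. f p * g p) X \<longrightarrow> vanishes f X \<or> vanishes g X)"
    using X unfolding zirreducible_def by (intro conjI ballI impI *) simp_all
next
  assume X: "zclosed I X \<and> X \<noteq> {} \<and>
    (\<forall>f\<in>pfun I. \<forall>g\<in>pfun I. vanishes (\<lambda>p. f p * g p) X \<longrightarrow> vanishes f X \<or> vanishes g X)"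
  have "X = A \<or> X = B" if AB: "zclosed I A" "zclosed I B" "X = A \<union> B" for A B
  proof (rule ccontr)
    assume "\<not> (X = A \<or> X = B)"
    then have nA: "\<not> X \<subseteq> A" and nB: "\<not> X \<subseteq> B" using AB by auto
    have Xa: "X \<subseteq> aspace I" using X zclosed_subset_aspace by blast
    from zclosed_not_subset[OF AB(1) Xa nA]
    obtain f where f: "f \<in> pfun I" "vanishes f A" "\<not> vanishes f X" .
    from zclosed_not_subset[OF AB(2) Xa nB]
    obtain g where g: "g \<in> pfun I" "vanishes g B" "\<not> vanishes g X" .
    have "vanishes (\<lambda>p. f p * g p) X" using f g AB(3) by auto
    moreover have "\<forall>g\<in>pfun I. vanishes (\<lambda>p. f p * g p) X \<longrightarrow> vanishes f X \<or> vanishes g X"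
      using conjunct2[OF conjunct2[OF X]] f(1) by (rule bspec)
    from bspec[OF this g(1)]
    have "vanishes (\<lambda>p. f p * g p) X \<longrightarrow> vanishes f X \<or> vanishes g X" .
    ultimately show False using f(3) g(3) by simp
  qed
  then show "zirreducible I X" using X unfolding zirreducible_def by blast
qed

lemma zirreducible_zclosed: "zirreducible I X \<Longrightarrow> zclosed I X"
  unfolding zirreducible_def by (erule conjunct1)

lemma zirreducible_nonempty: "zirreducible I X \<Longrightarrow> X \<noteq> {}"
  unfolding zirreducible_def by (elim conjE)

lemma zirreducible_subset_aspace: "zirreducible I X \<Longrightarrow> X \<subseteq> aspace I"
  by (intro zclosed_subset_aspace zirreducible_zclosed)

lemma zirreducibleD:
  "zirreducible I X \<Longrightarrow> f \<in> pfun I \<Longrightarrow> g \<in> pfun I \<Longrightarrow> vanishes (\<lambda>p. f p * g p) X \<Longrightarrow>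
    vanishes f X \<or> vanishes g X"
  unfolding zirreducible_iff by (elim conjE) (drule bspec, assumption, drule bspec, assumption, erule mp)

text \<open>Primality may be tested on the dense subset \<open>S\<close>, since a polynomial
  function vanishes on \<open>S\<close> iff it vanishes on the closure.\<close>

lemma zirreducible_zclosure:
  assumes "S \<subseteq> aspace I" "S \<noteq> {}"
    and "\<And>f g. f \<in> pfun I \<Longrightarrow> g \<in> pfun I \<Longrightarrow> vanishes (\<lambda>p. f p * g p) S \<Longrightarrow> vanishes f S \<or> vanishes g S"
  shows "zirreducible I (zclosure I S)"
  unfolding zirreducible_iff
proof (intro conjI ballI impI)
  show "zclosed I (zclosure I S)" using assms(1) by (rule zclosed_zclosure)
  show "zclosure I S \<noteq> {}" using assms(2) zclosure_subset[of S I] by blast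
  fix f g assume fg: "f \<in> pfun I" "g \<in> pfun I" "vanishes (\<lambda>p. f p * g p) (zclosure I S)"
  then have "vanishes (\<lambda>p. f p * g p) S" using zclosure_subset[of S I] by blast
  then show "vanishes f (zclosure I S) \<or> vanishes g (zclosure I S)"
    using assms fg by (simp add: vanishes_zclosure)
qed

lemma zirreducible_prod:
  assumes "zirreducible I X" "finite A" "\<And>i. i \<in> A \<Longrightarrow> f i \<in> pfun I \<and> \<not> vanishes (f i) X"
  shows "\<not> vanishes (\<lambda>p. \<Prod>i\<in>A. f i p) X"
  using assms(2,3)
proof (induction A rule: finite_induct)
  case empty
  then show ?case using assms(1) unfolding zirreducible_def by auto
next
  case (insert x F)
  then have "\<not> vanishes (\<lambda>p. \<Prod>i\<in>F. f i p) X" "(\<lambda>p. \<Prod>i\<in>F. f i p) \<in> pfun I" by (auto intro: pfun_prod)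
  then have "\<not> vanishes (\<lambda>p. f x p * (\<Prod>i\<in>F. f i p)) X"
    using insert.prems[of x] zirreducibleD[OF assms(1), of "f x" "\<lambda>p. \<Prod>i\<in>F. f i p"] by blast
  then show ?case using insert by simp
qed

section \<open>Noetherian descent and decomposition into irreducible sets\<close>

text \<open>A descending sequence of closed sets gives an ascending sequence of vanishing ideals
  \<open>V i\<close>. Finitely many generators of their union already lie in one of them, so the
  ideals stabilize, and closed sets are determined by their ideals.\<close>

lemma wf_zclosed:
  assumes "finite I"
  shows "wf {(A, B). zclosed I A \<and> zclosed I B \<and> A \<subset> B}"
  unfolding wf_iff_no_infinite_down_chain
proof
  assume "\<exists>f. \<forall>i. (f (Suc i), f i) \<in> {(A, B). zclosed I A \<and> zclosed I B \<and> A \<subset> B}"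
  then obtain C where "\<forall>i. (C (Suc i), C i) \<in> {(A, B). zclosed I A \<and> zclosed I B \<and> A \<subset> B}" ..
  then have C: "\<And>i. zclosed I (C i)" "\<And>i. C (Suc i) \<subset> C i" by auto
  have mono: "C (i + k) \<subseteq> C i" for i k by (induction k) (use C(2) in auto)
  have mono': "C j \<subseteq> C i" if "i \<le> j" for i j using mono[of i "j - i"] that by simp
  define V where "V i = {f \<in> pfun I. vanishes f (C i)}" for i
  have V_mono: "V i \<subseteq> V j" if "i \<le> j" for i j using mono'[OF that] unfolding V_def by blast
  have ideal: "ideal_of (pfun I) (V i)" for i
    unfolding ideal_of_def V_def using pfun_const[of 0]
    by (auto simp: plus_fun_def times_fun_def zero_fun_def intro: pfun_add pfun_mult)
  have "ideal_of (pfun I) (\<Union>i. V i)"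
    unfolding ideal_of_def
  proof (intro conjI ballI)
    show "(\<Union>i. V i) \<subseteq> pfun I" "0 \<in> (\<Union>i. V i)" using ideal unfolding ideal_of_def by blast+
    fix a assume "a \<in> (\<Union>d. V d)"
    then obtain d where d: "a \<in> V d" by auto
    show "r * a \<in> (\<Union>d. V d)" if "r \<in> pfun I" for r using ideal[of d] that d unfolding ideal_of_def by blast
    show "a + b \<in> (\<Union>d. V d)" if "b \<in> (\<Union>d. V d)" for b
    proof -
      from that obtain e where "b \<in> V e" by auto
      then have "a \<in> V (max d e)" "b \<in> V (max d e)" using d V_mono[of d "max d e"] V_mono[of e "max d e"] by auto
      then show ?thesis using ideal[of "max d e"] unfolding ideal_of_def by blast
    qed
  qed
  then obtain G where G: "finite G" "G \<subseteq> (\<Union>i. V i)" "(\<Union>i. V i) \<subseteq> ideal_span (pfun I) G"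
    using noetherian_pfun[OF assms] unfolding noetherian_set_def by meson
  have "\<exists>D. G \<subseteq> V D" using G(1,2)
  proof induction
    case (insert g F)
    then obtain D d where "F \<subseteq> V D" "g \<in> V d" by auto
    then have "insert g F \<subseteq> V (max D d)"
      using V_mono[of d "max D d"] V_mono[of D "max D d"] by auto
    then show ?case by blast
  qed simp
  then obtain D where "G \<subseteq> V D" by blast
  then have "V (Suc D) \<subseteq> V D" using ideal_span_subset[OF ideal] G(3) by blast
  moreover have "\<not> C D \<subseteq> C (Suc D)" using C(2)[of D] by blast
  from zclosed_not_subset[OF C(1) zclosed_subset_aspace[OF C(1)] this]
  obtain f where "f \<in> pfun I" "vanishes f (C (Suc D))" "\<not> vanishes f (C D)" .
  ultimately show False unfolding V_def by auto
qed

text \<open>Noetherian induction: a reducible set is a union of two strictly smaller closed sets.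
  The pieces obtained may be contained in one another.\<close>

lemma zclosed_decomposition:
  assumes "finite I" "zclosed I C"
  shows "\<exists>\<C>. finite \<C> \<and> (\<forall>X\<in>\<C>. zirreducible I X) \<and> C = \<Union>\<C>"
  using assms(2)
proof (induction C rule: wf_induct_rule[OF wf_zclosed[OF assms(1)]])
  case (1 C)
  show ?case
  proof (cases "C = {} \<or> zirreducible I C")
    case True
    then show ?thesis
    proof
      assume "C = {}"
      then show ?thesis by (intro exI[of _ "{}"]) auto
    next
      assume "zirreducible I C"
      then show ?thesis by (intro exI[of _ "{C}"]) auto
    qed
  next
    case False
    then obtain A B where AB: "zclosed I A" "zclosed I B" "C = A \<union> B" "C \<noteq> A" "C \<noteq> B"
      using 1(2) unfolding zirreducible_def by blast
    then have "A \<subset> C" "B \<subset> C" by auto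
    then have "(A, C) \<in> {(A, B). zclosed I A \<and> zclosed I B \<and> A \<subset> B}" "(B, C) \<in> {(A, B). zclosed I A \<and> zclosed I B \<and> A \<subset> B}"
      using AB 1(2) by auto
    from 1(1)[OF this(1) AB(1)] 1(1)[OF this(2) AB(2)] obtain \<A> \<B> where
      "finite \<A>" "\<forall>X\<in>\<A>. zirreducible I X" "A = \<Union>\<A>" "finite \<B>" "\<forall>X\<in>\<B>. zirreducible I X" "B = \<Union>\<B>"
      by metis
    then show ?thesis using AB(3) by (intro exI[of _ "\<A> \<union> \<B>"]) auto
  qed
qed

subsection \<open>Lifting points along coordinate projections\<close>

text \<open>The leading coefficient of \<open>H\<close> need not be invertible in
  \<open>pfun K\<close>, so each step multiplies \<open>F\<close> by it before cancelling the top
  term. One exponent \<open>N\<close> serves all points, and the identity remains valid where the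
  coefficient at \<open>d\<close> vanishes. Only the remainder is required to have polynomial
  coefficients.\<close>

lemma pseudo_division:
  fixes H F :: "('v \<Rightarrow> complex) \<Rightarrow> complex poly"
  assumes H: "\<And>i. (\<lambda>p. coeff (H p) i) \<in> pfun K" "\<And>p i. i > d \<Longrightarrow> coeff (H p) i = 0"
    and F: "\<And>i. (\<lambda>p. coeff (F p) i) \<in> pfun K" "\<And>p i. i \<ge> n \<Longrightarrow> coeff (F p) i = 0"
  shows "\<exists>N Q R. (\<forall>i. (\<lambda>p. coeff (R p) i) \<in> pfun K) \<and> (\<forall>p. \<forall>i\<ge>d. coeff (R p) i = 0) \<and>
     (\<forall>p. smult (coeff (H p) d ^ N) (F p) = Q p * H p + R p)"
  using F
proof (induction n arbitrary: F)
  case 0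
  then have "F = (\<lambda>p. 0)" by (auto simp: poly_eq_iff)
  then show ?case using pfun_const[of 0]
    by (intro exI[of _ 0] exI[of _ "\<lambda>p. 0"]) auto
next
  case (Suc n)
  show ?case
  proof (cases "n < d")
    case True
    then show ?thesis
      by (intro exI[of _ 0] exI[of _ "\<lambda>p. 0"] exI[of _ F]) (use Suc.prems in auto)
  next
    case False
    define M where "M p = monom (coeff (F p) n) (n - d)" for p
    define F' where "F' p = smult (coeff (H p) d) (F p) - M p * H p" for p
    have coeff': "coeff (F' p) i = coeff (H p) d * coeff (F p) i
        - (if n - d \<le> i then coeff (F p) n * coeff (H p) (i - (n - d)) else 0)" for p i
      unfolding F'_def M_def by (simp add: coeff_monom_mult)
    have c1: "(\<lambda>p. coeff (F' p) i) \<in> pfun K" for i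
      unfolding coeff' using H(1) Suc.prems(1)
      by (cases "n - d \<le> i") (auto intro!: pfun_diff pfun_mult)
    have c2: "coeff (F' p) i = 0" if "i \<ge> n" for p i
    proof (cases "i = n")
      case True
      then show ?thesis using False unfolding coeff' by simp
    next
      case 2: False
      then have "i > n" using that by simp
      then show ?thesis using False H(2)[of "i - (n - d)" p] Suc.prems(2)[of i p]
        unfolding coeff' by auto
    qed
    from Suc.IH[OF c1 c2] obtain N Q R where R: "\<forall>i. (\<lambda>p. coeff (R p) i) \<in> pfun K" "\<forall>p. \<forall>i\<ge>d. coeff (R p) i = 0"
      and eq: "\<And>p. smult (coeff (H p) d ^ N) (F' p) = Q p * H p + R p"
      by blast
    have "smult (coeff (H p) d ^ Suc N) (F p) = (Q p + smult (coeff (H p) d ^ N) (M p)) * H p + R p" for p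
    proof -
      have "smult (coeff (H p) d ^ Suc N) (F p) = smult (coeff (H p) d ^ N) (F' p + M p * H p)"
        unfolding F'_def by (simp add: mult.commute)
      also have "\<dots> = smult (coeff (H p) d ^ N) (F' p) + smult (coeff (H p) d ^ N) (M p) * H p"
        by (simp add: smult_add_right)
      finally show ?thesis unfolding eq by (simp add: algebra_simps)
    qed
    with R show ?thesis
      by (intro exI[of _ "Suc N"] exI[of _ "\<lambda>p. Q p + smult (coeff (H p) d ^ N) (M p)"] exI[of _ R]) blast
  qed
qed

lemma pfun_expand:
  assumes "f \<in> pfun (insert y K)"
  obtains Q s where "\<And>p. f p = poly (Q p) (p y)" "\<And>p. degree (Q p) \<le> s" "\<And>i. (\<lambda>p. coeff (Q p) i) \<in> pfun K"
proof -
  obtain s where "f \<in> dpol (insert y K) s" using assms pfun_dpol by blast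
  from dpol_expand[OF this] obtain Q where
    "\<forall>p. f p = poly (Q p) (p y)" "\<forall>p. degree (Q p) \<le> s" "\<forall>i. (\<lambda>p. coeff (Q p) i) \<in> dpol K s" by blast
  then show thesis using that[of Q s] dpol_pfun by blast
qed

text \<open>The Zariski closure of the projection of \<open>X\<close> to the coordinates
  \<open>K\<close>, viewed as a cylinder: the coordinates outside \<open>K\<close> are unrestricted,
  so a point can be altered in one of them without leaving the set.\<close>

definition closure_pts :: "'v set \<Rightarrow> ('v \<Rightarrow> complex) set \<Rightarrow> ('v \<Rightarrow> complex) set" where
  "closure_pts K X = {p. \<forall>f\<in>pfun K. vanishes f X \<longrightarrow> f p = 0}"

lemma closure_ptsI: "(\<And>f. f \<in> pfun K \<Longrightarrow> vanishes f X \<Longrightarrow> f p = 0) \<Longrightarrow> p \<in> closure_pts K X"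
  unfolding closure_pts_def by simp

lemma closure_ptsD: "p \<in> closure_pts K X \<Longrightarrow> f \<in> pfun K \<Longrightarrow> vanishes f X \<Longrightarrow> f p = 0"
  unfolding closure_pts_def by blast

lemma poly_truncate:
  fixes H :: "'p \<Rightarrow> complex poly"
  assumes "\<And>i. i > d \<Longrightarrow> vanishes (\<lambda>p. coeff (H p) i) X" "p \<in> X"
  shows "(\<Sum>i\<le>d. monom (coeff (H p) i) i) = H p"
  using assms by (intro poly_eqI) (simp add: coeff_sum)

text \<open>Two cases: if \<open>y\<close> satisfies no relation over \<open>K\<close> on \<open>X\<close>, every value of \<open>y\<close> is admissible;
  otherwise the fibre is the zero set of a relation of minimal degree, as pseudo-division shows.\<close>
lemma lift_step:
  assumes X: "zirreducible I X" and KI: "insert y K \<subseteq> I" and y: "y \<notin> K"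
    and f: "f \<in> pfun (insert y K)" "\<not> vanishes f X"
  shows "\<exists>g\<in>pfun K. \<not> vanishes g X \<and> (\<forall>p\<in>closure_pts K X. g p \<noteq> 0 \<longrightarrow>
     (\<exists>c. p(y := c) \<in> closure_pts (insert y K) X \<and> f (p(y := c)) \<noteq> 0))"
proof -
  have KI': "K \<subseteq> I" using KI by auto
  \<comment> \<open>\<open>H\<close> is an algebraic relation for \<open>y\<close> over
    \<open>K\<close> on \<open>X\<close>, of formal degree \<open>d\<close>, whose leading
    coefficient is not identically zero on \<open>X\<close>.\<close>
  define rel where "rel d H \<longleftrightarrow> (\<forall>i. (\<lambda>p. coeff (H p) i) \<in> pfun K) \<and> (\<forall>p. \<forall>i>d. coeff (H p) i = 0) \<and>
    vanishes (\<lambda>p. poly (H p) (p y)) X \<and> \<not> vanishes (\<lambda>p. coeff (H p) d) X" for d and H :: "('a \<Rightarrow> complex) \<Rightarrow> complex poly"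
  have upd: "H (p(y := c)) = H p" if "\<And>i. (\<lambda>p. coeff (H p) i) \<in> pfun K" for H :: "('a \<Rightarrow> complex) \<Rightarrow> complex poly" and p c
  proof (rule poly_eqI)
    fix i
    show "coeff (H (p(y := c))) i = coeff (H p) i"
      using y by (intro pfun_cong[OF that]) auto
  qed
  \<comment> \<open>Deleting the top terms whose coefficients vanish identically on \<open>X\<close>
    turns any nontrivial relation into one with an admissible leading coefficient.\<close>
  have relI: "\<exists>j<n. \<exists>H'. rel j H'"
    if H: "\<And>i. (\<lambda>p. coeff (H p) i) \<in> pfun K" "\<And>p i. i \<ge> n \<Longrightarrow> coeff (H p) i = 0"
      "vanishes (\<lambda>p. poly (H p) (p y)) X" "\<not> vanishes (\<lambda>p. coeff (H p) i) X" for H n i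
  proof -
    define A where "A = {i. \<not> vanishes (\<lambda>p. coeff (H p) i) X}"
    have A: "A \<subseteq> {..<n}" unfolding A_def using H(2) by (auto simp: not_le[symmetric])
    then have fin: "finite A" by (rule finite_subset) auto
    have "i \<in> A" using H(4) unfolding A_def by simp
    define d where "d = Max A"
    have "d \<in> A" unfolding d_def using \<open>i \<in> A\<close> fin by (intro Max_in) auto
    have gt: "vanishes (\<lambda>p. coeff (H p) j) X" if "j > d" for j
      using that Max_ge[OF fin, of j] unfolding d_def A_def by fastforce
    define H' where "H' p = (\<Sum>i\<le>d. monom (coeff (H p) i) i)" for p
    have coeff: "coeff (H' p) i = (if i \<le> d then coeff (H p) i else 0)" for p i
      unfolding H'_def by (simp add: coeff_sum)
    have "(\<lambda>p. coeff (H' p) i) \<in> pfun K" for i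
      using H(1)[of i] by (cases "i \<le> d") (auto simp: coeff pfun_const)
    moreover have "\<not> vanishes (\<lambda>p. coeff (H' p) d) X" using \<open>d \<in> A\<close> by (auto simp: coeff A_def)
    moreover have "vanishes (\<lambda>p. poly (H' p) (p y)) X"
      using H(3) poly_truncate[OF gt] unfolding H'_def by simp
    ultimately have "rel d H'" unfolding rel_def by (auto simp: coeff)
    then show ?thesis using \<open>d \<in> A\<close> A by blast
  qed
  show ?thesis
  proof (cases "\<exists>d H. rel d H")
    case False
    \<comment> \<open>Without relations, a function vanishing on \<open>X\<close> has all its
      coefficients vanishing on \<open>X\<close>, hence at every point of
      \<open>closure_pts K X\<close>; it imposes no condition on the value of \<open>y\<close>
      there.\<close>
    have vcoeff: "vanishes (\<lambda>p. coeff (Q p) i) X"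
      if Q: "\<And>p. G p = poly (Q p) (p y)" "\<And>p. degree (Q p) \<le> s" "\<And>i. (\<lambda>p. coeff (Q p) i) \<in> pfun K"
        and "vanishes G X" for G Q i and s :: nat
    proof (rule ccontr)
      assume *: "\<not> ?thesis"
      have "coeff (Q p) i = 0" if "i \<ge> Suc s" for p i using Q(2)[of p] that by (intro coeff_eq_0) auto
      with relI[OF Q(3) _ _ *, of "Suc s"] Q(1) \<open>vanishes G X\<close> show False using False by auto
    qed
    obtain F s where F: "\<And>p. f p = poly (F p) (p y)" "\<And>p. degree (F p) \<le> s" "\<And>i. (\<lambda>p. coeff (F p) i) \<in> pfun K"
      using pfun_expand[OF f(1)] by blast
    have "\<exists>i. \<not> vanishes (\<lambda>p. coeff (F p) i) X"
    proof (rule ccontr)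
      assume "\<not> ?thesis"
      then have "F p = 0" if "p \<in> X" for p using that by (auto simp: poly_eq_iff)
      then show False using f(2) F(1) by simp
    qed
    then obtain i where i: "\<not> vanishes (\<lambda>p. coeff (F p) i) X" ..
    have "\<exists>c. p(y := c) \<in> closure_pts (insert y K) X \<and> f (p(y := c)) \<noteq> 0"
      if p: "p \<in> closure_pts K X" "coeff (F p) i \<noteq> 0" for p
    proof -
      have "F p \<noteq> 0" using p(2) by auto
      then obtain c where c: "poly (F p) c \<noteq> 0" using poly_all_0_iff_0 by blast
      have nz: "f (p(y := c)) \<noteq> 0" using c upd[OF F(3), of p c] by (simp add: F(1))
      have "G (p(y := c)) = 0" if G: "G \<in> pfun (insert y K)" "vanishes G X" for G
      proof -
        obtain Q s where Q: "\<And>p. G p = poly (Q p) (p y)" "\<And>p. degree (Q p) \<le> s" "\<And>i. (\<lambda>p. coeff (Q p) i) \<in> pfun K"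
          using pfun_expand[OF G(1)] by blast
        have "coeff (Q p) i = 0" for i
          using closure_ptsD[OF p(1) Q(3) vcoeff[OF Q G(2)]] .
        then have "Q p = 0" by (simp add: poly_eq_iff)
        then show ?thesis using Q(1)[of "p(y := c)"] upd[OF Q(3), of p c] by simp
      qed
      then have "p(y := c) \<in> closure_pts (insert y K) X" by (rule closure_ptsI)
      with nz show ?thesis by blast
    qed
    then show ?thesis using F(3)[of i] i by (intro bexI[of _ "\<lambda>p. coeff (F p) i"]) blast+
  next
    case True
    define d where "d = (LEAST d. \<exists>H. rel d H)"
    have "\<exists>H. rel d H" unfolding d_def using True by (rule LeastI_ex)
    then obtain H where H: "rel d H" ..
    have min: "\<not> rel j H'" if "j < d" for j H' using not_less_Least that unfolding d_def by blast
    have Hc: "\<And>i. (\<lambda>p. coeff (H p) i) \<in> pfun K" and Hd: "\<And>p i. i > d \<Longrightarrow> coeff (H p) i = 0"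
      and Hv: "\<And>p. p \<in> X \<Longrightarrow> poly (H p) (p y) = 0" and Hl: "\<not> vanishes (\<lambda>p. coeff (H p) d) X"
      using H unfolding rel_def by auto
    have small: "vanishes (\<lambda>p. coeff (R p) i) X"
      if "\<And>i. (\<lambda>p. coeff (R p) i) \<in> pfun K" "\<And>p i. i \<ge> d \<Longrightarrow> coeff (R p) i = 0"
        "vanishes (\<lambda>p. poly (R p) (p y)) X" for R i
      using relI[OF that(1,2,3)] min by blast
    obtain F s where F: "\<And>p. f p = poly (F p) (p y)" "\<And>p. degree (F p) \<le> s" "\<And>i. (\<lambda>p. coeff (F p) i) \<in> pfun K"
      using pfun_expand[OF f(1)] by blast
    have powc: "(\<lambda>p. coeff (F p ^ k) i) \<in> pfun K" for k i
    proof (induction k arbitrary: i)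
      case 0
      then show ?case by (auto simp: coeff_1 pfun_const)
    next
      case (Suc k)
      then show ?case using F(3) by (simp add: coeff_mult) (intro pfun_sum pfun_mult)
    qed
    have powd: "coeff (F p ^ d) i = 0" if "i \<ge> Suc (s * d)" for p i
    proof (rule coeff_eq_0)
      have "degree (F p ^ d) \<le> degree (F p) * d" by (rule degree_power_le)
      also have "\<dots> \<le> s * d" using F(2) by simp
      finally show "degree (F p ^ d) < i" using that by simp
    qed
    \<comment> \<open>The power \<open>d\<close> comes from the univariate Nullstellensatz: if every
      root of \<open>H p\<close>, of degree \<open>d\<close>, were a root of \<open>F p\<close>,
      then \<open>H p\<close> would divide \<open>F p ^ d\<close> and the remainder
      \<open>R p\<close> would be zero.\<close>
    from pseudo_division[of H K d, OF Hc Hd powc powd]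
    obtain N Q R where R: "\<And>i. (\<lambda>p. coeff (R p) i) \<in> pfun K" "\<And>p i. i \<ge> d \<Longrightarrow> coeff (R p) i = 0"
      and eq: "\<And>p. smult (coeff (H p) d ^ N) (F p ^ d) = Q p * H p + R p" by metis
    have "\<not> vanishes (\<lambda>p. coeff (H p) d ^ N * f p ^ d) X"
    proof -
      have pw: "\<not> vanishes (\<lambda>p. h p ^ k) X" if "h \<in> pfun I" "\<not> vanishes h X" for h k
        using that by auto
      have "(\<lambda>p. coeff (H p) d ^ N) \<in> pfun I" "(\<lambda>p. f p ^ d) \<in> pfun I"
        using Hc f(1) KI KI' by (auto intro!: pfun_power intro: pfun_mono)
      moreover have "\<not> vanishes (\<lambda>p. coeff (H p) d ^ N) X" "\<not> vanishes (\<lambda>p. f p ^ d) X"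
        using Hl f(2) by auto
      ultimately show ?thesis
        using zirreducibleD[OF X, of "\<lambda>p. coeff (H p) d ^ N" "\<lambda>p. f p ^ d"] by blast
    qed
    moreover have "coeff (H p) d ^ N * f p ^ d = poly (R p) (p y)" if "p \<in> X" for p
      using arg_cong[OF eq[of p], of "\<lambda>q. poly q (p y)"] Hv[OF that] by (simp add: F(1))
    ultimately have Rv: "\<not> vanishes (\<lambda>p. poly (R p) (p y)) X" by simp
    have "\<exists>i. \<not> vanishes (\<lambda>p. coeff (R p) i) X"
    proof (rule ccontr)
      assume "\<not> ?thesis"
      then have "R p = 0" if "p \<in> X" for p using that by (auto simp: poly_eq_iff)
      then show False using Rv by simp
    qed
    then obtain i where i: "\<not> vanishes (\<lambda>p. coeff (R p) i) X" ..
    \<comment> \<open>The first factor keeps \<open>H p\<close> at full degree \<open>d\<close>, the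
      second keeps the remainder \<open>R p\<close> nonzero. Together they force a root of
      \<open>H p\<close> at which \<open>F p\<close> does not vanish.\<close>
    define g where "g p = coeff (H p) d * coeff (R p) i" for p
    have gK: "g \<in> pfun K" unfolding g_def using Hc R(1) by (intro pfun_mult)
    have gX: "\<not> vanishes g X"
      unfolding g_def using zirreducibleD[OF X pfun_mono[OF Hc KI'] pfun_mono[OF R(1) KI'], of d i] Hl i by blast
    have "\<exists>c. p(y := c) \<in> closure_pts (insert y K) X \<and> f (p(y := c)) \<noteq> 0"
      if p: "p \<in> closure_pts K X" "g p \<noteq> 0" for p
    proof -
      have hd: "coeff (H p) d \<noteq> 0" and ri: "coeff (R p) i \<noteq> 0" using p(2) unfolding g_def by auto
      have deg: "degree (H p) = d"
        using Hd[of _ p] hd by (intro antisym degree_le le_degree) auto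
      have "\<exists>c. poly (H p) c = 0 \<and> poly (F p) c \<noteq> 0"
      proof (rule ccontr)
        assume "\<not> ?thesis"
        then have "H p dvd F p ^ d"
          using nullstellensatz_univariate[of "H p" "F p"] hd deg by auto
        then have "H p dvd smult (coeff (H p) d ^ N) (F p ^ d)" by (rule dvd_smult)
        then have "H p dvd R p" unfolding eq by (simp add: dvd_add_right_iff)
        moreover have "R p \<noteq> 0" using ri by auto
        ultimately have "d \<le> degree (R p)" using dvd_imp_degree_le deg by metis
        moreover have "coeff (R p) (degree (R p)) \<noteq> 0" using \<open>R p \<noteq> 0\<close> by simp
        ultimately show False using R(2) by blast
      qed
      then obtain c where c: "poly (H p) c = 0" "poly (F p) c \<noteq> 0" by blast
      have nz: "f (p(y := c)) \<noteq> 0" using c upd[OF F(3), of p c] by (simp add: F(1))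
      have "G (p(y := c)) = 0" if G: "G \<in> pfun (insert y K)" "vanishes G X" for G
      proof -
        obtain Q s where Q: "\<And>p. G p = poly (Q p) (p y)" "\<And>p. degree (Q p) \<le> s" "\<And>i. (\<lambda>p. coeff (Q p) i) \<in> pfun K"
          using pfun_expand[OF G(1)] by blast
        have Qd: "coeff (Q p) i = 0" if "i \<ge> Suc s" for p i using Q(2)[of p] that by (intro coeff_eq_0) auto
        \<comment> \<open>Modulo \<open>H\<close>, a function vanishing on \<open>X\<close> leaves a
          remainder of degree below \<open>d\<close>, whose coefficients vanish on \<open>X\<close>
          by minimality of \<open>d\<close>. Roots of \<open>H p\<close> are therefore roots of
          \<open>Q p\<close>.\<close>
        from pseudo_division[of H K d, OF Hc Hd Q(3) Qd]
        obtain N S R where R: "\<And>i. (\<lambda>p. coeff (R p) i) \<in> pfun K" "\<And>p i. i \<ge> d \<Longrightarrow> coeff (R p) i = 0"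
          and eq: "\<And>p. smult (coeff (H p) d ^ N) (Q p) = S p * H p + R p" by metis
        have "poly (R p) (p y) = 0" if "p \<in> X" for p
          using arg_cong[OF eq[of p], of "\<lambda>q. poly q (p y)"] Hv[OF that] G(2) that by (simp add: Q(1))
        then have "vanishes (\<lambda>p. coeff (R p) i) X" for i by (intro small R) auto
        then have "coeff (R p) i = 0" for i using closure_ptsD[OF p(1) R(1)] by blast
        then have "R p = 0" by (simp add: poly_eq_iff)
        then have "coeff (H p) d ^ N * poly (Q p) c = 0"
          using arg_cong[OF eq[of p], of "\<lambda>q. poly q c"] c(1) by simp
        then have "poly (Q p) c = 0" using hd by simp
        then show ?thesis using Q(1)[of "p(y := c)"] upd[OF Q(3), of p c] by simp
      qed
      then have "p(y := c) \<in> closure_pts (insert y K) X" by (rule closure_ptsI)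
      with nz show ?thesis by blast
    qed
    then show ?thesis using gK gX by (intro bexI[of _ g]) blast+
  qed
qed

text \<open>A form of Chevalley's theorem for coordinate projections: the image of the open part
  \<open>f \<noteq> 0\<close> contains an open part \<open>g \<noteq> 0\<close> of the closure of
  the projection. The coordinates in \<open>L\<close> are removed singly; each removal turns the
  current condition into one in fewer variables.\<close>

lemma lift_points:
  assumes X: "zirreducible I X" and fin: "finite L" and sub: "J \<union> L \<subseteq> I" and disj: "J \<inter> L = {}"
    and f: "f \<in> pfun (J \<union> L)" "\<not> vanishes f X"
  shows "\<exists>g\<in>pfun J. \<not> vanishes g X \<and> (\<forall>p\<in>closure_pts J X. g p \<noteq> 0 \<longrightarrow>
     (\<exists>q\<in>closure_pts (J \<union> L) X. (\<forall>v. v \<notin> L \<longrightarrow> q v = p v) \<and> f q \<noteq> 0))"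
  using fin sub disj f
proof (induction L arbitrary: f rule: finite_induct)
  case empty
  then show ?case by auto
next
  case (insert y L)
  have "f \<in> pfun (insert y (J \<union> L))" using insert.prems by simp
  from lift_step[OF X _ _ this] insert.prems insert.hyps
  obtain h where h: "h \<in> pfun (J \<union> L)" "\<not> vanishes h X"
    and lh: "\<And>p. p \<in> closure_pts (J \<union> L) X \<Longrightarrow> h p \<noteq> 0 \<Longrightarrow>
      \<exists>c. p(y := c) \<in> closure_pts (insert y (J \<union> L)) X \<and> f (p(y := c)) \<noteq> 0" by auto
  from insert.IH[OF _ _ h] insert.prems
  obtain g where g: "g \<in> pfun J" "\<not> vanishes g X"
    and lg: "\<And>p. p \<in> closure_pts J X \<Longrightarrow> g p \<noteq> 0 \<Longrightarrow>
      \<exists>q\<in>closure_pts (J \<union> L) X. (\<forall>v. v \<notin> L \<longrightarrow> q v = p v) \<and> h q \<noteq> 0" by auto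
  have "\<exists>q\<in>closure_pts (J \<union> insert y L) X. (\<forall>v. v \<notin> insert y L \<longrightarrow> q v = p v) \<and> f q \<noteq> 0"
    if pg: "p \<in> closure_pts J X" "g p \<noteq> 0" for p
  proof -
    obtain q where q: "q \<in> closure_pts (J \<union> L) X" "\<forall>v. v \<notin> L \<longrightarrow> q v = p v" "h q \<noteq> 0" using lg[OF pg] by blast
    obtain c where c: "q(y := c) \<in> closure_pts (insert y (J \<union> L)) X" "f (q(y := c)) \<noteq> 0" using lh[OF q(1,3)] by blast
    show ?thesis using c q(2) by (intro bexI[of _ "q(y := c)"]) auto
  qed
  then show ?case using g by blast
qed

subsection \<open>Chains of irreducible sets\<close>

text \<open>Algebraic independence of the coordinates \<open>J\<close> in the coordinate ring of
  \<open>X\<close>.\<close>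

definition indep_on :: "'v set \<Rightarrow> ('v \<Rightarrow> complex) set \<Rightarrow> bool" where
  "indep_on J X \<longleftrightarrow> (\<forall>f\<in>pfun J. vanishes f X \<longrightarrow> (\<forall>p. f p = 0))"

lemma indep_onD: "indep_on J X \<Longrightarrow> f \<in> pfun J \<Longrightarrow> vanishes f X \<Longrightarrow> f p = 0"
  unfolding indep_on_def by blast

text \<open>The slice \<open>p j = c\<close> has finitely many irreducible pieces. If each satisfied
  a nontrivial relation in \<open>J\<close>, the product of these relations would vanish on the
  slice; but a point over which this product is nonzero lifts into the slice.\<close>

lemma indep_chain_step:
  assumes I: "finite I" and X: "zirreducible I X" and J: "insert j J \<subseteq> I" "j \<notin> J"
    and ind: "indep_on (insert j J) X"
  shows "\<exists>Z. zirreducible I Z \<and> Z \<subset> X \<and> indep_on J Z"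
proof -
  define L where "L = I - insert j J"
  have IL: "insert j J \<union> L = I" "insert j J \<inter> L = {}" "finite L" unfolding L_def using J I by auto
  have "\<not> vanishes (\<lambda>p. 1) X" using X unfolding zirreducible_def by auto
  from lift_points[OF X IL(3) _ IL(2) pfun_const this, unfolded IL(1), OF subset_refl]
  obtain g where g: "g \<in> pfun (insert j J)" "\<not> vanishes g X"
    and lift: "\<And>p. p \<in> closure_pts (insert j J) X \<Longrightarrow> g p \<noteq> 0 \<Longrightarrow>
      \<exists>q\<in>closure_pts I X. \<forall>v. v \<notin> L \<longrightarrow> q v = p v" by blast
  obtain p0 where p0: "g p0 \<noteq> 0" using g(2) by auto
  \<comment> \<open>Taking the \<open>j\<close>-coordinate of a point with
    \<open>g \<noteq> 0\<close> ensures that \<open>g\<close> restricted to the hyperplane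
    \<open>p j = c\<close> is not the zero function.\<close>
  define c where "c = p0 j"
  define g' where "g' p = g (p(j := c))" for p
  have g': "g' \<in> pfun J"
  proof -
    have "(\<lambda>p. g (\<lambda>v. (if v = j then (\<lambda>p. c) else (\<lambda>p. p v)) p)) \<in> pfun J"
      using g(1) by (rule pfun_subst) (auto intro: pfun_const pfun_var)
    moreover have "(\<lambda>p. g (\<lambda>v. (if v = j then (\<lambda>p. c) else (\<lambda>p. p v)) p)) = g'"
      unfolding g'_def fun_upd_def by (auto intro!: ext arg_cong[where f = g])
    ultimately show ?thesis by simp
  qed
  have jc: "(\<lambda>p. p j - c) \<in> pfun I" using J by (intro pfun_diff pfun_var pfun_const) auto
  define X' where "X' = {p \<in> X. p j - c = 0}"
  have "zclosed I X'" unfolding X'_def using zirreducible_zclosed[OF X] jc by (rule zclosed_Int_zeros)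
  then obtain \<C> where C: "finite \<C>" "\<forall>Z\<in>\<C>. zirreducible I Z" "X' = \<Union>\<C>"
    using zclosed_decomposition[OF I] by metis
  have "\<exists>Z\<in>\<C>. indep_on J Z"
  proof (rule ccontr)
    assume "\<not> ?thesis"
    then have "\<exists>h. h \<in> pfun J \<and> vanishes h Z \<and> (\<exists>p. h p \<noteq> 0)" if "Z \<in> \<C>" for Z
      using that unfolding indep_on_def by blast
    then obtain h where h: "\<And>Z. Z \<in> \<C> \<Longrightarrow> h Z \<in> pfun J \<and> vanishes (h Z) Z \<and> (\<exists>p. h Z p \<noteq> 0)" by metis
    have "\<exists>p. (\<Prod>Z\<in>\<C>. h Z p) \<noteq> 0" using C(1) h by (intro pfun_nonzero_prod[where K = J]) auto
    then obtain p1 where "(\<Prod>Z\<in>\<C>. h Z p1) \<noteq> 0" ..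
    moreover have "g' p0 \<noteq> 0" using p0 unfolding g'_def c_def by simp
    moreover have "(\<lambda>p. \<Prod>Z\<in>\<C>. h Z p) \<in> pfun J" using h by (intro pfun_prod) auto
    ultimately obtain p where p: "g' p * (\<Prod>Z\<in>\<C>. h Z p) \<noteq> 0" using pfun_nonzero_mult[OF g'] by meson
    have "p(j := c) \<in> closure_pts (insert j J) X"
      by (rule closure_ptsI) (rule indep_onD[OF ind])
    moreover have "g (p(j := c)) \<noteq> 0" using p unfolding g'_def by auto
    ultimately obtain q where q: "q \<in> closure_pts I X" "\<forall>v. v \<notin> L \<longrightarrow> q v = (p(j := c)) v"
      using lift by blast
    \<comment> \<open>The lift is controlled only on \<open>I\<close>; the remaining coordinates are
      set to 0 to return to \<open>aspace I\<close>.\<close>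
    define q' where "q' = (\<lambda>v. if v \<in> I then q v else 0)"
    have "q' \<in> X"
    proof (rule zclosed_memI[OF zirreducible_zclosed[OF X]])
      show "q' \<in> aspace I" unfolding q'_def aspace_def by simp
      fix f assume f: "f \<in> pfun I" "vanishes f X"
      have "f q' = f q" using f(1) unfolding q'_def by (rule pfun_cong) auto
      then show "f q' = 0" using closure_ptsD[OF q(1) f] by simp
    qed
    moreover have "q' j = c" using q(2) IL J unfolding q'_def by auto
    ultimately have "q' \<in> X'" unfolding X'_def by simp
    then obtain Z where Z: "Z \<in> \<C>" "q' \<in> Z" using C(3) by blast
    have "h Z q' = h Z p"
    proof (rule pfun_cong[of "h Z" J])
      show "h Z \<in> pfun J" using h Z by blast
      fix v assume "v \<in> J"
      then show "q' v = p v" using q(2) IL J unfolding q'_def by auto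
    qed
    moreover have "h Z p \<noteq> 0" using p Z(1) C(1) by auto
    moreover have "h Z q' = 0" using h Z by blast
    ultimately show False by simp
  qed
  then obtain Z where Z: "Z \<in> \<C>" "indep_on J Z" ..
  have "X' \<noteq> X"
  proof
    assume "X' = X"
    then have "vanishes (\<lambda>p. p j - c) X" unfolding X'_def by blast
    moreover have "(\<lambda>p. p j - c) \<in> pfun (insert j J)" by (intro pfun_diff pfun_var pfun_const) auto
    \<comment> \<open>Any point with \<open>j\<close>-coordinate different from \<open>c\<close>
      shows that \<open>p j - c\<close> is not the zero function, so by independence the slice is
      proper.\<close>
    ultimately have "(\<lambda>v. c + 1) j - c = 0" using indep_onD[OF ind, of "\<lambda>p. p j - c" "\<lambda>v. c + 1"] by blast
    then show False by simp
  qed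
  then have "Z \<subset> X" using Z(1) C(3) unfolding X'_def by blast
  then show ?thesis using Z C(2) by blast
qed

lemma zchain_snoc:
  assumes "zchain I Y k Z" "Y \<subset> X" "zirreducible I X"
  shows "zchain I X (Suc k) (Z(Suc k := X))"
  unfolding zchain_def
proof (intro conjI allI impI)
  have Z: "\<And>i. i \<le> k \<Longrightarrow> zirreducible I (Z i)" "\<And>i. i \<le> k \<Longrightarrow> Z i \<subseteq> Y" "\<And>i. i < k \<Longrightarrow> Z i \<subset> Z (Suc i)"
    using assms(1) unfolding zchain_def by auto
  fix i
  show "zirreducible I ((Z(Suc k := X)) i)" if "i \<le> Suc k" using that assms(3) Z(1)[of i] by (cases "i = Suc k") simp_all
  show "(Z(Suc k := X)) i \<subseteq> X" if "i \<le> Suc k"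
  proof (cases "i = Suc k")
    case False
    then show ?thesis using that assms(2) Z(2)[of i] by fastforce
  qed simp
  show "(Z(Suc k := X)) i \<subset> (Z(Suc k := X)) (Suc i)" if "i < Suc k"
  proof (cases "i = k")
    case True
    then show ?thesis using assms(2) Z(2)[of k] by auto
  next
    case False
    then show ?thesis using that Z(3)[of i] by simp
  qed
qed

lemma indep_chain:
  assumes I: "finite I" and J: "finite J" "J \<subseteq> I" and X: "zirreducible I X" and ind: "indep_on J X"
  shows "\<exists>Z. zchain I X (card J) Z"
  using J X ind
proof (induction J arbitrary: X rule: finite_induct)
  case empty
  then show ?case by (intro exI[of _ "\<lambda>_. X"]) (auto simp: zchain_def)
next
  case (insert j J)
  then obtain Y where Y: "zirreducible I Y" "Y \<subset> X" "indep_on J Y"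
    using indep_chain_step[OF I, of X j J] by blast
  then obtain Z where "zchain I Y (card J) Z" using insert by blast
  from zchain_snoc[OF this Y(2) insert.prems(2)] show ?case using insert.hyps by auto
qed

subsection \<open>Growth of Hilbert functions\<close>

definition lin_indep_on :: "'p set \<Rightarrow> (nat \<Rightarrow> 'p \<Rightarrow> complex) \<Rightarrow> nat \<Rightarrow> bool" where
  "lin_indep_on X g k \<longleftrightarrow> (\<forall>a. vanishes (\<lambda>p. \<Sum>i<k. a i * g i p) X \<longrightarrow> (\<forall>i<k. a i = 0))"

lemma lin_indep_onI:
  "(\<And>a i. vanishes (\<lambda>p. \<Sum>i<k. a i * g i p) X \<Longrightarrow> i < k \<Longrightarrow> a i = 0) \<Longrightarrow> lin_indep_on X g k"
  unfolding lin_indep_on_def by (intro allI impI)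

lemma lin_indep_onD:
  assumes "lin_indep_on X g k" "vanishes (\<lambda>p. \<Sum>i<k. a i * g i p) X" "i < k"
  shows "a i = 0"
  using assms(2,3) assms(1)[unfolded lin_indep_on_def, THEN spec[of _ a]] by simp

text \<open>The Hilbert function of \<open>X\<close>, the dimension of the space of restrictions of
  \<open>dpol I s\<close> to \<open>X\<close>, is at least \<open>k\<close> at
  \<open>s\<close>.\<close>

definition rich :: "'v set \<Rightarrow> ('v \<Rightarrow> complex) set \<Rightarrow> nat \<Rightarrow> nat \<Rightarrow> bool" where
  "rich I X s k \<longleftrightarrow> (\<exists>g. (\<forall>i<k. g i \<in> dpol I s) \<and> lin_indep_on X g k)"

lemma richI: "(\<And>i. i < k \<Longrightarrow> g i \<in> dpol I s) \<Longrightarrow> lin_indep_on X g k \<Longrightarrow> rich I X s k"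
  unfolding rich_def by blast

lemma richE:
  assumes "rich I X s k"
  obtains g where "\<And>i. i < k \<Longrightarrow> g i \<in> dpol I s" "lin_indep_on X g k"
  using assms unfolding rich_def by blast

lemma rich_mono:
  assumes "rich I X s k" "I \<subseteq> J" "X \<subseteq> Y" "s \<le> t"
  shows "rich J Y t k"
proof -
  from assms(1) obtain g where g: "\<And>i. i < k \<Longrightarrow> g i \<in> dpol I s"
    "lin_indep_on X g k"
    by (rule richE) blast
  show ?thesis
  proof (rule richI)
    show "g i \<in> dpol J t" if "i < k" for i using g(1)[OF that] assms(2,4) by (rule dpol_mono)
    show "lin_indep_on Y g k"
    proof (rule lin_indep_onI)
      fix a i assume "vanishes (\<lambda>p. \<Sum>i<k. a i * g i p) Y" "i < k"
      with assms(3) show "a i = 0" by (intro lin_indep_onD[OF g(2)]) auto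
    qed
  qed
qed

lemma rich_zclosure:
  assumes "S \<subseteq> aspace I" "rich I (zclosure I S) s k"
  shows "rich I S s k"
proof -
  from assms(2) obtain g where g: "\<And>i. i < k \<Longrightarrow> g i \<in> dpol I s"
    and ind: "lin_indep_on (zclosure I S) g k"
    by (rule richE) blast
  have "(\<lambda>p. \<Sum>i<k. a i * g i p) \<in> pfun I" for a :: "nat \<Rightarrow> complex"
    using g by (intro pfun_sum pfun_mult pfun_const) (auto intro: dpol_pfun)
  note van = vanishes_zclosure[OF assms(1) this]
  show ?thesis
  proof (rule richI[OF g lin_indep_onI])
    fix a i assume "vanishes (\<lambda>p. \<Sum>i<k. a i * g i p) S" "i < k"
    with van[of a] show "a i = 0" by (intro lin_indep_onD[OF ind]) simp_all
  qed
qed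

lemma rich_proj:
  assumes "rich K (proj K ` S) s k" "K \<subseteq> I"
  shows "rich I S s k"
proof -
  from assms(1) obtain g where g: "\<And>i. i < k \<Longrightarrow> g i \<in> dpol K s"
    and ind: "lin_indep_on (proj K ` S) g k"
    by (rule richE) blast
  have eq: "g i (proj K p) = g i p" if "i < k" for i p
    using dpol_pfun[OF g[OF that]] by (rule pfun_cong) (simp add: proj_def)
  have "rich K S s k"
  proof (rule richI[OF g lin_indep_onI])
    fix a i assume "vanishes (\<lambda>p. \<Sum>i<k. a i * g i p) S" "i < k"
    then show "a i = 0" by (intro lin_indep_onD[OF ind]) (auto simp: eq)
  qed
  then show ?thesis using assms(2) by (rule rich_mono) auto
qed

text \<open>Multiples of \<open>f\<close> are invisible on \<open>Z\<close>, so a family independent on \<open>Z\<close> and the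
  \<open>f\<close>-multiples of a family independent on \<open>X\<close> are jointly independent on \<open>X\<close>.\<close>
lemma rich_step:
  assumes X: "zirreducible I X" and "Z \<subseteq> X" and f: "f \<in> dpol I d" "vanishes f Z" "\<not> vanishes f X"
    and "rich I Z s k" "rich I X s l"
  shows "rich I X (s + d) (k + l)"
proof -
  from assms(6) obtain g where g: "\<And>i. i < k \<Longrightarrow> g i \<in> dpol I s"
    and gi: "lin_indep_on Z g k"
    by (rule richE) blast
  from assms(7) obtain h where h: "\<And>i. i < l \<Longrightarrow> h i \<in> dpol I s"
    and hi: "lin_indep_on X h l"
    by (rule richE) blast
  define u where "u i = (if i < k then g i else f * h (i - k))" for i
  have "u i \<in> dpol I (s + d)" if "i < k + l" for i
    using that g[of i] dpol_mult[OF f(1) h[of "i - k"]] unfolding u_def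
    by (auto simp: add.commute intro: dpol_mono)
  moreover have "a i = 0" if van: "vanishes (\<lambda>p. \<Sum>i<k + l. a i * u i p) X" and "i < k + l"
    for a :: "nat \<Rightarrow> complex" and i
  proof -
    have split: "(\<Sum>i<k + m. w i) = (\<Sum>i<k. w i) + (\<Sum>i<m. w (k + i))" for w :: "nat \<Rightarrow> complex" and m
      by (induction m) (auto simp: add.assoc)
    have sum: "(\<Sum>i<k + l. a i * u i p) = (\<Sum>i<k. a i * g i p) + f p * (\<Sum>i<l. a (k + i) * h i p)" for p
      unfolding split by (simp add: u_def sum_distrib_left mult.left_commute)
    have "vanishes (\<lambda>p. \<Sum>i<k. a i * g i p) Z"
    proof
      fix p assume "p \<in> Z"
      with van \<open>Z \<subseteq> X\<close> have "(\<Sum>i<k + l. a i * u i p) = 0" by blast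
      then show "(\<Sum>i<k. a i * g i p) = 0" using f(2) \<open>p \<in> Z\<close> by (simp add: sum)
    qed
    then have a: "a i = 0" if "i < k" for i using that by (rule lin_indep_onD[OF gi])
    then have "vanishes (\<lambda>p. f p * (\<Sum>i<l. a (k + i) * h i p)) X" using van by (simp add: sum)
    moreover have "(\<lambda>p. \<Sum>i<l. a (k + i) * h i p) \<in> pfun I"
      using h by (intro pfun_sum pfun_mult pfun_const) (auto intro: dpol_pfun)
    ultimately have "vanishes (\<lambda>p. \<Sum>i<l. a (k + i) * h i p) X"
      using zirreducibleD[OF X dpol_pfun[OF f(1)]] f(3) by blast
    then have b: "a (k + i) = 0" if "i < l" for i
      using lin_indep_onD[OF hi, of "\<lambda>i. a (k + i)"] that by blast
    show ?thesis using a[of i] b[of "i - k"] \<open>i < k + l\<close> by (cases "i < k") auto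
  qed
  ultimately show ?thesis by (intro richI lin_indep_onI)
qed

lemma rich_one: "X \<noteq> {} \<Longrightarrow> rich I X s 1"
  by (rule richI[of _ "\<lambda>_ _. 1"]) (auto intro!: dpol_const lin_indep_onI)

lemma rich_zero: "rich I X s 0"
  by (rule richI[of _ "\<lambda>_ _. 0"]) (auto intro!: lin_indep_onI)

text \<open>A double induction along Pascal's rule: for \<open>Z i\<close> inside
  \<open>Z (Suc i)\<close>, \<open>rich_step\<close> adds \<open>j choose i\<close> and
  \<open>j choose Suc i\<close> to \<open>Suc j choose Suc i\<close> while the degree grows by
  \<open>d\<close>.\<close>

lemma chain_rich:
  assumes "zchain I X n Z"
  shows "\<exists>d. \<forall>j. rich I X (j * d) (j choose n)"
proof -
  have Z: "\<And>i. i \<le> n \<Longrightarrow> zirreducible I (Z i)" "\<And>i. i \<le> n \<Longrightarrow> Z i \<subseteq> X" "\<And>i. i < n \<Longrightarrow> Z i \<subset> Z (Suc i)"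
    using assms unfolding zchain_def by auto
  have "\<exists>f d. f \<in> dpol I d \<and> vanishes f (Z i) \<and> \<not> vanishes f (Z (Suc i))" if "i < n" for i
  proof -
    have "zclosed I (Z i)" "Z (Suc i) \<subseteq> aspace I" "\<not> Z (Suc i) \<subseteq> Z i"
      using Z(1)[of i] Z(1)[of "Suc i"] Z(3)[of i] that
      by (auto intro: zirreducible_zclosed dest: zirreducible_subset_aspace)
    from zclosed_not_subset[OF this] obtain f where "f \<in> pfun I" "vanishes f (Z i)" "\<not> vanishes f (Z (Suc i))" .
    then show ?thesis using pfun_dpol by blast
  qed
  then obtain f d' where f: "\<And>i. i < n \<Longrightarrow> f i \<in> dpol I (d' i) \<and> vanishes (f i) (Z i) \<and> \<not> vanishes (f i) (Z (Suc i))"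
    by metis
  \<comment> \<open>The sum is a common bound for the degrees of all separating functions.\<close>
  define d where "d = (\<Sum>i<n. d' i)"
  have d: "f i \<in> dpol I d" if "i < n" for i
  proof (rule dpol_mono)
    show "f i \<in> dpol I (d' i)" using f that by blast
    show "d' i \<le> d" unfolding d_def using that by (intro member_le_sum) auto
  qed simp
  have "rich I (Z i) (j * d) (j choose i)" if "i \<le> n" for i j
    using that
  proof (induction i arbitrary: j)
    case 0
    then have "Z 0 \<noteq> {}" using Z(1)[of 0] unfolding zirreducible_def by simp
    then show ?case using rich_one by simp
  next
    case (Suc i)
    show ?case
    proof (induction j)
      case 0
      then show ?case by (simp add: rich_zero)
    next
      case (Suc j)
      have "rich I (Z (Suc i)) (j * d + d) ((j choose i) + (j choose Suc i))"
      proof (rule rich_step[where f = "f i" and Z = "Z i"])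
        show "Z i \<subseteq> Z (Suc i)" using Z(3)[of i] Suc.prems \<open>Suc i \<le> n\<close> by auto
      qed (use Suc \<open>Suc i \<le> n\<close> \<open>\<And>j. i \<le> n \<Longrightarrow> rich I (Z i) (j * d) (j choose i)\<close> Z(1) d f in auto)
      then show ?case by (simp add: add.commute)
    qed
  qed
  then show ?thesis using rich_mono[OF _ order_refl Z(2)[of n] order_refl] by blast
qed

lemma no_long_chain:
  assumes "\<And>s k. rich I X s k \<Longrightarrow> k \<le> C * (s + 1) ^ n"
  shows "\<not> (\<exists>Z. zchain I X (Suc n) Z)"
proof
  assume "\<exists>Z. zchain I X (Suc n) Z"
  then obtain d where d: "\<And>j. rich I X (j * d) (j choose Suc n)" using chain_rich by metis
  \<comment> \<open>With \<open>j = Suc n * t\<close> the binomial coefficient is at least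
    \<open>t ^ Suc n\<close>, while the bound gives at most \<open>(t - 1) * t ^ n\<close>; the
    constant in \<open>t\<close> is the one left after pulling \<open>t\<close> out of
    \<open>j * d + 1\<close>.\<close>
  define t where "t = C * (Suc n * d + 1) ^ n + 1"
  define j where "j = Suc n * t"
  have "t \<ge> 1" unfolding t_def by simp
  then have "Suc n * 1 \<le> j" unfolding j_def by (rule mult_le_mono2)
  then have "Suc n \<le> j" by simp
  have "real j / real (Suc n) = real t" unfolding j_def of_nat_mult by (rule nonzero_mult_div_cancel_left) simp
  then have "real (t ^ Suc n) = (real j / real (Suc n)) ^ Suc n" by simp
  also have "\<dots> \<le> real (j choose Suc n)" using \<open>Suc n \<le> j\<close> by (rule binomial_ge_n_over_k_pow_k)
  finally have "t ^ Suc n \<le> j choose Suc n" by linarith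
  also have "\<dots> \<le> C * (j * d + 1) ^ n" using assms[OF d] .
  also have "\<dots> \<le> C * ((Suc n * d + 1) * t) ^ n"
    using \<open>t \<ge> 1\<close> unfolding j_def by (intro mult_left_mono power_mono) (auto simp: algebra_simps)
  also have "\<dots> = (C * (Suc n * d + 1) ^ n) * t ^ n" by (simp only: power_mult_distrib mult.assoc)
  also have "\<dots> < t * t ^ n" using \<open>t \<ge> 1\<close> unfolding t_def by simp
  finally show False by simp
qed

subsection \<open>Eliminating algebraic coordinates\<close>

interpretation fs: vector_space "\<lambda>(c::complex) (f::'p \<Rightarrow> complex) p. c * f p"
  by standard (auto simp: fun_eq_iff algebra_simps)

lemma sum_fun_apply: "(\<Sum>i\<in>A. f i) p = (\<Sum>i\<in>A. f i p)" for f :: "'i \<Rightarrow> 'p \<Rightarrow> 'b::comm_monoid_add"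
  by (induction A rule: infinite_finite_induct) auto

lemma span_sum_fun:
  assumes "\<And>i. i \<in> A \<Longrightarrow> f i \<in> fs.span B"
  shows "(\<lambda>p. \<Sum>i\<in>A. f i p) \<in> fs.span B"
proof -
  have "(\<Sum>i\<in>A. f i) \<in> fs.span B" using assms by (rule fs.span_sum)
  moreover have "(\<Sum>i\<in>A. f i) = (\<lambda>p. \<Sum>i\<in>A. f i p)" by (simp add: fun_eq_iff sum_fun_apply)
  ultimately show ?thesis by simp
qed

lemma span_mult_fun:
  assumes "g \<in> fs.span B"
  shows "(\<lambda>p. h p * g p) \<in> fs.span ((\<lambda>b p. h p * b p) ` B)"
  using assms
proof (rule fs.span_induct)
  show "fs.subspace {g. (\<lambda>p. h p * g p) \<in> fs.span ((\<lambda>b p. h p * b p) ` B)}"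
  proof (rule fs.subspaceI)
    have "(\<lambda>p. h p * 0 p) = 0" by (auto simp: fun_eq_iff)
    then show "0 \<in> {g. (\<lambda>p. h p * g p) \<in> fs.span ((\<lambda>b p. h p * b p) ` B)}" using fs.span_zero by simp
  next
    fix x y assume "x \<in> {g. (\<lambda>p. h p * g p) \<in> fs.span ((\<lambda>b p. h p * b p) ` B)}"
      "y \<in> {g. (\<lambda>p. h p * g p) \<in> fs.span ((\<lambda>b p. h p * b p) ` B)}"
    then have "(\<lambda>p. h p * x p) + (\<lambda>p. h p * y p) \<in> fs.span ((\<lambda>b p. h p * b p) ` B)" by (intro fs.span_add) auto
    moreover have "(\<lambda>p. h p * x p) + (\<lambda>p. h p * y p) = (\<lambda>p. h p * (x + y) p)" by (auto simp: fun_eq_iff algebra_simps)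
    ultimately show "x + y \<in> {g. (\<lambda>p. h p * g p) \<in> fs.span ((\<lambda>b p. h p * b p) ` B)}" by simp
  next
    fix c x assume "x \<in> {g. (\<lambda>p. h p * g p) \<in> fs.span ((\<lambda>b p. h p * b p) ` B)}"
    then have "(\<lambda>p. c * (h p * x p)) \<in> fs.span ((\<lambda>b p. h p * b p) ` B)" by (intro fs.span_scale) auto
    then show "(\<lambda>p. c * x p) \<in> {g. (\<lambda>p. h p * g p) \<in> fs.span ((\<lambda>b p. h p * b p) ` B)}"
      by (simp add: mult.left_commute)
  qed
qed (auto intro: fs.span_base)

text \<open>The factor \<open>F\<close> absorbs the denominators that arise when coordinates are eliminated.\<close>
definition slow_growth :: "('v \<Rightarrow> complex) set \<Rightarrow> 'v set \<Rightarrow> nat \<Rightarrow> bool" where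
  "slow_growth W K n \<longleftrightarrow> (\<exists>C. \<forall>s. \<exists>F B. (\<forall>p\<in>W. F p \<noteq> 0) \<and> finite B \<and> card B \<le> C * (s + 1) ^ n \<and>
     (\<forall>f\<in>dpol K s. (\<lambda>p. if p \<in> W then F p * f p else 0) \<in> fs.span B))"

lemma slow_growth_empty: "slow_growth W {} 0"
  unfolding slow_growth_def
proof (rule exI[of _ 1], rule allI)
  fix s
  have "(\<lambda>p. if p \<in> W then 1 * f p else 0) \<in> fs.span {\<lambda>p. if p \<in> W then 1 else 0}" if "f \<in> dpol {} s" for f
  proof -
    have "f p = f undefined" for p using dpol_pfun[OF that] by (rule pfun_cong) auto
    then have "(\<lambda>p. if p \<in> W then 1 * f p else 0) = (\<lambda>p. f undefined * (if p \<in> W then 1 else 0))"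
      by (auto simp: fun_eq_iff)
    also have "\<dots> \<in> fs.span {\<lambda>p. if p \<in> W then 1 else 0}"
      by (rule fs.span_scale[OF fs.span_base]) simp
    finally show ?thesis .
  qed
  then show "\<exists>F B. (\<forall>p\<in>W. F p \<noteq> 0) \<and> finite B \<and> card B \<le> 1 * (s + 1) ^ 0 \<and>
     (\<forall>f\<in>dpol {} s. (\<lambda>p. if p \<in> W then F p * f p else 0) \<in> fs.span B)"
    by (intro exI[of _ "\<lambda>_. 1"] exI[of _ "{\<lambda>p. if p \<in> W then 1 else 0}"]) auto
qed

lemma span_powers:
  fixes v :: 'v
  assumes "\<And>k. k \<in> A \<Longrightarrow> g k \<in> fs.span B" "\<And>k. k \<in> A \<Longrightarrow> r k < m"
  shows "(\<lambda>p. \<Sum>k\<in>A. p v ^ r k * g k p) \<in> fs.span (\<Union>i<m. (\<lambda>b p. p v ^ i * b p) ` B)"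
proof (rule span_sum_fun)
  fix k assume k: "k \<in> A"
  have "(\<lambda>p. p v ^ r k * g k p) \<in> fs.span ((\<lambda>b p. p v ^ r k * b p) ` B)"
    using assms(1)[OF k] by (rule span_mult_fun)
  moreover have "(\<lambda>b p. p v ^ r k * b p) ` B \<subseteq> (\<Union>i<m. (\<lambda>b p. p v ^ i * b p) ` B)"
    using assms(2)[OF k] by blast
  ultimately show "(\<lambda>p. p v ^ r k * g k p) \<in> fs.span (\<Union>i<m. (\<lambda>b p. p v ^ i * b p) ` B)"
    using fs.span_mono by blast
qed

lemma card_powers:
  fixes v :: 'v and B :: "(('v \<Rightarrow> complex) \<Rightarrow> complex) set"
  assumes "finite B"
  shows "card (\<Union>i<m. (\<lambda>b p. p v ^ i * b p) ` B) \<le> m * card B"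
proof -
  have "card (\<Union>i<m. (\<lambda>b p. p v ^ i * b p) ` B) \<le> (\<Sum>i<m. card ((\<lambda>b p. p v ^ i * b p) ` B))"
    by (rule card_UN_le) simp
  also have "\<dots> \<le> (\<Sum>i<m. card B)" using assms by (intro sum_mono card_image_le)
  finally show ?thesis by simp
qed

text \<open>A function of degree at most \<open>s\<close> is a combination of the
  \<open>s + 1\<close> powers of \<open>v\<close> up to \<open>s\<close>, which costs one factor
  \<open>s + 1\<close>.\<close>

lemma slow_growth_free:
  assumes "slow_growth W K n"
  shows "slow_growth W (insert v K) (Suc n)"
proof -
  from assms obtain C where C: "\<And>s. \<exists>F B. (\<forall>p\<in>W. F p \<noteq> 0) \<and> finite B \<and> card B \<le> C * (s + 1) ^ n \<and>
     (\<forall>f\<in>dpol K s. (\<lambda>p. if p \<in> W then F p * f p else 0) \<in> fs.span B)" unfolding slow_growth_def by blast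
  show ?thesis unfolding slow_growth_def
  proof (intro exI[of _ C] allI)
    fix s
    obtain F B where F: "\<forall>p\<in>W. F p \<noteq> 0" and B: "finite B" "card B \<le> C * (s + 1) ^ n"
      and sp: "\<And>f. f\<in>dpol K s \<Longrightarrow> (\<lambda>p. if p \<in> W then F p * f p else 0) \<in> fs.span B" using C[of s] by blast
    define B' where "B' = (\<Union>i<Suc s. (\<lambda>b p. p v ^ i * b p) ` B)"
    have "card B' \<le> Suc s * card B" unfolding B'_def using B(1) by (rule card_powers)
    also have "\<dots> \<le> Suc s * (C * (s + 1) ^ n)" using B(2) by (rule mult_le_mono2)
    finally have "card B' \<le> C * (s + 1) ^ Suc n" by (simp add: algebra_simps)
    moreover have "finite B'" unfolding B'_def using B(1) by simp
    moreover have "(\<lambda>p. if p \<in> W then F p * f p else 0) \<in> fs.span B'" if "f \<in> dpol (insert v K) s" for f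
    proof -
      from dpol_expand[OF that] obtain Q where Q: "\<And>p. f p = poly (Q p) (p v)" "\<And>p. degree (Q p) \<le> s"
        "\<And>i. (\<lambda>p. coeff (Q p) i) \<in> dpol K s" by blast
      have f: "f p = (\<Sum>k\<le>s. coeff (Q p) k * p v ^ k)" for p
      proof -
        have "f p = (\<Sum>i\<le>degree (Q p). coeff (Q p) i * p v ^ i)"
          using Q(1) by (simp add: poly_altdef)
        also have "\<dots> = (\<Sum>i\<le>s. coeff (Q p) i * p v ^ i)"
          using Q(2)[of p] by (intro sum.mono_neutral_left) (auto simp: coeff_eq_0)
        finally show ?thesis .
      qed
      have "(\<lambda>p. if p \<in> W then F p * f p else 0) =
          (\<lambda>p. \<Sum>k\<in>{..s}. p v ^ k * (if p \<in> W then F p * coeff (Q p) k else 0))"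
        by (auto simp: fun_eq_iff f sum_distrib_left algebra_simps)
      also have "\<dots> \<in> fs.span B'" unfolding B'_def by (rule span_powers) (auto intro: sp Q(3))
      finally show ?thesis .
    qed
    ultimately show "\<exists>F B. (\<forall>p\<in>W. F p \<noteq> 0) \<and> finite B \<and> card B \<le> C * (s + 1) ^ Suc n \<and>
     (\<forall>f\<in>dpol (insert v K) s. (\<lambda>p. if p \<in> W then F p * f p else 0) \<in> fs.span B)"
      using F by (intro exI[of _ F] exI[of _ B']) blast
  qed
qed

text \<open>On \<open>W\<close> the power \<open>v ^ e\<close> equals \<open>N / D\<close>, so only
  the powers of \<open>v\<close> below \<open>e\<close> survive. Multiplying by \<open>D ^ s\<close>
  clears all denominators at once. The coefficients then have degree at most
  \<open>s + d * s\<close>, and \<open>s + d * s + 1 \<le> (d + 1) * (s + 1)\<close> moves the loss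
  into the constant.\<close>

lemma slow_growth_algebraic:
  assumes "slow_growth W K n" and e: "e > 0" and ND: "N \<in> pfun K" "D \<in> pfun K"
    and rel: "\<And>p. p \<in> W \<Longrightarrow> D p \<noteq> 0 \<and> p v ^ e * D p = N p"
  shows "slow_growth W (insert v K) n"
proof -
  from ND obtain d1 d2 where "N \<in> dpol K d1" "D \<in> dpol K d2" using pfun_dpol by meson
  then obtain d where d: "N \<in> dpol K d" "D \<in> dpol K d"
    using dpol_mono[of _ K _ K "max d1 d2"] by (metis max.cobounded1 max.cobounded2 order_refl)
  from assms(1) obtain C where C: "\<And>s. \<exists>F B. (\<forall>p\<in>W. F p \<noteq> 0) \<and> finite B \<and> card B \<le> C * (s + 1) ^ n \<and>
     (\<forall>f\<in>dpol K s. (\<lambda>p. if p \<in> W then F p * f p else 0) \<in> fs.span B)" unfolding slow_growth_def by blast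
  show ?thesis unfolding slow_growth_def
  proof (intro exI[of _ "e * (C * (d + 1) ^ n)"] allI)
    fix s
    obtain F B where F: "\<forall>p\<in>W. F p \<noteq> 0" and B: "finite B" "card B \<le> C * (s + d * s + 1) ^ n"
      and sp: "\<And>f. f\<in>dpol K (s + d * s) \<Longrightarrow> (\<lambda>p. if p \<in> W then F p * f p else 0) \<in> fs.span B"
      using C[of "s + d * s"] by blast
    define B' where "B' = (\<Union>i<e. (\<lambda>b p. p v ^ i * b p) ` B)"
    have "card B' \<le> e * card B" unfolding B'_def using B(1) by (rule card_powers)
    also have "\<dots> \<le> e * (C * (s + d * s + 1) ^ n)" using B(2) by (rule mult_le_mono2)
    also have "\<dots> \<le> e * (C * ((d + 1) * (s + 1)) ^ n)"
      by (intro mult_le_mono2 power_mono) auto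
    also have "\<dots> = e * (C * (d + 1) ^ n) * (s + 1) ^ n" by (simp only: power_mult_distrib mult.assoc)
    finally have "card B' \<le> e * (C * (d + 1) ^ n) * (s + 1) ^ n" .
    moreover have "finite B'" unfolding B'_def using B(1) by simp
    moreover have "(\<lambda>p. if p \<in> W then (D p ^ s * F p) * f p else 0) \<in> fs.span B'" if "f \<in> dpol (insert v K) s" for f
    proof -
      from dpol_expand[OF that] obtain Q where Q: "\<And>p. f p = poly (Q p) (p v)" "\<And>p. degree (Q p) \<le> s"
        "\<And>i. (\<lambda>p. coeff (Q p) i) \<in> dpol K s" by blast
      have f: "f p = (\<Sum>k\<le>s. coeff (Q p) k * p v ^ k)" for p
      proof -
        have "f p = (\<Sum>i\<le>degree (Q p). coeff (Q p) i * p v ^ i)"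
          using Q(1) by (simp add: poly_altdef)
        also have "\<dots> = (\<Sum>i\<le>s. coeff (Q p) i * p v ^ i)"
          using Q(2)[of p] by (intro sum.mono_neutral_left) (auto simp: coeff_eq_0)
        finally show ?thesis .
      qed
      \<comment> \<open>Coefficient of \<open>v ^ (k mod e)\<close> after replacing
        \<open>(v ^ e) ^ (k div e) * D ^ s\<close>; the two exponents sum to \<open>s\<close>, so
        the degree bound does not depend on \<open>k\<close>.\<close>
      define c where "c k = (\<lambda>p. coeff (Q p) k) * (N ^ (k div e) * D ^ (s - k div e))" for k
      have pow: "(h ^ j) p = h p ^ j" for h :: "('a \<Rightarrow> complex) \<Rightarrow> complex" and j p by (induction j) auto
      have c: "c k \<in> dpol K (s + d * s)" if "k \<le> s" for k
      proof -
        have "k div e \<le> s" using that div_le_dividend le_trans by blast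
        then have "d * (k div e) + d * (s - k div e) = d * s" by (simp flip: add_mult_distrib2)
        then show ?thesis unfolding c_def
          using dpol_mult[OF Q(3)[of k] dpol_mult[OF dpol_power[OF d(1), of "k div e"] dpol_power[OF d(2), of "s - k div e"]]]
          by simp
      qed
      have key: "D p ^ s * p v ^ k = p v ^ (k mod e) * (N p ^ (k div e) * D p ^ (s - k div e))"
        if "p \<in> W" "k \<le> s" for p k
      proof -
        have "k div e \<le> s" using that div_le_dividend le_trans by blast
        then have "D p ^ s = D p ^ (k div e) * D p ^ (s - k div e)" by (simp flip: power_add)
        moreover have "p v ^ k = p v ^ (k mod e) * (p v ^ e) ^ (k div e)"
          by (simp flip: power_mult power_add)
        moreover have "(p v ^ e) ^ (k div e) * D p ^ (k div e) = N p ^ (k div e)"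
          using rel[OF that(1)] by (simp flip: power_mult_distrib)
        ultimately show ?thesis by (metis mult.assoc mult.commute)
      qed
      have "D p ^ s * F p * f p = (\<Sum>k\<le>s. p v ^ (k mod e) * (F p * c k p))" if "p \<in> W" for p
      proof -
        have "D p ^ s * F p * f p = (\<Sum>k\<le>s. F p * coeff (Q p) k * (D p ^ s * p v ^ k))"
          by (simp add: f sum_distrib_left algebra_simps)
        also have "\<dots> = (\<Sum>k\<le>s. p v ^ (k mod e) * (F p * c k p))"
          using that by (intro sum.cong) (auto simp: key c_def pow)
        finally show ?thesis .
      qed
      then have "(\<lambda>p. if p \<in> W then (D p ^ s * F p) * f p else 0) =
          (\<lambda>p. \<Sum>k\<in>{..s}. p v ^ (k mod e) * (if p \<in> W then F p * c k p else 0))"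
        by (auto simp: fun_eq_iff)
      also have "\<dots> \<in> fs.span B'" unfolding B'_def by (rule span_powers) (use e in \<open>auto intro: sp c\<close>)
      finally show ?thesis .
    qed
    moreover have "\<forall>p\<in>W. D p ^ s * F p \<noteq> 0" using F rel by auto
    ultimately show "\<exists>F B. (\<forall>p\<in>W. F p \<noteq> 0) \<and> finite B \<and> card B \<le> e * (C * (d + 1) ^ n) * (s + 1) ^ n \<and>
     (\<forall>f\<in>dpol (insert v K) s. (\<lambda>p. if p \<in> W then F p * f p else 0) \<in> fs.span B)"
      by (intro exI[of _ "\<lambda>p. D p ^ s * F p"] exI[of _ B']) blast
  qed
qed

text \<open>Multiplication by \<open>F\<close>, nonzero on \<open>W\<close>, and extension by zero
  preserve linear independence on \<open>W\<close>. Hence \<open>k\<close> independent functions of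
  degree at most \<open>s\<close> give \<open>k\<close> independent vectors in the span of
  \<open>B\<close>.\<close>

lemma slow_growth_bound:
  assumes "slow_growth W K n"
  shows "\<exists>C. \<forall>s k. rich K W s k \<longrightarrow> k \<le> C * (s + 1) ^ n"
proof -
  from assms obtain C where C: "\<And>s. \<exists>F B. (\<forall>p\<in>W. F p \<noteq> 0) \<and> finite B \<and> card B \<le> C * (s + 1) ^ n \<and>
     (\<forall>f\<in>dpol K s. (\<lambda>p. if p \<in> W then F p * f p else 0) \<in> fs.span B)" unfolding slow_growth_def by blast
  have "k \<le> C * (s + 1) ^ n" if "rich K W s k" for s k
  proof -
    obtain F B where F: "\<And>p. p \<in> W \<Longrightarrow> F p \<noteq> 0" and B: "finite B" "card B \<le> C * (s + 1) ^ n"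
      and sp: "\<And>f. f\<in>dpol K s \<Longrightarrow> (\<lambda>p. if p \<in> W then F p * f p else 0) \<in> fs.span B" using C[of s] by blast
    from that obtain g where g: "\<And>i. i < k \<Longrightarrow> g i \<in> dpol K s"
      and ind: "lin_indep_on W g k"
      by (rule richE) blast
    define G where "G i = (\<lambda>p. if p \<in> W then F p * g i p else 0)" for i
    have inj: "inj_on G {..<k}"
    proof (rule inj_onI, rule ccontr)
      fix i j assume ij: "i \<in> {..<k}" "j \<in> {..<k}" "G i = G j" "i \<noteq> j"
      have "g i p = g j p" if "p \<in> W" for p
        using fun_cong[OF ij(3), of p] that F[OF that] unfolding G_def by simp
      \<comment> \<open>Independence of a set of vectors says nothing about repetitions, so
        injectivity of \<open>G\<close> is checked first: two equal members would give a relation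
        with coefficients 1 and -1.\<close>
      then have "vanishes (\<lambda>p. \<Sum>l<k. ((if l = i then 1 else 0) - (if l = j then 1 else 0)) * g l p) W"
        using ij by (auto simp: left_diff_distrib sum_subtractf if_distrib[of "\<lambda>x. x * _"] cong: if_cong)
      from lin_indep_onD[OF ind this, of i] ij show False by auto
    qed
    have scalars: "u x = 0" if u: "(\<Sum>x\<in>G ` {..<k}. (\<lambda>p. u x * x p)) = 0" "x \<in> G ` {..<k}" for u x
    proof -
      have "(\<Sum>i<k. u (G i) * g i p) = 0" if "p \<in> W" for p
      proof -
        have "0 = (\<Sum>x\<in>G ` {..<k}. (\<lambda>p. u x * x p)) p" using u(1) by simp
        also have "\<dots> = (\<Sum>i<k. u (G i) * G i p)" using inj by (simp add: sum_fun_apply sum.reindex)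
        also have "\<dots> = F p * (\<Sum>i<k. u (G i) * g i p)"
          using that by (simp add: G_def sum_distrib_left mult.left_commute)
        finally show ?thesis using F[OF that] by simp
      qed
      then have "vanishes (\<lambda>p. \<Sum>i<k. u (G i) * g i p) W" by blast
      then have "\<forall>i<k. u (G i) = 0" using ind lin_indep_onD[where a = "\<lambda>i. u (G i)"] by blast
      then show ?thesis using u(2) by blast
    qed
    have "fs.independent (G ` {..<k})"
      by (rule fs.independent_if_scalars_zero, simp) (erule scalars)
    moreover have "G ` {..<k} \<subseteq> fs.span B" unfolding G_def using g sp by blast
    ultimately have "card (G ` {..<k}) \<le> card B" using fs.independent_span_bound[OF B(1)] by blast
    then show ?thesis using B(2) inj by (simp add: card_image)
  qed
  then show ?thesis by blast
qed

subsection \<open>Holomorphic functions of several variables\<close>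

lemma holo_onE:
  assumes "holo_on f U" "t \<in> U"
  obtains L where "(f has_derivative L) (at t)" "\<And>c z. L (c *s z) = c * L z"
  using assms unfolding holo_on_def by blast

lemma holo_on_const: "holo_on (\<lambda>t. c) U"
  unfolding holo_on_def by (intro ballI exI[of _ "\<lambda>_. 0"]) auto

lemma holo_on_nth: "holo_on (\<lambda>t. t $ k) U"
  unfolding holo_on_def
  by (intro ballI exI[of _ "\<lambda>t. t $ k"]) (auto intro: bounded_linear.has_derivative bounded_linear_vec_nth)

lemma holo_on_add:
  assumes "holo_on f U" "holo_on g U"
  shows "holo_on (\<lambda>t. f t + g t) U"
  unfolding holo_on_def
proof
  fix t assume t: "t \<in> U"
  obtain L where L: "(f has_derivative L) (at t)" "\<And>c z. L (c *s z) = c * L z" using holo_onE[OF assms(1) t] by blast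
  obtain M where M: "(g has_derivative M) (at t)" "\<And>c z. M (c *s z) = c * M z" using holo_onE[OF assms(2) t] by blast
  show "\<exists>L. ((\<lambda>t. f t + g t) has_derivative L) (at t) \<and> (\<forall>c z. L (c *s z) = c * L z)"
    using L M by (intro exI[of _ "\<lambda>z. L z + M z"]) (auto intro: has_derivative_add simp: algebra_simps)
qed

lemma holo_on_mult:
  assumes "holo_on f U" "holo_on g U"
  shows "holo_on (\<lambda>t. f t * g t) U"
  unfolding holo_on_def
proof
  fix t assume t: "t \<in> U"
  obtain L where L: "(f has_derivative L) (at t)" "\<And>c z. L (c *s z) = c * L z" using holo_onE[OF assms(1) t] by blast
  obtain M where M: "(g has_derivative M) (at t)" "\<And>c z. M (c *s z) = c * M z" using holo_onE[OF assms(2) t] by blast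
  show "\<exists>L. ((\<lambda>t. f t * g t) has_derivative L) (at t) \<and> (\<forall>c z. L (c *s z) = c * L z)"
    using has_derivative_mult[OF L(1) M(1)] L(2) M(2)
    by (intro exI[of _ "\<lambda>z. f t * M z + L z * g t"]) (simp add: algebra_simps)
qed

lemma holo_on_divide:
  assumes "holo_on f U" "holo_on g U" "\<And>t. t \<in> U \<Longrightarrow> g t \<noteq> 0"
  shows "holo_on (\<lambda>t. f t / g t) U"
  unfolding holo_on_def
proof
  fix t assume t: "t \<in> U"
  obtain L where L: "(f has_derivative L) (at t)" "\<And>c z. L (c *s z) = c * L z" using holo_onE[OF assms(1) t] by blast
  obtain M where M: "(g has_derivative M) (at t)" "\<And>c z. M (c *s z) = c * M z" using holo_onE[OF assms(2) t] by blast
  have "((\<lambda>t. f t / g t) has_derivative (\<lambda>z. (L z * g t - f t * M z) / (g t * g t))) (at t)"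
    using L(1) M(1) assms(3)[OF t] by (rule has_derivative_divide')
  moreover have "(L (c *s z) * g t - f t * M (c *s z)) / (g t * g t) = c * ((L z * g t - f t * M z) / (g t * g t))" for c z
    by (simp add: L(2) M(2) algebra_simps)
  ultimately show "\<exists>L. ((\<lambda>t. f t / g t) has_derivative L) (at t) \<and> (\<forall>c z. L (c *s z) = c * L z)" by blast
qed

lemma holo_on_prod: "(\<And>i. i \<in> A \<Longrightarrow> holo_on (f i) U) \<Longrightarrow> holo_on (\<lambda>t. \<Prod>i\<in>A. f i t) U"
  by (induction A rule: infinite_finite_induct) (auto intro: holo_on_const holo_on_mult)

lemma holo_on_power: "holo_on f U \<Longrightarrow> holo_on (\<lambda>t. f t ^ k) U"
  by (induction k) (auto intro: holo_on_const holo_on_mult)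

lemma holo_on_pfun:
  assumes "f \<in> pfun K" "\<And>v. v \<in> K \<Longrightarrow> holo_on (\<lambda>t. h t v) U"
  shows "holo_on (\<lambda>t. f (h t)) U"
  using assms by (induction rule: pfun_induct) (auto intro: holo_on_const holo_on_add holo_on_mult)

lemma holo_on_subset: "holo_on f U \<Longrightarrow> V \<subseteq> U \<Longrightarrow> holo_on f V"
  unfolding holo_on_def by blast

lemma holo_on_continuous: "holo_on f U \<Longrightarrow> continuous_on U f"
  unfolding holo_on_def
  by (intro continuous_at_imp_continuous_on) (meson has_derivative_continuous)

lemma open_nonzero:
  assumes "holo_on f U" "open U"
  shows "open {t \<in> U. f t \<noteq> 0}"
proof -
  have "open (U \<inter> f -` (- {0}))"
    using holo_on_continuous[OF assms(1)] assms(2) by (intro continuous_open_preimage) auto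
  moreover have "U \<inter> f -` (- {0}) = {t \<in> U. f t \<noteq> 0}" by auto
  ultimately show ?thesis by simp
qed

lemma has_derivative_complex_line:
  fixes a v :: "complex^'n"
  shows "((\<lambda>z. a + z *s v) has_derivative (\<lambda>z. z *s v)) (at z)"
proof -
  have "linear (\<lambda>z. z *s v)"
    by (intro linearI) (auto simp: vec_eq_iff algebra_simps)
  then have "((\<lambda>z. z *s v) has_derivative (\<lambda>z. z *s v)) (at z)"
    by (intro bounded_linear_imp_has_derivative) (simp add: linear_conv_bounded_linear)
  then show ?thesis by (intro derivative_eq_intros) auto
qed

text \<open>Complex homogeneity of the derivative \<open>L\<close> makes its restriction to a
  complex line multiplication by the number \<open>L v\<close>.\<close>

lemma holo_on_line:
  fixes a v :: "complex^'n"
  assumes "holo_on f U" "open S" "\<And>z. z \<in> S \<Longrightarrow> a + z *s v \<in> U"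
  shows "(\<lambda>z. f (a + z *s v)) holomorphic_on S"
  unfolding holomorphic_on_open[OF assms(2)]
proof
  fix z assume "z \<in> S"
  from holo_onE[OF assms(1) assms(3)[OF this]] obtain L where
    L: "(f has_derivative L) (at (a + z *s v))" "\<And>c z. L (c *s z) = c * L z" by blast
  have "((\<lambda>z. f (a + z *s v)) has_derivative (\<lambda>w. L (w *s v))) (at z)"
    by (rule has_derivative_compose[OF has_derivative_complex_line L(1)])
  then have "((\<lambda>z. f (a + z *s v)) has_field_derivative L v) (at z)"
    unfolding has_field_derivative_def by (simp add: L(2) mult_commute_abs)
  then show "\<exists>f'. ((\<lambda>z. f (a + z *s v)) has_field_derivative f') (at z)" ..
qed

text \<open>Restriction to the complex line from \<open>x\<close> to \<open>z\<close> reduces the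
  claim to one variable. The part of the line inside the ball is convex, hence connected, and
  \<open>f\<close> vanishes on it near \<open>x\<close>.\<close>

lemma holo_zero_ball:
  fixes a :: "complex^'n"
  assumes f: "holo_on f (ball a r)" and x: "x \<in> ball a r" and e: "e > 0" "\<And>s. s \<in> ball x e \<Longrightarrow> f s = 0"
    and z: "z \<in> ball a r"
  shows "f z = 0"
proof -
  define l where "l w = x + w *s (z - x)" for w
  have cont: "continuous_on UNIV l"
    unfolding l_def by (intro continuous_at_imp_continuous_on ballI has_derivative_continuous[OF has_derivative_complex_line])
  define S where "S = l -` ball a r"
  define S0 where "S0 = l -` (ball x e \<inter> ball a r)"
  have S: "open S" "open S0" unfolding S_def S0_def using cont by (auto intro!: open_vimage)
  have "convex S" unfolding convex_def
  proof (intro ballI allI impI)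
    fix p q u v assume pq: "p \<in> S" "q \<in> S" and uv: "0 \<le> (u::real)" "0 \<le> v" "u + v = 1"
    have "l (u *\<^sub>R p + v *\<^sub>R q) = u *\<^sub>R l p + v *\<^sub>R l q"
    proof -
      have "x = (u + v) *\<^sub>R x" using uv by simp
      then have "x = u *\<^sub>R x + v *\<^sub>R x" by (simp only: scaleR_add_left)
      moreover have "(u *\<^sub>R p + v *\<^sub>R q) *s (z - x) = u *\<^sub>R (p *s (z - x)) + v *\<^sub>R (q *s (z - x))"
        by (simp add: vec_eq_iff algebra_simps)
      ultimately show ?thesis unfolding l_def by (simp add: scaleR_add_right)
    qed
    then show "u *\<^sub>R p + v *\<^sub>R q \<in> S" using pq uv convexD[OF convex_ball, of "l p" a r "l q" u v]
      unfolding S_def by simp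
  qed
  then have "connected S" by (rule convex_connected)
  have "0 \<in> S0" "S0 \<subseteq> S" "1 \<in> S" unfolding S_def S0_def l_def using x z e(1) by auto
  have "(\<lambda>w. f (l w)) holomorphic_on S"
    unfolding l_def by (rule holo_on_line[OF f S(1)]) (simp add: S_def l_def)
  moreover have "S0 \<noteq> {}" using \<open>0 \<in> S0\<close> by blast
  moreover have "f (l w) = 0" if "w \<in> S0" for w using that e(2) unfolding S0_def by blast
  ultimately have "f (l 1) = 0"
    using analytic_continuation_open[of S0 S "\<lambda>w. f (l w)" "\<lambda>_. 0" 1] S \<open>connected S\<close> \<open>S0 \<subseteq> S\<close> \<open>1 \<in> S\<close>
    by simp
  then show ?thesis unfolding l_def by simp
qed

text \<open>Vanishing in a neighbourhood of a point spreads through every ball contained in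
  \<open>U\<close>; connectedness of \<open>U\<close> then carries it everywhere.\<close>

lemma holo_identity:
  fixes f :: "complex^'n \<Rightarrow> complex"
  assumes f: "holo_on f U" and U: "open U" "connected U" and V: "open V" "V \<subseteq> U" "V \<noteq> {}"
    and zero: "\<And>t. t \<in> V \<Longrightarrow> f t = 0" and t: "t \<in> U"
  shows "f t = 0"
proof -
  define P where "P t \<longleftrightarrow> (\<exists>e>0. \<forall>s\<in>ball t e. f s = 0)" for t
  obtain a where a: "a \<in> V" using V(3) by blast
  have "P t"
  proof (rule connected_induction_simple[OF U(2), of a t P])
    show "a \<in> U" "t \<in> U" using a V(2) t by auto
    obtain e where e: "e > 0" "ball a e \<subseteq> V" using openE[OF V(1) a] .
    then have "\<forall>s\<in>ball a e. f s = 0" using zero by blast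
    then show "P a" unfolding P_def using e(1) by (intro exI[of _ e] conjI)
    fix b assume "b \<in> U"
    then obtain r where r: "r > 0" "ball b r \<subseteq> U" using openE[OF U(1)] by metis
    have "P y" if "x \<in> ball b r" "y \<in> ball b r" "P x" for x y
    proof -
      obtain e where e: "e > 0" "\<And>s. s \<in> ball x e \<Longrightarrow> f s = 0" using \<open>P x\<close> unfolding P_def by blast
      have z: "f z = 0" if "z \<in> ball b r" for z
        using holo_zero_ball[OF holo_on_subset[OF f r(2)] \<open>x \<in> ball b r\<close> e that] .
      obtain d where "d > 0" "ball y d \<subseteq> ball b r" using openE[OF open_ball \<open>y \<in> ball b r\<close>] by blast
      then have "\<forall>s\<in>ball y d. f s = 0" using z by blast
      then show ?thesis unfolding P_def using \<open>d > 0\<close> by (intro exI[of _ d] conjI)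
    qed
    then have "\<forall>x\<in>ball b r. \<forall>y\<in>ball b r. P x \<longrightarrow> P y" by blast
    moreover have "openin (top_of_set U) (ball b r)" using r(2) U(1) by (simp add: openin_open_eq)
    moreover have "b \<in> ball b r" using r(1) by simp
    ultimately show "\<exists>T. openin (top_of_set U) T \<and> b \<in> T \<and> (\<forall>x\<in>T. \<forall>y\<in>T. P x \<longrightarrow> P y)"
      by blast
  qed
  then show ?thesis unfolding P_def by (metis centre_in_ball)
qed

text \<open>Where \<open>f\<close> is nonzero, on an open set, \<open>g\<close> must vanish; the
  identity theorem extends this to \<open>U\<close>.\<close>

lemma holo_mult_zero:
  fixes f g :: "complex^'n \<Rightarrow> complex"
  assumes "holo_on f U" "holo_on g U" "open U" "connected U" "vanishes (\<lambda>t. f t * g t) U"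
  shows "vanishes f U \<or> vanishes g U"
proof (rule ccontr)
  assume "\<not> ?thesis"
  then obtain t where t: "t \<in> U" "f t \<noteq> 0" and g: "\<not> vanishes g U" by blast
  have "vanishes g U"
  proof
    fix s assume "s \<in> U"
    then show "g s = 0"
      using holo_identity[OF assms(2-4) open_nonzero[OF assms(1,3)]] t assms(5) by fastforce
  qed
  with g show False by blast
qed

lemma holo_prod_nonzero:
  fixes f :: "'i \<Rightarrow> complex^'n \<Rightarrow> complex"
  assumes "open U" "connected U" "U \<noteq> {}" "finite A" "\<And>i. i \<in> A \<Longrightarrow> holo_on (f i) U \<and> (\<exists>t\<in>U. f i t \<noteq> 0)"
  shows "\<exists>t\<in>U. (\<Prod>i\<in>A. f i t) \<noteq> 0"
  using assms(4,5)
proof (induction A rule: finite_induct)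
  case empty
  then show ?case using assms(3) by auto
next
  case (insert x F)
  then have "\<not> vanishes (f x) U" "\<not> vanishes (\<lambda>t. \<Prod>i\<in>F. f i t) U" "holo_on (f x) U" "holo_on (\<lambda>t. \<Prod>i\<in>F. f i t) U"
    by (auto intro: holo_on_prod)
  then have "\<not> vanishes (\<lambda>t. f x t * (\<Prod>i\<in>F. f i t)) U"
    using holo_mult_zero[of "f x" U "\<lambda>t. \<Prod>i\<in>F. f i t"] assms(1,2) by blast
  then show ?case unfolding prod.insert[OF insert.hyps] by blast
qed

text \<open>The polynomial is read as an entire function on \<open>complex^'n\<close> through the
  naming \<open>\<sigma>\<close> of its variables. The naming is left free because both the
  parameters and a selection of the \<open>x_j\<close> play this role.\<close>

lemma pfun_zero_on_open:
  fixes \<sigma> :: "'n::finite \<Rightarrow> 'v"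
  assumes f: "f \<in> pfun (range \<sigma>)" and \<sigma>: "inj \<sigma>" and V: "open V" "V \<noteq> {}"
    and zero: "\<And>y :: complex^'n. y \<in> V \<Longrightarrow> \<exists>p. (\<forall>k. p (\<sigma> k) = y $ k) \<and> f p = 0"
  shows "f p = 0"
proof -
  define h where "h y v = y $ (inv \<sigma> v)" for y :: "complex^'n" and v
  have eq: "f q = f (h y)" if "\<And>k. q (\<sigma> k) = y $ k" for q y
    using f by (rule pfun_cong) (use that \<sigma> in \<open>auto simp: h_def\<close>)
  have "holo_on (\<lambda>y. f (h y)) UNIV"
    using f by (rule holo_on_pfun) (simp add: h_def holo_on_nth)
  moreover have "f (h y) = 0" if "y \<in> V" for y using zero[OF that] eq by metis
  ultimately have "f (h y) = 0" for y
    using V by (intro holo_identity[of "\<lambda>y. f (h y)" UNIV V y]) auto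
  then show ?thesis using eq[of p "\<chi> k. p (\<sigma> k)"] by simp
qed

lemma pfun_tendsto:
  assumes "f \<in> pfun K" "\<And>v. v \<in> K \<Longrightarrow> ((\<lambda>k. u k v) \<longlongrightarrow> w v) F"
  shows "((\<lambda>k. f (u k)) \<longlongrightarrow> f w) F"
  using assms by (induction rule: pfun_induct) (auto intro: tendsto_intros)

text \<open>A quantitative continuity of roots: \<open>b ^ e - a\<close> is the product of the
  differences \<open>b - x\<close> over the roots \<open>x\<close> of \<open>z ^ e = a\<close>, so
  its modulus is at least the \<open>e\<close>-th power of the distance from \<open>b\<close> to the
  nearest root.\<close>

lemma exists_close_root:
  fixes a b :: complex
  assumes "e > 0"
  shows "\<exists>z. z ^ e = a \<and> cmod (b - z) ^ e \<le> cmod (b ^ e - a)"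
proof -
  define p where "p = monom 1 e - [:a:]"
  have deg: "degree p = e" unfolding p_def using assms
    by (subst diff_conv_add_uminus, subst degree_add_eq_left) (auto simp: degree_monom_eq)
  have "p \<noteq> 0" using deg assms by auto
  have lead: "lead_coeff p = 1" unfolding deg using assms by (simp add: p_def coeff_pCons split: nat.split)
  obtain A where A: "size A = e" "p = (\<Prod>x\<in>#A. [:-x, 1:])"
    using alg_closed_imp_factorization[OF \<open>p \<noteq> 0\<close>] lead deg by auto
  have poly_p: "poly p z = z ^ e - a" for z unfolding p_def by (simp add: poly_monom)
  have "A \<noteq> {#}" using A(1) assms by auto
  define d where "d = Min ((\<lambda>x. cmod (b - x)) ` set_mset A)"
  have "d \<in> (\<lambda>x. cmod (b - x)) ` set_mset A" unfolding d_def using \<open>A \<noteq> {#}\<close> by (intro Min_in) auto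
  then obtain z where z: "z \<in># A" "d = cmod (b - z)" by auto
  have le: "d \<le> cmod (b - x)" if "x \<in># A" for x unfolding d_def using that by (intro Min_le) auto
  have "d \<ge> 0" using z by simp
  have "poly p z = 0" unfolding A(2) poly_prod_mset using z(1) by auto
  moreover have "d ^ size B \<le> cmod (\<Prod>x\<in>#B. b - x)" if "B \<subseteq># A" for B
    using that
  proof (induction B)
    case (add x B)
    have "B \<subseteq># add_mset x B" by simp
    then have "B \<subseteq># A" using add.prems by (rule subset_mset.order_trans)
    then have "d ^ size B \<le> cmod (\<Prod>x\<in>#B. b - x)" by (rule add.IH)
    moreover have "d \<le> cmod (b - x)" using mset_subset_eqD[OF add.prems, of x] by (intro le) simp
    ultimately have "d ^ size B \<le> cmod (\<Prod>x\<in>#B. b - x)" "d \<le> cmod (b - x)" .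
    then have "d * d ^ size B \<le> cmod (b - x) * cmod (\<Prod>x\<in>#B. b - x)"
      using \<open>d \<ge> 0\<close> by (intro mult_mono) auto
    then show ?case by (simp add: norm_mult)
  qed simp
  from this[of A] have "d ^ e \<le> cmod (b ^ e - a)"
    using poly_p[of b] A by (simp add: poly_prod_mset)
  ultimately show ?thesis using z poly_p by auto
qed

subsection \<open>The auxiliary variety\<close>

lemma meval_msub [simp]: "meval (msub f g) p = meval f p - meval g p"
  by (simp add: msub_def)

lemma meval_mpow [simp]: "meval (mpow f k) p = meval f p ^ k"
  by (induction k) auto

lemma meval_mprod [simp]: "meval (mprod fs) p = (\<Prod>f\<leftarrow>fs. meval f p)"
  by (induction fs) (auto simp: mprod_def)

lemma meval_cong: "mvars f \<subseteq> K \<Longrightarrow> (\<And>v. v \<in> K \<Longrightarrow> p v = q v) \<Longrightarrow> meval f p = meval f q"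
  by (rule pfun_cong[OF pfun_meval])

lemma finite_coordsA: "finite (coordsA m r :: 'n::finite coord set)"
  unfolding coordsA_def by simp

lemma coordsX_subset: "coordsX r \<subseteq> coordsA m r"
  unfolding coordsX_def coordsA_def by auto

lemma inj_Tc: "inj Tc"
  by (auto intro: injI)

locale radical_equations =
  fixes m r :: nat
    and e :: "nat \<Rightarrow> nat"
    and aN aD xN xD :: "nat \<Rightarrow> ('n::finite) coord mpx"
  assumes e_pos: "i < m \<Longrightarrow> e i > 0"
    and vars_a: "i < m \<Longrightarrow> mvars (aN i) \<union> mvars (aD i) \<subseteq> range Tc \<union> Dc ` {..<i}"
    and vars_x: "j < r \<Longrightarrow> mvars (xN j) \<union> mvars (xD j) \<subseteq> range Tc \<union> Dc ` {..<m}"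
begin

definition W :: "('n coord \<Rightarrow> complex) set" where
  "W = {p \<in> aspace (coordsA m r).
     (\<forall>i<m. meval (aD i) p \<noteq> 0 \<and> p (Dc i) ^ e i * meval (aD i) p = meval (aN i) p) \<and>
     (\<forall>j<r. meval (xD j) p \<noteq> 0 \<and> p (Xc j) * meval (xD j) p = meval (xN j) p)}"

lemma vars_a_TD:
  assumes "i < m"
  shows "mvars (aN i) \<subseteq> range Tc \<union> Dc ` {..<m}" "mvars (aD i) \<subseteq> range Tc \<union> Dc ` {..<m}"
proof -
  have "Dc ` {..<i} \<subseteq> Dc ` {..<m}" using assms by (intro image_mono) auto
  then show "mvars (aN i) \<subseteq> range Tc \<union> Dc ` {..<m}" "mvars (aD i) \<subseteq> range Tc \<union> Dc ` {..<m}"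
    using vars_a[OF assms] by blast+
qed

lemma vars_x_TD:
  assumes "j < r"
  shows "mvars (xN j) \<subseteq> range Tc \<union> Dc ` {..<m}" "mvars (xD j) \<subseteq> range Tc \<union> Dc ` {..<m}"
  using vars_x[OF assms] by blast+

lemma vars_coordsA:
  "i < m \<Longrightarrow> mvars (aN i) \<subseteq> coordsA m r" "i < m \<Longrightarrow> mvars (aD i) \<subseteq> coordsA m r"
  "j < r \<Longrightarrow> mvars (xN j) \<subseteq> coordsA m r" "j < r \<Longrightarrow> mvars (xD j) \<subseteq> coordsA m r"
  using vars_a_TD[of i] vars_x_TD[of j] unfolding coordsA_def by blast+

text \<open>\<open>Z * P = 1\<close> is solvable for \<open>Z\<close> exactly when the product
  \<open>P\<close> of all denominators is nonzero, and then by \<open>1 / P\<close>. The coordinate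
  \<open>Z\<close> therefore only encodes that no denominator vanishes.\<close>

lemma W_eq: "W = proj (coordsA m r) ` zset (insert Zc (coordsA m r))
   (rp_E e aN aD ` {..<m} \<union> rp_G xN xD ` {..<r} \<union> {rp_GZ m r aD xD})" (is "_ = proj ?A ` ?Z")
proof (intro equalityI subsetI)
  fix p assume p: "p \<in> W"
  define P where "P q = (\<Prod>f\<leftarrow>map xD [0..<r] @ map aD [0..<m]. meval f q)" for q
  have "P p \<noteq> 0" using p unfolding P_def W_def by (auto simp: prod_list_zero_iff)
  define q where "q = p(Zc := 1 / P p)"
  have A: "meval f q = meval f p" if "mvars f \<subseteq> ?A" for f
    using that by (rule meval_cong) (auto simp: q_def coordsA_def)
  have "mvars f \<subseteq> ?A" if "f \<in> set (map xD [0..<r] @ map aD [0..<m])" for f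
  proof -
    from that consider j where "j < r" "f = xD j" | i where "i < m" "f = aD i" by auto
    then show ?thesis by cases (simp_all add: vars_coordsA)
  qed
  then have "P q = P p"
    unfolding P_def by (intro arg_cong[where f = prod_list] map_cong refl A)
  then have "meval (rp_GZ m r aD xD) q = 0"
    using \<open>P p \<noteq> 0\<close> unfolding rp_GZ_def meval_msub by (simp add: q_def P_def)
  then have "q \<in> ?Z"
    using p unfolding zset_def W_def aspace_def rp_E_def rp_G_def
    by (auto simp: A vars_coordsA) (auto simp: q_def)
  moreover have "proj ?A q = p"
    using p unfolding proj_def q_def W_def aspace_def by (auto simp: fun_eq_iff coordsA_def)
  ultimately show "p \<in> proj ?A ` ?Z" by blast
next
  fix p assume "p \<in> proj ?A ` ?Z"
  then obtain q where q: "q \<in> ?Z" "p = proj ?A q" by blast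
  have A: "meval f p = meval f q" if "mvars f \<subseteq> ?A" for f
    using that by (rule meval_cong) (auto simp: q(2) proj_def)
  have D: "p (Dc i) = q (Dc i)" if "i < m" for i using that by (auto simp: q(2) proj_def coordsA_def)
  have X: "p (Xc j) = q (Xc j)" if "j < r" for j using that by (auto simp: q(2) proj_def coordsA_def)
  have "q Zc * (\<Prod>f\<leftarrow>map xD [0..<r] @ map aD [0..<m]. meval f q) = 1"
    using q(1) unfolding zset_def rp_GZ_def by simp
  then have "(\<Prod>f\<leftarrow>map xD [0..<r] @ map aD [0..<m]. meval f q) \<noteq> 0" by auto
  then have "meval f q \<noteq> 0" if "f \<in> set (map xD [0..<r] @ map aD [0..<m])" for f
    using that by (auto simp: prod_list_zero_iff image_iff)
  then have nz: "\<forall>i<m. meval (aD i) q \<noteq> 0" "\<forall>j<r. meval (xD j) q \<noteq> 0" by auto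
  moreover have "q (Dc i) ^ e i * meval (aD i) q = meval (aN i) q" if "i < m" for i
  proof -
    have "meval (rp_E e aN aD i) q = 0" using q(1) that unfolding zset_def by blast
    then show ?thesis by (simp add: rp_E_def)
  qed
  moreover have "q (Xc j) * meval (xD j) q = meval (xN j) q" if "j < r" for j
  proof -
    have "meval (rp_G xN xD j) q = 0" using q(1) that unfolding zset_def by blast
    then show ?thesis by (simp add: rp_G_def)
  qed
  moreover have "p \<in> aspace ?A" unfolding q(2) proj_def aspace_def by simp
  ultimately show "p \<in> W"
    unfolding W_def by (simp add: A D X vars_coordsA)
qed

lemma W_subset: "W \<subseteq> aspace (coordsA m r)"
  unfolding W_def by blast

lemma auxiliary_eq: "auxiliary_variety m r e aN aD xN xD = zclosure (coordsA m r) W"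
  unfolding auxiliary_variety_def W_eq ..

section \<open>Growth of the Hilbert function on \<open>W\<close>\<close>

lemma slow_growth_T: "finite S \<Longrightarrow> slow_growth X (Tc ` S) (card S)" for S :: "'n set"
proof (induction S rule: finite_induct)
  case empty
  then show ?case by (simp add: slow_growth_empty)
next
  case (insert k S)
  then show ?case using slow_growth_free[of X "Tc ` S" "card S" "Tc k"] by simp
qed

text \<open>The tower is followed upwards: \<open>E_i\<close> expresses a power of
  \<open>Dc i\<close> through the parameters and the earlier radicals only, so each radical leaves
  the exponent unchanged.\<close>

lemma slow_growth_TD: "i \<le> m \<Longrightarrow> slow_growth W (range Tc \<union> Dc ` {..<i}) CARD('n)"
proof (induction i)
  case 0
  then show ?case using slow_growth_T[of UNIV W] by simp
next
  case (Suc i)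
  have "slow_growth W (insert (Dc i) (range Tc \<union> Dc ` {..<i})) CARD('n)"
  proof (rule slow_growth_algebraic[where e = "e i" and N = "meval (aN i)" and D = "meval (aD i)"])
    show "meval (aN i) \<in> pfun (range Tc \<union> Dc ` {..<i})" "meval (aD i) \<in> pfun (range Tc \<union> Dc ` {..<i})"
      using vars_a[of i] Suc.prems by (auto intro!: pfun_meval)
  qed (use Suc e_pos in \<open>auto simp: W_def\<close>)
  then show ?case by (simp add: lessThan_Suc)
qed

lemma slow_growth_TDX:
  "j \<le> r \<Longrightarrow> slow_growth W (range Tc \<union> Dc ` {..<m} \<union> Xc ` {..<j}) CARD('n)"
proof (induction j)
  case 0
  then show ?case using slow_growth_TD[of m] by simp
next
  case (Suc j)
  have "slow_growth W (insert (Xc j) (range Tc \<union> Dc ` {..<m} \<union> Xc ` {..<j})) CARD('n)"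
  proof (rule slow_growth_algebraic[where e = 1 and N = "meval (xN j)" and D = "meval (xD j)"])
    show "meval (xN j) \<in> pfun (range Tc \<union> Dc ` {..<m} \<union> Xc ` {..<j})"
      "meval (xD j) \<in> pfun (range Tc \<union> Dc ` {..<m} \<union> Xc ` {..<j})"
      using vars_x[of j] Suc.prems by (auto intro!: pfun_meval)
  qed (use Suc in \<open>auto simp: W_def\<close>)
  then show ?case by (simp add: lessThan_Suc)
qed

text \<open>The set \<open>X\<close> may live in other coordinates \<open>I\<close>; domination of
  its Hilbert function by that of \<open>W\<close> is all that matters. This covers the components,
  the incidence variety and its projection.\<close>

lemma dimension_bound:
  assumes "\<And>s k. rich I X s k \<Longrightarrow> rich (coordsA m r) W s k"
  shows "\<not> (\<exists>Z. zchain I X (Suc CARD('n)) Z)"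
proof -
  have "slow_growth W (coordsA m r) CARD('n)"
    using slow_growth_TDX[of r] unfolding coordsA_def by simp
  from slow_growth_bound[OF this] obtain C where
    "\<And>s k. rich (coordsA m r) W s k \<Longrightarrow> k \<le> C * (s + 1) ^ CARD('n)" by blast
  then show ?thesis using assms by (intro no_long_chain[of I X C]) blast
qed

text \<open>The branches of the radicals over a nearby parameter value can be chosen close to the given
  ones, so a parameter condition \<open>q \<noteq> 0\<close> cuts out a Euclidean-dense part of \<open>W\<close>.\<close>
lemma W_approx:
  assumes w: "w \<in> W" and q: "q \<in> pfun (range Tc)" "q p1 \<noteq> 0"
  shows "\<exists>u. (\<forall>v. (\<lambda>k. u k v) \<longlonglongrightarrow> w v) \<and> (\<forall>\<^sub>F k in sequentially. u k \<in> W \<and> q (u k) \<noteq> 0)"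
proof -
  \<comment> \<open>Distinct numbers tending to 0: a nonzero univariate polynomial vanishes at only
    finitely many of them.\<close>
  define z where "z k = complex_of_real (1 / real (Suc k))" for k
  have z0: "z \<longlonglongrightarrow> 0"
    unfolding z_def using tendsto_of_real[OF LIMSEQ_inverse_real_of_nat, where ?'a = complex]
    by (simp add: inverse_eq_divide)
  have inj_z: "inj z" unfolding z_def by (rule injI) (simp add: field_simps flip: of_nat_Suc)
  have wz: "w v = 0" if "v \<notin> coordsA m r" for v using w that unfolding W_def aspace_def by blast
  \<comment> \<open>The radicals are corrected one by one. Nonvanishing of the denominators need not
    be part of the invariant, since it eventually follows from convergence to
    \<open>w\<close>.\<close>
  have "\<exists>u. (\<forall>v. (\<lambda>k. u k v) \<longlonglongrightarrow> w v) \<and> (\<forall>k v. v \<notin> coordsA m r \<longrightarrow> u k v = 0) \<and>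
      (\<forall>\<^sub>F k in sequentially. q (u k) \<noteq> 0 \<and>
        (\<forall>l<i. u k (Dc l) ^ e l * meval (aD l) (u k) = meval (aN l) (u k)))" if "i \<le> m" for i
    using that
  proof (induction i)
    case 0
    obtain Q where Q: "\<And>x. q (\<lambda>v. w v + x * (p1 v - w v)) = poly Q x" using pfun_line[OF q(1)] by blast
    have "Q \<noteq> 0" using Q[of 1] q(2) by auto
    then have "finite {x. poly Q x = 0}" by (rule poly_roots_finite)
    then have "finite (z -` {x. poly Q x = 0})" using inj_z by (rule finite_vimageI)
    then have ev: "\<forall>\<^sub>F k in sequentially. poly Q (z k) \<noteq> 0"
      unfolding cofinite_eq_sequentially[symmetric] eventually_cofinite by (simp add: vimage_def)
    define u where "u k v = (if v \<in> range Tc then w v + z k * (p1 v - w v) else w v)" for k v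
    have "q (u k) = poly Q (z k)" for k
      unfolding Q[symmetric] using q(1) by (rule pfun_cong) (simp add: u_def)
    with ev have "\<forall>\<^sub>F k in sequentially. q (u k) \<noteq> 0" by simp
    moreover have "(\<lambda>k. u k v) \<longlonglongrightarrow> w v" for v
    proof (cases "v \<in> range Tc")
      case True
      have "(\<lambda>k. w v + z k * (p1 v - w v)) \<longlonglongrightarrow> w v + 0 * (p1 v - w v)"
        by (intro tendsto_intros z0)
      then show ?thesis using True by (simp add: u_def)
    qed (simp add: u_def)
    moreover have "u k v = 0" if "v \<notin> coordsA m r" for k v
      using that wz[of v] by (auto simp: u_def coordsA_def)
    ultimately show ?case by (intro exI[of _ u]) simp
  next
    case (Suc i)
    then obtain u where u: "\<And>v. (\<lambda>k. u k v) \<longlonglongrightarrow> w v" "\<And>k v. v \<notin> coordsA m r \<Longrightarrow> u k v = 0"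
      and ev: "\<forall>\<^sub>F k in sequentially. q (u k) \<noteq> 0 \<and>
        (\<forall>l<i. u k (Dc l) ^ e l * meval (aD l) (u k) = meval (aN l) (u k))" by auto
    have i: "i < m" using Suc.prems by simp
    have tend: "(\<lambda>k. meval f (u k)) \<longlonglongrightarrow> meval f w" for f
      using pfun_meval[OF order_refl] by (rule pfun_tendsto) (rule u(1))
    define a where "a k = meval (aN i) (u k) / meval (aD i) (u k)" for k
    have wi: "meval (aD i) w \<noteq> 0" "w (Dc i) ^ e i * meval (aD i) w = meval (aN i) w"
      using w i unfolding W_def by auto
    have "a \<longlonglongrightarrow> meval (aN i) w / meval (aD i) w"
      unfolding a_def using wi(1) by (intro tendsto_divide tend)
    moreover have "meval (aN i) w / meval (aD i) w = w (Dc i) ^ e i" using wi by (simp add: field_simps)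
    ultimately have a: "a \<longlonglongrightarrow> w (Dc i) ^ e i" by simp
    have "\<forall>k. \<exists>y. y ^ e i = a k \<and> cmod (w (Dc i) - y) ^ e i \<le> cmod (w (Dc i) ^ e i - a k)"
      using exists_close_root[OF e_pos[OF i]] by blast
    then obtain y where y: "\<And>k. y k ^ e i = a k" "\<And>k. cmod (w (Dc i) - y k) ^ e i \<le> cmod (w (Dc i) ^ e i - a k)"
      by metis
    have "(\<lambda>k. cmod (w (Dc i) ^ e i - a k)) \<longlonglongrightarrow> 0"
      using tendsto_norm[OF tendsto_diff[OF tendsto_const[of "w (Dc i) ^ e i"] a]] by simp
    then have "(\<lambda>k. cmod (w (Dc i) - y k) ^ e i) \<longlonglongrightarrow> 0"
      by (rule tendsto_sandwich[OF _ _ tendsto_const, rotated 2]) (use y in auto)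
    then have "(\<lambda>k. root (e i) (cmod (w (Dc i) - y k) ^ e i)) \<longlonglongrightarrow> root (e i) 0"
      by (rule tendsto_real_root)
    then have "(\<lambda>k. cmod (w (Dc i) - y k)) \<longlonglongrightarrow> 0"
      using e_pos[OF i] by (simp add: real_root_power_cancel)
    then have "(\<lambda>k. w (Dc i) - y k) \<longlonglongrightarrow> 0" by (simp add: tendsto_norm_zero_iff)
    then have "(\<lambda>k. w (Dc i) - (w (Dc i) - y k)) \<longlonglongrightarrow> w (Dc i) - 0" by (intro tendsto_diff tendsto_const)
    then have y_lim: "y \<longlonglongrightarrow> w (Dc i)" by simp
    define u' where "u' k = (u k)(Dc i := y k)" for k
    have "(\<lambda>k. u' k v) \<longlonglongrightarrow> w v" for v
      using u(1)[of v] y_lim unfolding u'_def by (cases "v = Dc i") auto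
    moreover have "u' k v = 0" if "v \<notin> coordsA m r" for k v
      using that u(2) i unfolding u'_def coordsA_def by auto
    moreover have "\<forall>\<^sub>F k in sequentially. meval (aD i) (u k) \<noteq> 0"
      using tend wi(1) by (rule tendsto_imp_eventually_ne)
    with ev have "\<forall>\<^sub>F k in sequentially. q (u' k) \<noteq> 0 \<and>
        (\<forall>l<Suc i. u' k (Dc l) ^ e l * meval (aD l) (u' k) = meval (aN l) (u' k))"
    proof eventually_elim
      case (elim k)
      have q': "q (u' k) = q (u k)"
        using q(1) by (rule pfun_cong) (auto simp: u'_def)
      have ma: "meval (aN l) (u' k) = meval (aN l) (u k)" "meval (aD l) (u' k) = meval (aD l) (u k)" if "l < Suc i" for l
        using vars_a[of l] that i by (auto intro!: meval_cong[of _ "range Tc \<union> Dc ` {..<l}"] simp: u'_def)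
      have "u' k (Dc l) ^ e l * meval (aD l) (u' k) = meval (aN l) (u' k)" if "l < Suc i" for l
      proof (cases "l = i")
        case True
        then show ?thesis using elim y(1)[of k] ma[of i] by (simp add: u'_def a_def)
      next
        case False
        then show ?thesis using elim ma[of l] that by (simp add: u'_def)
      qed
      then show ?case using elim q' by simp
    qed
    ultimately show ?case by (intro exI[of _ u']) simp
  qed
  from this[of m] obtain u where u: "\<And>v. (\<lambda>k. u k v) \<longlonglongrightarrow> w v" "\<And>k v. v \<notin> coordsA m r \<Longrightarrow> u k v = 0"
    and ev: "\<forall>\<^sub>F k in sequentially. q (u k) \<noteq> 0 \<and>
      (\<forall>l<m. u k (Dc l) ^ e l * meval (aD l) (u k) = meval (aN l) (u k))" by auto
  have tend: "(\<lambda>k. meval f (u k)) \<longlonglongrightarrow> meval f w" for f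
    using pfun_meval[OF order_refl] by (rule pfun_tendsto) (rule u(1))
  define u' where "u' k v = (case v of Xc j \<Rightarrow> if j < r then meval (xN j) (u k) / meval (xD j) (u k) else 0 | _ \<Rightarrow> u k v)" for k v
  have "(\<lambda>k. u' k v) \<longlonglongrightarrow> w v" for v
  proof (cases "\<exists>j<r. v = Xc j")
    case True
    then obtain j where j: "j < r" "v = Xc j" by blast
    have wj: "meval (xD j) w \<noteq> 0" "w (Xc j) * meval (xD j) w = meval (xN j) w"
      using w j unfolding W_def by auto
    have "(\<lambda>k. meval (xN j) (u k) / meval (xD j) (u k)) \<longlonglongrightarrow> meval (xN j) w / meval (xD j) w"
      using wj(1) by (intro tendsto_divide tend)
    moreover have "meval (xN j) w / meval (xD j) w = w (Xc j)" using wj by (simp add: field_simps)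
    ultimately show ?thesis using j by (simp add: u'_def)
  next
    case False
    show ?thesis
    proof (cases v)
      case (Xc j)
      then have "w v = 0" using False by (intro wz) (auto simp: coordsA_def)
      then show ?thesis using False Xc by (auto simp: u'_def)
    qed (use u(1)[of v] in \<open>auto simp: u'_def\<close>)
  qed
  moreover have "\<forall>\<^sub>F k in sequentially. u' k \<in> W \<and> q (u' k) \<noteq> 0"
  proof -
    have "\<forall>\<^sub>F k in sequentially. \<forall>j\<in>{..<r}. meval (xD j) (u k) \<noteq> 0"
      using w by (intro eventually_ball_finite ballI tendsto_imp_eventually_ne[OF tend]) (auto simp: W_def)
    moreover have "\<forall>\<^sub>F k in sequentially. \<forall>i\<in>{..<m}. meval (aD i) (u k) \<noteq> 0"
      using w by (intro eventually_ball_finite ballI tendsto_imp_eventually_ne[OF tend]) (auto simp: W_def)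
    ultimately show ?thesis using ev
    proof eventually_elim
      case (elim k)
      have TD: "meval f (u' k) = meval f (u k)" if "mvars f \<subseteq> range Tc \<union> Dc ` {..<m}" for f
        using that by (rule meval_cong) (auto simp: u'_def)
      have "u' k v = 0" if "v \<notin> coordsA m r" for v
        using that u(2)[of v k] by (cases v) (auto simp: u'_def coordsA_def)
      then have "u' k \<in> aspace (coordsA m r)" unfolding aspace_def by blast
      moreover have "u' k (Dc i) = u k (Dc i)" for i by (simp add: u'_def)
      moreover have "u' k (Xc j) = meval (xN j) (u k) / meval (xD j) (u k)" if "j < r" for j
        using that by (simp add: u'_def)
      ultimately have "u' k \<in> W" unfolding W_def using elim by (simp add: TD vars_a_TD vars_x_TD)
      moreover have "q (u' k) = q (u k)" using q(1) by (rule pfun_cong) (auto simp: u'_def)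
      ultimately show ?case using elim by simp
    qed
  qed
  ultimately show ?thesis by (intro exI[of _ u']) blast
qed

lemma W_torsion_free:
  assumes q: "q \<in> pfun (range Tc)" "q p1 \<noteq> 0" and f: "f \<in> pfun (coordsA m r)"
    and zero: "vanishes (\<lambda>p. q p * f p) W"
  shows "vanishes f W"
proof
  fix w assume "w \<in> W"
  from W_approx[OF this q] obtain u where u: "\<And>v. (\<lambda>k. u k v) \<longlonglongrightarrow> w v"
    and ev: "\<forall>\<^sub>F k in sequentially. u k \<in> W \<and> q (u k) \<noteq> 0" by blast
  have "(\<lambda>k. f (u k)) \<longlonglongrightarrow> f w" using f by (rule pfun_tendsto) (rule u)
  moreover have "\<forall>\<^sub>F k in sequentially. f (u k) = 0" using ev
  proof eventually_elim
    case (elim k)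
    then have "q (u k) * f (u k) = 0" using zero by blast
    with elim show ?case by simp
  qed
  then have "(\<lambda>k. f (u k)) \<longlonglongrightarrow> 0" by (rule tendsto_eventually)
  ultimately show "f w = 0" by (rule LIMSEQ_unique)
qed

lemma component_indep:
  assumes C: "zcomponent (coordsA m r) (zclosure (coordsA m r) W) C"
  shows "indep_on (range Tc) C"
  unfolding indep_on_def
proof (intro ballI impI allI, rule ccontr)
  fix q p1 assume q: "q \<in> pfun (range Tc)" "vanishes q C" "q p1 \<noteq> 0"
  define A :: "'n coord set" where "A = coordsA m r"
  have irr: "zirreducible A C" and sub: "C \<subseteq> zclosure A W"
    and max: "\<And>C'. zirreducible A C' \<Longrightarrow> C \<subseteq> C' \<Longrightarrow> C' \<subseteq> zclosure A W \<Longrightarrow> C' = C"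
    using C unfolding zcomponent_def A_def by auto
  have "zclosed A (zclosure A W)" unfolding A_def using W_subset by (rule zclosed_zclosure)
  moreover have "finite A" unfolding A_def by (rule finite_coordsA)
  ultimately obtain \<C> where
    \<C>: "finite \<C>" "\<forall>X\<in>\<C>. zirreducible A X" "zclosure A W = \<Union>\<C>"
    using zclosed_decomposition by metis
  have "\<exists>f. f \<in> pfun A \<and> vanishes f X \<and> \<not> vanishes f C" if X: "X \<in> \<C> - {C}" for X
  proof -
    have "\<not> C \<subseteq> X" using max[of X] X \<C> by auto
    moreover have "zclosed A X" using X \<C>(2) by (auto intro: zirreducible_zclosed)
    ultimately obtain f where "f \<in> pfun A" "vanishes f X" "\<not> vanishes f C"
      using zclosed_not_subset[of A X C] zirreducible_subset_aspace[OF irr] by blast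
    then show ?thesis by blast
  qed
  then obtain f where f: "\<And>X. X \<in> \<C> - {C} \<Longrightarrow> f X \<in> pfun A \<and> vanishes (f X) X \<and> \<not> vanishes (f X) C"
    by metis
  define g where "g p = (\<Prod>X\<in>\<C> - {C}. f X p)" for p
  have gA: "g \<in> pfun A" unfolding g_def using f by (intro pfun_prod) auto
  have gC: "\<not> vanishes g C" unfolding g_def using irr \<C>(1) f by (intro zirreducible_prod) auto
  have "vanishes (\<lambda>p. q p * g p) W"
  proof
    fix w assume "w \<in> W"
    then obtain X where X: "X \<in> \<C>" "w \<in> X" using zclosure_subset[of W A] \<C>(3) by blast
    show "q w * g w = 0"
    proof (cases "X = C")
      case True
      then show ?thesis using X(2) q(2) by simp
    next
      case False
      then have "f X w = 0" using f[of X] X by blast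
      then have "g w = 0" unfolding g_def using \<C>(1) X(1) False by auto
      then show ?thesis by simp
    qed
  qed
  then have "vanishes g W" using W_torsion_free[OF q(1,3)] gA unfolding A_def by blast
  then have "vanishes g (zclosure A W)" using vanishes_zclosure[OF W_subset] gA unfolding A_def by blast
  then show False using gC sub by blast
qed

lemma component_dim:
  assumes C: "zcomponent (coordsA m r) (auxiliary_variety m r e aN aD xN xD) C"
  shows "zdim (coordsA m r) C CARD('n)"
  unfolding zdim_def
proof
  have irr: "zirreducible (coordsA m r) C" and sub: "C \<subseteq> zclosure (coordsA m r) W"
    using C unfolding zcomponent_def auxiliary_eq by auto
  have "\<exists>Z. zchain (coordsA m r) C (card (range (Tc :: 'n \<Rightarrow> 'n coord))) Z"
    using C unfolding auxiliary_eq
    by (intro indep_chain finite_coordsA irr component_indep) (auto simp: coordsA_def)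
  then show "\<exists>Z. zchain (coordsA m r) C CARD('n) Z" by (simp add: card_image[OF inj_Tc])
  show "\<not> (\<exists>Z. zchain (coordsA m r) C (Suc CARD('n)) Z)"
    by (rule dimension_bound) (rule rich_zclosure[OF W_subset], rule rich_mono[OF _ order_refl sub order_refl])
qed

end

subsection \<open>The incidence and radical varieties\<close>

lemma invertible_rows:
  fixes l :: "nat \<Rightarrow> complex^'n"
  assumes ker: "\<And>z. (\<And>j. j < r \<Longrightarrow> (\<Sum>k\<in>UNIV. l j $ k * z $ k) = 0) \<Longrightarrow> z = 0"
  obtains \<sigma> :: "'n \<Rightarrow> nat" and M where "inj \<sigma>" "\<And>i. \<sigma> i < r" "(\<chi> i. l (\<sigma> i)) ** M = mat 1"
proof -
  obtain B where B: "B \<subseteq> l ` {..<r}" "vec.independent B" "l ` {..<r} \<subseteq> vec.span B"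
    using vec.maximal_independent_subset by metis
  have finB: "finite B" using B(1) by (rule finite_subset) simp
  have "card B \<le> CARD('n)"
    using vec.independent_card_le_dim[OF subset_UNIV B(2)] unfolding vec_dim_card .
  then obtain h :: "complex^'n \<Rightarrow> 'n" where h: "inj_on h B"
    using card_le_inj[OF finB finite_class.finite_UNIV] by auto
  define A :: "complex^'n^'n" where "A = (\<chi> i. if i \<in> h ` B then the_inv_into B h i else 0)"
  have A_row: "A $ h b = b" if "b \<in> B" for b
    using that h by (simp add: A_def the_inv_into_f_f)
  have "z = 0" if "A *v z = 0" for z
  proof (rule ker)
    fix j assume "j < r"
    have sub: "vec.subspace {x. (\<Sum>k\<in>UNIV. x $ k * z $ k) = 0}"
      by (rule vec.subspaceI) (auto simp: algebra_simps sum.distrib simp flip: sum_distrib_left)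
    have "B \<subseteq> {x. (\<Sum>k\<in>UNIV. x $ k * z $ k) = 0}"
    proof
      fix b assume "b \<in> B"
      have "(A *v z) $ h b = (\<Sum>k\<in>UNIV. b $ k * z $ k)"
        unfolding matrix_vector_mult_def using A_row[OF \<open>b \<in> B\<close>] by simp
      then show "b \<in> {x. (\<Sum>k\<in>UNIV. x $ k * z $ k) = 0}" using that by simp
    qed
    from vec.span_minimal[OF this sub] B(3) \<open>j < r\<close> show "(\<Sum>k\<in>UNIV. l j $ k * z $ k) = 0" by blast
  qed
  then obtain A' where "A' ** A = mat 1" using matrix_left_invertible_ker[of A] by blast
  then have AA': "A ** A' = mat 1" by (simp add: matrix_left_right_inverse)
  have surj: "i \<in> h ` B" for i
  proof (rule ccontr)
    assume "i \<notin> h ` B"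
    then have "(A ** A') $ i $ i = 0" unfolding matrix_matrix_mult_def by (simp add: A_def)
    then show False unfolding AA' by (simp add: mat_def)
  qed
  have "\<exists>j<r. l j = A $ i" for i
  proof -
    obtain b where b: "b \<in> B" "i = h b" using surj by blast
    then show ?thesis using B(1) A_row by force
  qed
  then obtain \<sigma> where \<sigma>: "\<And>i. \<sigma> i < r" "\<And>i. l (\<sigma> i) = A $ i" by metis
  have "inj \<sigma>"
  proof (rule injI)
    fix i i' assume "\<sigma> i = \<sigma> i'"
    then have "A $ i = A $ i'" using \<sigma>(2) by metis
    moreover obtain b b' where "b \<in> B" "i = h b" "b' \<in> B" "i' = h b'" using surj by blast
    ultimately show "i = i'" using A_row by metis
  qed
  moreover have "(\<chi> i. l (\<sigma> i)) = A" by (simp add: \<sigma>(2) vec_eq_iff)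
  ultimately show thesis using that \<sigma>(1) AA' by metis
qed

lemma has_derivative_vec_lambda:
  fixes f :: "'n::finite \<Rightarrow> 'a::real_normed_vector \<Rightarrow> complex"
  assumes "\<And>i. (f i has_derivative f' i) (at t)"
  shows "((\<lambda>t. \<chi> i. f i t) has_derivative (\<lambda>z. \<chi> i. f' i z)) (at t)"
proof -
  have bl: "bounded_linear (axis i :: complex \<Rightarrow> complex^'n)" for i
    by (intro linear_conv_bounded_linear[THEN iffD1] linearI) (auto simp: vec_eq_iff axis_def)
  have eq: "(\<chi> i. g i) = (\<Sum>i\<in>UNIV. axis i (g i))" for g :: "'n \<Rightarrow> complex"
    by (simp add: vec_eq_iff axis_def)
  show ?thesis unfolding eq
    by (intro has_derivative_sum bounded_linear.has_derivative[OF bl] assms)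
qed

locale radical_parametrization = radical_equations m r e aN aD xN xD
  for m r e and aN aD xN xD :: "nat \<Rightarrow> ('n::finite) coord mpx" +
  fixes U :: "(complex^'n) set"
    and \<delta> :: "nat \<Rightarrow> complex^'n \<Rightarrow> complex"
  assumes U_open: "open U" and U_conn: "connected U" and U_ne: "U \<noteq> {}"
    and holo: "i < m \<Longrightarrow> holo_on (\<delta> i) U"
    and radical: "i < m \<Longrightarrow> t \<in> U \<Longrightarrow> \<delta> i t ^ e i * meval (aD i) (rp_env m \<delta> t) = meval (aN i) (rp_env m \<delta> t)"
    and aD_nz: "i < m \<Longrightarrow> \<exists>t\<in>U. meval (aD i) (rp_env m \<delta> t) \<noteq> 0"
    and xD_nz: "j < r \<Longrightarrow> \<exists>t\<in>U. meval (xD j) (rp_env m \<delta> t) \<noteq> 0"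
begin

abbreviation "env \<equiv> rp_env m \<delta>"
abbreviation "\<phi> \<equiv> rp_phi m r \<delta> xN xD"

definition Q :: "complex^'n \<Rightarrow> complex" where "Q t = (\<Prod>j<r. meval (xD j) (env t))"

definition P :: "complex^'n \<Rightarrow> complex" where "P t = Q t * (\<Prod>i<m. meval (aD i) (env t))"

definition U1 :: "(complex^'n) set" where "U1 = {t \<in> U. \<forall>j<r. meval (xD j) (env t) \<noteq> 0}"

definition U2 :: "(complex^'n) set" where "U2 = {t \<in> U. P t \<noteq> 0}"

lemma U1_eq: "U1 = {t \<in> U. Q t \<noteq> 0}"
  unfolding U1_def Q_def by auto

lemma U2_subset_U1: "U2 \<subseteq> U1"
  unfolding U1_eq U2_def P_def by auto

lemma holo_env:
  assumes "mvars f \<subseteq> range Tc \<union> Dc ` {..<m}"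
  shows "holo_on (\<lambda>t. meval f (env t)) U"
proof (rule holo_on_pfun[OF pfun_meval[OF assms]])
  fix v :: "'n coord" assume "v \<in> range Tc \<union> Dc ` {..<m}"
  then show "holo_on (\<lambda>t. env t v) U" by (auto simp: rp_env_def intro: holo_on_nth holo)
qed

lemma holo_Q: "holo_on Q U"
  unfolding Q_def by (intro holo_on_prod holo_env vars_x_TD) auto

lemma holo_P: "holo_on P U"
  unfolding P_def by (intro holo_on_mult holo_Q holo_on_prod holo_env vars_a_TD) auto

lemma open_U1: "open U1"
  unfolding U1_eq using holo_Q U_open by (rule open_nonzero)

lemma P_nonzero: "\<not> vanishes P U"
proof -
  have "\<exists>t\<in>U. (\<Prod>j<r. meval (xD j) (env t)) \<noteq> 0"
    by (intro holo_prod_nonzero U_open U_conn U_ne conjI holo_env vars_x_TD xD_nz) auto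
  then have "\<not> vanishes Q U" unfolding Q_def by blast
  moreover have "\<exists>t\<in>U. (\<Prod>i<m. meval (aD i) (env t)) \<noteq> 0"
    by (intro holo_prod_nonzero U_open U_conn U_ne conjI holo_env vars_a_TD aD_nz) auto
  moreover have "holo_on (\<lambda>t. \<Prod>i<m. meval (aD i) (env t)) U"
    by (intro holo_on_prod holo_env vars_a_TD) auto
  ultimately show ?thesis
    unfolding P_def using holo_mult_zero[OF holo_Q _ U_open U_conn] by blast
qed

lemma U2_nonempty: "U2 \<noteq> {}"
  using P_nonzero unfolding U2_def by blast

lemma phi_env: "mvars f \<subseteq> range Tc \<union> Dc ` {..<m} \<Longrightarrow> meval f (\<phi> t) = meval f (env t)"
  by (rule meval_cong) (auto simp: rp_phi_def rp_env_def)

lemma phi_aspace: "\<phi> t \<in> aspace (coordsA m r)"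
  unfolding aspace_def coordsA_def rp_phi_def by (auto split: coord.split)

lemma phi_W:
  assumes "t \<in> U2"
  shows "\<phi> t \<in> W"
proof -
  have t: "t \<in> U" "\<And>j. j < r \<Longrightarrow> meval (xD j) (env t) \<noteq> 0" "\<And>i. i < m \<Longrightarrow> meval (aD i) (env t) \<noteq> 0"
    using assms unfolding U2_def P_def Q_def by auto
  have "\<phi> t (Dc i) = \<delta> i t" if "i < m" for i using that by (simp add: rp_phi_def)
  moreover have "\<phi> t (Xc j) * meval (xD j) (env t) = meval (xN j) (env t)" if "j < r" for j
    using that t(2) by (simp add: rp_phi_def rp_x_def)
  ultimately show ?thesis
    unfolding W_def using t phi_aspace radical by (simp add: phi_env vars_a_TD vars_x_TD)
qed

lemma clear_denominators:
  assumes "f \<in> pfun (coordsA m r)"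
  shows "\<exists>N h. holo_on h U \<and> (\<forall>t\<in>U1. f (\<phi> t) * Q t ^ N = h t)"
  using assms
proof (induction rule: pfun_induct)
  case (const c)
  show ?case by (intro exI[of _ 0] exI[of _ "\<lambda>_. c"]) (simp add: holo_on_const)
next
  case (var v)
  then consider k where "v = Tc k" | i where "i < m" "v = Dc i" | j where "j < r" "v = Xc j"
    unfolding coordsA_def by auto
  then show ?case
  proof cases
    case 1
    then show ?thesis
      by (intro exI[of _ 0] exI[of _ "\<lambda>t. t $ k"]) (simp add: holo_on_nth rp_phi_def)
  next
    case 2
    then show ?thesis
      by (intro exI[of _ 0] exI[of _ "\<delta> i"]) (simp add: holo rp_phi_def)
  next
    case 3
    define h where "h t = meval (xN j) (env t) * (\<Prod>l\<in>{..<r} - {j}. meval (xD l) (env t))" for t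
    have "holo_on h U"
      unfolding h_def using 3(1) by (intro holo_on_mult holo_on_prod holo_env vars_x_TD) auto
    moreover have "\<phi> t v * Q t ^ 1 = h t" if "t \<in> U1" for t
    proof -
      have "Q t = meval (xD j) (env t) * (\<Prod>l\<in>{..<r} - {j}. meval (xD l) (env t))"
        unfolding Q_def using 3(1) by (intro prod.remove) auto
      moreover have "meval (xD j) (env t) \<noteq> 0" using that 3(1) unfolding U1_def by blast
      ultimately show ?thesis using 3 unfolding h_def by (simp add: rp_phi_def rp_x_def)
    qed
    ultimately show ?thesis by blast
  qed
next
  case (add f g)
  then obtain N h M k where h: "holo_on h U" "\<And>t. t \<in> U1 \<Longrightarrow> f (\<phi> t) * Q t ^ N = h t"
    and k: "holo_on k U" "\<And>t. t \<in> U1 \<Longrightarrow> g (\<phi> t) * Q t ^ M = k t" by metis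
  have "holo_on (\<lambda>t. h t * Q t ^ M + k t * Q t ^ N) U"
    by (intro holo_on_add holo_on_mult holo_on_power holo_Q h k)
  moreover have "(f (\<phi> t) + g (\<phi> t)) * Q t ^ (N + M) = h t * Q t ^ M + k t * Q t ^ N" if "t \<in> U1" for t
    by (simp add: power_add algebra_simps flip: h(2)[OF that] k(2)[OF that])
  ultimately show ?case by blast
next
  case (mult f g)
  then obtain N h M k where h: "holo_on h U" "\<And>t. t \<in> U1 \<Longrightarrow> f (\<phi> t) * Q t ^ N = h t"
    and k: "holo_on k U" "\<And>t. t \<in> U1 \<Longrightarrow> g (\<phi> t) * Q t ^ M = k t" by metis
  have "holo_on (\<lambda>t. h t * k t) U" by (intro holo_on_mult h k)
  moreover have "(f (\<phi> t) * g (\<phi> t)) * Q t ^ (N + M) = h t * k t" if "t \<in> U1" for t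
    by (simp add: power_add algebra_simps flip: h(2)[OF that] k(2)[OF that])
  ultimately show ?case by blast
qed

lemma phi_prime:
  assumes f: "f \<in> pfun (coordsA m r)" and g: "g \<in> pfun (coordsA m r)"
    and zero: "vanishes (\<lambda>p. f p * g p) (\<phi> ` U2)"
  shows "vanishes f (\<phi> ` U1) \<or> vanishes g (\<phi> ` U1)"
proof -
  obtain N h where h: "holo_on h U" "\<And>t. t \<in> U1 \<Longrightarrow> f (\<phi> t) * Q t ^ N = h t"
    using clear_denominators[OF f] by blast
  obtain M k where k: "holo_on k U" "\<And>t. t \<in> U1 \<Longrightarrow> g (\<phi> t) * Q t ^ M = k t"
    using clear_denominators[OF g] by blast
  have "vanishes (\<lambda>t. (h t * k t) * P t) U"
  proof
    fix t assume "t \<in> U"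
    show "(h t * k t) * P t = 0"
    proof (cases "t \<in> U2")
      case True
      then have "t \<in> U1" using U2_subset_U1 by blast
      moreover have "f (\<phi> t) * g (\<phi> t) = 0" using zero True by blast
      ultimately show ?thesis using h(2)[of t] k(2)[of t] by auto
    next
      case False
      then show ?thesis using \<open>t \<in> U\<close> unfolding U2_def by simp
    qed
  qed
  then have "vanishes (\<lambda>t. h t * k t) U"
    using holo_mult_zero[OF holo_on_mult[OF h(1) k(1)] holo_P U_open U_conn] P_nonzero by blast
  then have "vanishes h U \<or> vanishes k U" by (rule holo_mult_zero[OF h(1) k(1) U_open U_conn])
  moreover have "f (\<phi> t) = 0" if "vanishes h U" "t \<in> U1" for t
    using h(2)[of t] that unfolding U1_eq by auto
  moreover have "g (\<phi> t) = 0" if "vanishes k U" "t \<in> U1" for t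
    using k(2)[of t] that unfolding U1_eq by auto
  ultimately show ?thesis by blast
qed

lemma phi_vanishes: "f \<in> pfun (coordsA m r) \<Longrightarrow> vanishes f (\<phi> ` U2) \<longleftrightarrow> vanishes f (\<phi> ` U1)"
proof
  assume f: "f \<in> pfun (coordsA m r)"
  assume "vanishes f (\<phi> ` U2)"
  then have "vanishes f (\<phi> ` U1) \<or> vanishes (\<lambda>p. 1) (\<phi> ` U1)"
    by (intro phi_prime f pfun_const) simp
  then show "vanishes f (\<phi> ` U1)" using U2_nonempty U2_subset_U1 by auto
next
  show "vanishes f (\<phi> ` U1) \<Longrightarrow> vanishes f (\<phi> ` U2)" using U2_subset_U1 by blast
qed

lemma incidence_eq: "incidence_variety m r U \<delta> xN xD = zclosure (coordsA m r) (\<phi> ` U1)"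
  unfolding incidence_variety_def U1_def ..

lemma incidence_eq': "incidence_variety m r U \<delta> xN xD = zclosure (coordsA m r) (\<phi> ` U2)"
proof -
  have "\<phi> ` U1 \<subseteq> aspace (coordsA m r)" "\<phi> ` U2 \<subseteq> aspace (coordsA m r)" using phi_aspace by auto
  then show ?thesis unfolding incidence_eq
    by (simp only: zclosure_eq) (intro Collect_cong conj_cong refl ball_cong, simp only: phi_vanishes)
qed

lemma incidence_irreducible: "zirreducible (coordsA m r) (incidence_variety m r U \<delta> xN xD)"
  unfolding incidence_eq'
proof (rule zirreducible_zclosure)
  show "\<phi> ` U2 \<subseteq> aspace (coordsA m r)" using phi_aspace by auto
  show "\<phi> ` U2 \<noteq> {}" using U2_nonempty by simp
  show "vanishes f (\<phi> ` U2) \<or> vanishes g (\<phi> ` U2)"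
    if "f \<in> pfun (coordsA m r)" "g \<in> pfun (coordsA m r)" "vanishes (\<lambda>p. f p * g p) (\<phi> ` U2)" for f g
    using phi_prime[OF that] U2_subset_U1 by blast
qed

lemma rich_incidence:
  assumes "rich (coordsA m r) (incidence_variety m r U \<delta> xN xD) s k"
  shows "rich (coordsA m r) W s k"
proof -
  have "\<phi> ` U2 \<subseteq> aspace (coordsA m r)" using phi_aspace by auto
  then have "rich (coordsA m r) (\<phi> ` U2) s k" using assms unfolding incidence_eq' by (rule rich_zclosure)
  then show ?thesis using phi_W by (auto intro: rich_mono)
qed

lemma incidence_dim: "zdim (coordsA m r) (incidence_variety m r U \<delta> xN xD) CARD('n)"
  unfolding zdim_def
proof
  have "indep_on (range Tc) (incidence_variety m r U \<delta> xN xD)"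
    unfolding indep_on_def
  proof (intro ballI impI allI)
    fix f p assume f: "f \<in> pfun (range Tc)" "vanishes f (incidence_variety m r U \<delta> xN xD)"
    show "f p = 0"
    proof (rule pfun_zero_on_open[OF f(1) inj_Tc open_U1])
      show "U1 \<noteq> {}" using U2_nonempty U2_subset_U1 by blast
      fix y assume "y \<in> U1"
      then have "\<phi> y \<in> incidence_variety m r U \<delta> xN xD"
        unfolding incidence_eq using zclosure_subset by blast
      then have "f (\<phi> y) = 0" using f(2) by blast
      then show "\<exists>p. (\<forall>k. p (Tc k) = y $ k) \<and> f p = 0"
        by (intro exI[of _ "\<phi> y"]) (simp add: rp_phi_def)
    qed
  qed
  then have "\<exists>Z. zchain (coordsA m r) (incidence_variety m r U \<delta> xN xD) (card (range (Tc :: 'n \<Rightarrow> 'n coord))) Z"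
    by (intro indep_chain finite_coordsA incidence_irreducible) (auto simp: coordsA_def)
  then show "\<exists>Z. zchain (coordsA m r) (incidence_variety m r U \<delta> xN xD) CARD('n) Z"
    by (simp add: card_image[OF inj_Tc])
  show "\<not> (\<exists>Z. zchain (coordsA m r) (incidence_variety m r U \<delta> xN xD) (Suc CARD('n)) Z)"
    by (rule dimension_bound) (rule rich_incidence)
qed

abbreviation "projX \<equiv> proj (coordsX r) ` incidence_variety m r U \<delta> xN xD"

lemma projX_subset: "projX \<subseteq> aspace (coordsX r)"
  unfolding proj_def aspace_def by auto

lemma projX_eval: "f \<in> pfun (coordsX r) \<Longrightarrow> f (proj (coordsX r) p) = f p"
  by (rule pfun_cong[of f "coordsX r"]) (auto simp: proj_def)

lemma radical_irreducible: "zirreducible (coordsX r) (radical_variety m r U \<delta> xN xD)"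
  unfolding radical_variety_def
proof (rule zirreducible_zclosure[OF projX_subset])
  show "projX \<noteq> {}" using zirreducible_nonempty[OF incidence_irreducible] by simp
  fix f g :: "('n coord \<Rightarrow> complex) \<Rightarrow> complex"
  assume fg: "f \<in> pfun (coordsX r)" "g \<in> pfun (coordsX r)" "vanishes (\<lambda>p. f p * g p) projX"
  then have "vanishes (\<lambda>p. f p * g p) (incidence_variety m r U \<delta> xN xD)"
    by (simp add: projX_eval)
  then have "vanishes f (incidence_variety m r U \<delta> xN xD) \<or> vanishes g (incidence_variety m r U \<delta> xN xD)"
    using fg by (intro zirreducibleD[OF incidence_irreducible] pfun_mono[OF _ coordsX_subset])
  then show "vanishes f projX \<or> vanishes g projX" using fg by (simp add: projX_eval)
qed

lemma open_image_of_coordinates: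
  assumes t0: "t0 \<in> U1" and L: "\<And>j. j < r \<Longrightarrow> (rp_x m \<delta> xN xD j has_derivative L j) (at t0)"
    and ker: "\<And>z. (\<And>j. j < r \<Longrightarrow> L j z = 0) \<Longrightarrow> z = 0"
  obtains \<sigma> :: "'n \<Rightarrow> nat" where "inj \<sigma>" "\<And>i. \<sigma> i < r"
    "interior ((\<lambda>t. \<chi> i. rp_x m \<delta> xN xD (\<sigma> i) t) ` U1) \<noteq> {}"
proof -
  have holo_x: "holo_on (rp_x m \<delta> xN xD j) U1" if "j < r" for j
  proof -
    have "U1 \<subseteq> U" unfolding U1_def by blast
    then have "holo_on (\<lambda>t. meval (xN j) (env t) / meval (xD j) (env t)) U1"
      using that by (intro holo_on_divide holo_on_subset[OF holo_env] vars_x_TD) (auto simp: U1_def)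
    moreover have "(\<lambda>t. meval (xN j) (env t) / meval (xD j) (env t)) = rp_x m \<delta> xN xD j"
      by (auto simp: rp_x_def)
    ultimately show ?thesis by simp
  qed
  define l where "l j = (\<chi> k. L j (axis k 1))" for j
  have Ll: "L j z = (\<Sum>k\<in>UNIV. l j $ k * z $ k)" if j: "j < r" for j z
  proof -
    obtain L' where L': "(rp_x m \<delta> xN xD j has_derivative L') (at t0)" "\<And>c z. L' (c *s z) = c * L' z"
      using holo_onE[OF holo_x[OF j] t0] by blast
    have "L j = L'" using has_derivative_unique[OF L[OF j] L'(1)] .
    then have hom: "L j (c *s z) = c * L j z" for c z using L'(2) by simp
    have "linear (L j)" using has_derivative_linear[OF L[OF j]] .
    have "z = (\<Sum>k\<in>UNIV. z $ k *s axis k 1)" by (simp add: vec_eq_iff axis_def if_distrib cong: if_cong)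
    then have "L j z = L j (\<Sum>k\<in>UNIV. z $ k *s axis k 1)" by simp
    also have "\<dots> = (\<Sum>k\<in>UNIV. L j (z $ k *s axis k 1))" using \<open>linear (L j)\<close> by (rule linear_sum)
    finally show ?thesis by (simp add: hom l_def mult.commute)
  qed
  obtain \<sigma> :: "'n \<Rightarrow> nat" and M where \<sigma>: "inj \<sigma>" "\<And>i. \<sigma> i < r" and M: "(\<chi> i. l (\<sigma> i)) ** M = mat 1"
    using invertible_rows[of r l] ker Ll by metis
  define F where "F t = (\<chi> i. rp_x m \<delta> xN xD (\<sigma> i) t)" for t
  have "F t0 \<in> interior (F ` U1)"
  proof (rule sussmann_open_mapping)
    show "open U1" by (rule open_U1)
    show "continuous_on U1 F"
      unfolding F_def by (intro continuous_on_vec_lambda holo_on_continuous holo_x \<sigma>)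
    show "t0 \<in> U1" by fact
    have "(F has_derivative (\<lambda>z. \<chi> i. L (\<sigma> i) z)) (at t0)"
      unfolding F_def using \<sigma>(2) by (intro has_derivative_vec_lambda L)
    moreover have "(\<lambda>z. \<chi> i. L (\<sigma> i) z) = (*v) (\<chi> i. l (\<sigma> i))"
      by (simp add: fun_eq_iff vec_eq_iff matrix_vector_mult_def Ll \<sigma>(2))
    ultimately show "(F has_derivative (*v) (\<chi> i. l (\<sigma> i))) (at t0)" by simp
    show "bounded_linear ((*v) M)" by simp
    show "(*v) (\<chi> i. l (\<sigma> i)) \<circ> (*v) M = id"
      by (simp add: fun_eq_iff matrix_vector_mul_assoc M)
    show "U1 \<subseteq> U1" by simp
    show "t0 \<in> interior U1" using t0 open_U1 by (simp add: interior_open)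
  qed
  then show thesis using that[OF \<sigma>] unfolding F_def by blast
qed

lemma radical_dim:
  assumes t0: "t0 \<in> U1" and L: "\<And>j. j < r \<Longrightarrow> (rp_x m \<delta> xN xD j has_derivative L j) (at t0)"
    and ker: "\<And>z. (\<And>j. j < r \<Longrightarrow> L j z = 0) \<Longrightarrow> z = 0"
  shows "zdim (coordsX r) (radical_variety m r U \<delta> xN xD) CARD('n)"
  unfolding zdim_def
proof
  obtain \<sigma> :: "'n \<Rightarrow> nat" where \<sigma>: "inj \<sigma>" "\<And>i. \<sigma> i < r"
    and int: "interior ((\<lambda>t. \<chi> i. rp_x m \<delta> xN xD (\<sigma> i) t) ` U1) \<noteq> {}" (is "interior ?I \<noteq> {}")
    using open_image_of_coordinates[OF t0 L ker] by metis
  define \<tau> :: "'n \<Rightarrow> 'n coord" where "\<tau> k = Xc (\<sigma> k)" for k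
  have \<tau>: "inj \<tau>" using \<sigma>(1) unfolding \<tau>_def by (auto simp: inj_def)
  have sub: "range \<tau> \<subseteq> coordsX r" using \<sigma>(2) unfolding \<tau>_def coordsX_def by auto
  have "indep_on (range \<tau>) (radical_variety m r U \<delta> xN xD)"
    unfolding indep_on_def
  proof (intro ballI impI allI)
    fix f p assume f: "f \<in> pfun (range \<tau>)" "vanishes f (radical_variety m r U \<delta> xN xD)"
    show "f p = 0"
    proof (rule pfun_zero_on_open[OF f(1) \<tau> open_interior int])
      fix y assume "y \<in> interior ?I"
      then obtain t where t: "t \<in> U1" "y = (\<chi> i. rp_x m \<delta> xN xD (\<sigma> i) t)"
        using interior_subset by blast
      have "\<phi> t \<in> incidence_variety m r U \<delta> xN xD"
        unfolding incidence_eq using zclosure_subset t(1) by blast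
      then have "proj (coordsX r) (\<phi> t) \<in> radical_variety m r U \<delta> xN xD"
        unfolding radical_variety_def using zclosure_subset by blast
      then have "f (proj (coordsX r) (\<phi> t)) = 0" using f(2) by blast
      then show "\<exists>p. (\<forall>k. p (\<tau> k) = y $ k) \<and> f p = 0"
        using \<sigma>(2) t(2)
        by (intro exI[of _ "proj (coordsX r) (\<phi> t)"]) (auto simp: \<tau>_def proj_def coordsX_def rp_phi_def)
    qed
  qed
  then have "\<exists>Z. zchain (coordsX r) (radical_variety m r U \<delta> xN xD) (card (range \<tau>)) Z"
    using sub by (intro indep_chain radical_irreducible) (auto simp: coordsX_def)
  then show "\<exists>Z. zchain (coordsX r) (radical_variety m r U \<delta> xN xD) CARD('n) Z"
    by (simp add: card_image[OF \<tau>])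
  show "\<not> (\<exists>Z. zchain (coordsX r) (radical_variety m r U \<delta> xN xD) (Suc CARD('n)) Z)"
    unfolding radical_variety_def
    by (rule dimension_bound)
      (rule rich_incidence, rule rich_proj[OF _ coordsX_subset], rule rich_zclosure[OF projX_subset])
qed

end

theorem theorem3p11:
  fixes m r :: nat
    and e :: "nat \<Rightarrow> nat"
    and aN aD xN xD :: "nat \<Rightarrow> ('n::finite) coord mpx"
    and U :: "(complex^'n) set"
    and \<delta> :: "nat \<Rightarrow> complex^'n \<Rightarrow> complex"
  assumes r_gt: "r > CARD('n)"
    and e_pos: "\<forall>i<m. e i > 0"
    and vars_a: "\<forall>i<m. mvars (aN i) \<union> mvars (aD i) \<subseteq> range Tc \<union> Dc ` {..<i}"
    and vars_x: "\<forall>j<r. mvars (xN j) \<union> mvars (xD j) \<subseteq> range Tc \<union> Dc ` {..<m}"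
    and U_open: "open U" and U_conn: "connected U" and U_ne: "U \<noteq> {}"
    and holo: "\<forall>i<m. holo_on (\<delta> i) U"
    and radical: "\<forall>i<m. \<forall>t\<in>U. \<delta> i t ^ e i * meval (aD i) (rp_env m \<delta> t) = meval (aN i) (rp_env m \<delta> t)"
    and aD_nz: "\<forall>i<m. \<exists>t\<in>U. meval (aD i) (rp_env m \<delta> t) \<noteq> 0"
    and xD_nz: "\<forall>j<r. \<exists>t\<in>U. meval (xD j) (rp_env m \<delta> t) \<noteq> 0"
    and rank: "\<exists>t\<in>U. (\<forall>j<r. meval (xD j) (rp_env m \<delta> t) \<noteq> 0) \<and>
                 (\<exists>L. (\<forall>j<r. (rp_x m \<delta> xN xD j has_derivative L j) (at t)) \<and>
                      (\<forall>z. (\<forall>j<r. L j z = 0) \<longrightarrow> z = 0))"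
  shows "(\<forall>C. zcomponent (coordsA m r) (auxiliary_variety m r e aN aD xN xD) C
                \<longrightarrow> zdim (coordsA m r) C CARD('n))
       \<and> zirreducible (coordsA m r) (incidence_variety m r U \<delta> xN xD)
       \<and> zdim (coordsA m r) (incidence_variety m r U \<delta> xN xD) CARD('n)
       \<and> zirreducible (coordsX r) (radical_variety m r U \<delta> xN xD)
       \<and> zdim (coordsX r) (radical_variety m r U \<delta> xN xD) CARD('n)"
proof -
  interpret radical_parametrization m r e aN aD xN xD U \<delta>
    by unfold_locales (use e_pos vars_a vars_x U_open U_conn U_ne holo radical aD_nz xD_nz in blast)+
  from rank obtain t0 L where t0: "t0 \<in> U1"
    and L: "\<And>j. j < r \<Longrightarrow> (rp_x m \<delta> xN xD j has_derivative L j) (at t0)"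
    and ker: "\<And>z. \<forall>j<r. L j z = 0 \<Longrightarrow> z = 0"
    unfolding U1_def by blast
  have "zdim (coordsX r) (radical_variety m r U \<delta> xN xD) CARD('n)"
    using t0 L by (rule radical_dim) (auto intro: ker)
  then show ?thesis
    using component_dim incidence_irreducible incidence_dim radical_irreducible by blast
qed

end
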